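(* There exists an absolute constant $c>0$ such that for all integers $n\geq 2$, the logarithmic Sobolev constant $\mathrm{C}_{\mathsf{LS}}$ of the Markov chain on $\Omega=\mathrm{SL}_n(\mathbb{Z}_2)$ with transition matrix $P$ (the random walk generated by elementary transvections) satisfies \[ \mathrm{C}_{\mathsf{LS}}\;\leq\; c\,n^2. \]
   Context: Let $\mathbb{Z}_2$ be the field with two elements and let $\Omega=\mathrm{SL}_n(\mathbb{Z}_2)$ be the set of invertible $n\times n$ matrices with entries in $\mathbb{Z}_2$. For $1\leq i\neq j\leq n$, let $E_{i,j}$ be the $n\times n$ matrix with a $1$ in position $(i,j)$ and $0$ elsewhere. The transition matrix $P$ on $\Omega$ is defined by \[ P(x,y)=\begin{cases}\frac{1}{n(n-1)} & \text{if } y=(I+E_{i,j})x \text{ for some } 1\leq i\neq j\leq n,\\ 0 & \text{otherwise.}\end{cases} \] That is, at each step an ordered pair of distinct rows is picked uniformly at random and one is added to the other modulo $2$. The matrix $P$ is symmetric and the uniform distribution $\pi$ on $\Omega$ is its unique stationary distribution. For $f\colon\Omega\to\mathbb{R}$, let $\mathbb{E}_\pi[f]=\sum_{x\in\Omega}\pi(x)f(x)$, let \[ \mathrm{Ent}_\pi(f^2)=\mathbb{E}_\pi[f^2\log f^2]-\mathbb{E}_\pi[f^2]\log\mathbb{E}_\pi[f^2] \] (with natural logarithm and the convention $0\log 0=0$), and let the Dirichlet form be \[ \mathcal{E}_P(f,f)=\frac12\sum_{x,y\in\Omega}\pi(x)P(x,y)\left(f(x)-f(y)\right)^2. \] The logarithmic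 Sobolev constant $\mathrm{C}_{\mathsf{LS}}$ of $P$ is the smallest constant $c'>0$ such that $\mathrm{Ent}_\pi(f^2)\leq c'\,\mathcal{E}_P(f,f)$ for all functions $f\colon\Omega\to\mathbb{R}$. "Absolute constant" means a constant that does not depend on $n$. *)

theory Defs
  imports
    Complex_Main
    "HOL-Library.Z2"
    "Jordan_Normal_Form.Matrix"
begin

section \<open>Logarithmic Sobolev constant of a finite Markov chain\<close>

text \<open>
  A chain is given by a finite state space \<open>S\<close>, a stationary distribution \<open>p\<close> and a transition
  matrix \<open>P\<close>; functions are only ever evaluated on \<open>S\<close>.
\<close>

definition expect :: "'a set \<Rightarrow> ('a \<Rightarrow> real) \<Rightarrow> ('a \<Rightarrow> real) \<Rightarrow> real" where
  "expect S p g = (\<Sum>x\<in>S. p x * g x)"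

text \<open>
  The convention \<open>0 log 0 = 0\<close> holds automatically, since \<open>0 * ln 0 = 0\<close> whatever \<open>ln 0\<close> is.
\<close>

definition Ent :: "'a set \<Rightarrow> ('a \<Rightarrow> real) \<Rightarrow> ('a \<Rightarrow> real) \<Rightarrow> real" where
  "Ent S p g = expect S p (\<lambda>x. g x * ln (g x)) - expect S p g * ln (expect S p g)"

definition dirichlet_form ::
  "'a set \<Rightarrow> ('a \<Rightarrow> real) \<Rightarrow> ('a \<Rightarrow> 'a \<Rightarrow> real) \<Rightarrow> ('a \<Rightarrow> real) \<Rightarrow> real" where
  "dirichlet_form S p P f = 1 / 2 * (\<Sum>x\<in>S. \<Sum>y\<in>S. p x * P x y * (f x - f y)\<^sup>2)"

definition log_sobolev_inequality ::
  "'a set \<Rightarrow> ('a \<Rightarrow> real) \<Rightarrow> ('a \<Rightarrow> 'a \<Rightarrow> real) \<Rightarrow> real \<Rightarrow> bool" where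
  "log_sobolev_inequality S p P c \<longleftrightarrow>
     (\<forall>f :: 'a \<Rightarrow> real. Ent S p (\<lambda>x. (f x)\<^sup>2) \<le> c * dirichlet_form S p P f)"

text \<open>
  ``The smallest constant'' is a relation rather than a function (\<open>LEAST\<close> or \<open>Inf\<close>), so that no
  arbitrary value enters when there is no such constant.  There is at most one \<open>C\<close> satisfying it.
\<close>

definition is_log_sobolev_constant ::
  "'a set \<Rightarrow> ('a \<Rightarrow> real) \<Rightarrow> ('a \<Rightarrow> 'a \<Rightarrow> real) \<Rightarrow> real \<Rightarrow> bool" where
  "is_log_sobolev_constant S p P C \<longleftrightarrow>
     C > 0 \<and> log_sobolev_inequality S p P C \<and>
     (\<forall>c'>0. log_sobolev_inequality S p P c' \<longrightarrow> C \<le> c')"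

section \<open>The transvection walk on $\mathrm{SL}_n(\mathbb{Z}_2)$\<close>

text \<open>
  The two-element field is the type \<open>bit\<close>; rows and columns are indexed by \<open>0, \<dots>, n - 1\<close>.
  Over this field every invertible matrix has determinant 1.
\<close>

definition SL_Z2 :: "nat \<Rightarrow> bit mat set" where
  "SL_Z2 n = {x \<in> carrier_mat n n. invertible_mat x}"

definition elem_mat :: "nat \<Rightarrow> nat \<Rightarrow> nat \<Rightarrow> bit mat" where
  "elem_mat n i j = mat n n (\<lambda>(k, l). if k = i \<and> l = j then 1 else 0)"

definition transvection_P :: "nat \<Rightarrow> bit mat \<Rightarrow> bit mat \<Rightarrow> real" where
  "transvection_P n x y =
     (if \<exists>i<n. \<exists>j<n. i \<noteq> j \<and> y = (1\<^sub>m n + elem_mat n i j) * x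
      then 1 / (real n * (real n - 1)) else 0)"

definition unif :: "'a set \<Rightarrow> 'a \<Rightarrow> real" where
  "unif S x = 1 / real (card S)"

end

theory Submission
  imports Defs "HOL-Analysis.Infinite_Products" "HOL-Real_Asymp.Real_Asymp" "Jordan_Normal_Form.Determinant"
begin

text \<open>
  For a set \<open>A\<close> of rows let \<open>K\<close> be the group of invertible matrices acting on the rows in \<open>A\<close> only. It
  suffices to bound the entropy of \<open>g = f\<^sup>2\<close> on the cosets of \<open>K\<close> by a constant times the sum over the
  transvections of \<open>K\<close> of the squared increments of \<open>sqrt g\<close>, with a constant independent of \<open>A\<close>.

  Split \<open>A\<close> into \<open>A1\<close> and \<open>A2\<close> with \<open>card A2\<close> exceeding \<open>card A1\<close> by about 28, and let \<open>S1\<close>, \<open>S2\<close> be the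
  subgroups of \<open>K\<close> changing only the rows in \<open>A2\<close>, respectively in \<open>A1\<close>. Under the uniform distribution
  on \<open>K\<close>, the rows in \<open>A1\<close> and the rows in \<open>A2\<close> have a joint density of at most 16 with respect to the product
  of their marginals, and their maximal correlation is tiny because a uniform \<open>card A1\<close> by \<open>card A2\<close>
  matrix has full row rank with overwhelming probability. This yields a hypercontractive inequality with
  exponents 4/3, which is dual to the factorization \<open>Ent K \<le> 3/2 * (Ent S1 + Ent S2)\<close>.

  The entropy on \<open>S2\<close> splits into that of the abelian group adding combinations of the rows in \<open>A2\<close> to the rows in
  \<open>A1\<close>, a hypercube for which entropy tensorizes over the transvections without any loss, and that of the
  group acting on the rows in \<open>A1\<close>; similarly for \<open>S1\<close>. Averaging over all splittings, a pair of rows lies on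
  the same side with probability at most 3/5, so the constants satisfy
  \<open>c(A) \<le> 3/2 * (3/5 * c + 2/5 * 4)\<close> and stay bounded.
\<close>

section \<open>Averages over subgroups and relative entropy\<close>

text \<open>As a pair lies on the same side with proportion close to 1/2, a factor below 2 keeps the
  constants bounded. Hypercontractivity with exponents 1/theta yields the factor theta / (2 theta -
  1), so theta must exceed 2/3; theta = 3/4 gives 3/2, and 3/2 * 3/5 = 9/10 is below 1.

  A bounded density alone cannot give the constant 1 in the hypercontractive inequality: functions
  close to 1 must gain from small correlation. This forces A2 to be larger than A1, so that a random
  A1 by A2 block has a right inverse except with probability at most 2^-28. The imbalance is
  bounded, so for large sets it hardly changes the proportion 1/2, and bounded sets are treated
  crudely. Nothing here depends on n; the n^2 of the theorem is the normalization of the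
  walk.\<close>

lemma truncated_cube_le:
  fixes t l :: real
  assumes t: "0 \<le> t" and l: "1 \<le> l"
  defines "s \<equiv> min t l"
  shows "s ^ 3 + 1 / (4 * (l\<^sup>2 + l + 1)) * (s ^ 3 - 1)\<^sup>2 + l * (t ^ 3 - s ^ 3) \<le> 1/4 + 3/4 * t ^ 4"
proof -
  \<comment> \<open>Young's inequality \<open>u ^ 3 \<le> 1/4 + 3/4 * u ^ 4\<close> has slack (u -
    1)^2 (3 u^2 + 2 u + 1) / 4. Below the level \<open>l\<close> it pays for a multiple of (u^3 -
    1)^2, which has the same double root and a bounded cofactor.\<close>
  have small: "u ^ 3 + 1 / (4 * (l\<^sup>2 + l + 1)) * (u ^ 3 - 1)\<^sup>2 \<le> 1/4 + 3/4 * u ^ 4"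
    if u: "0 \<le> u" "u \<le> l" for u :: real
  proof -
    let ?q = "u\<^sup>2 + u + 1"
    have q: "1 \<le> ?q" "?q \<le> l\<^sup>2 + l + 1" using u by (auto intro!: add_mono power_mono)
    have "(u ^ 3 - 1)\<^sup>2 = (u - 1)\<^sup>2 * (?q * ?q)"
      by (simp add: power2_eq_square power3_eq_cube algebra_simps)
    then have "1 / (4 * (l\<^sup>2 + l + 1)) * (u ^ 3 - 1)\<^sup>2 = (u - 1)\<^sup>2 * ?q / 4 * (?q / (l\<^sup>2 + l + 1))"
      by simp
    also have "\<dots> \<le> (u - 1)\<^sup>2 * ?q / 4 * 1"
      using q by (intro mult_left_mono) auto
    also have "\<dots> \<le> (u - 1)\<^sup>2 * (3 * u\<^sup>2 + 2 * u + 1) / 4"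
      using u by (simp add: mult_left_mono)
    also have "\<dots> = 1/4 + 3/4 * u ^ 4 - u ^ 3"
      by (simp add: field_simps power2_eq_square power3_eq_cube power4_eq_xxxx)
    finally show ?thesis by simp
  qed
  show ?thesis
  proof (cases "t \<le> l")
    case True
    then show ?thesis using small[OF t] by (simp add: s_def)
  next
    case False
    \<comment> \<open>The same slack polynomial, homogenized at \<open>l\<close>: above the level
      each unit of excess in the cube can be charged \<open>l\<close> times.\<close>
    have "0 \<le> (t - l)\<^sup>2 * (3 * t\<^sup>2 + 2 * t * l + l\<^sup>2)"
      using t l by simp
    also have "\<dots> = 3 * (t ^ 4 - l ^ 4) - 4 * (l * (t ^ 3 - l ^ 3))"
      by (simp add: field_simps power2_eq_square power3_eq_cube power4_eq_xxxx)
    finally have "l * (t ^ 3 - l ^ 3) \<le> 3/4 * t ^ 4 - 3/4 * l ^ 4" by simp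
    moreover have "s = l" using False by (simp add: s_def)
    ultimately show ?thesis using small[of l] l by simp
  qed
qed

locale finite_group = group +
  assumes finite_carrier [simp]: "finite (carrier G)"
begin

text \<open>The cosets are those of the left action, as row operations multiply from the
  left.\<close>

definition avg :: "'a set \<Rightarrow> ('a \<Rightarrow> real) \<Rightarrow> 'a \<Rightarrow> real" where
  "avg H f x = (\<Sum>h\<in>H. f (h \<otimes> x)) / real (card H)"

text \<open>The entropy lost by averaging over \<open>H\<close>: up to the missing factor \<open>1 / card (carrier G)\<close>, the
  mean over the cosets of \<open>H\<close> of the entropy of \<open>g\<close> on the coset.\<close>

definition gap :: "'a set \<Rightarrow> ('a \<Rightarrow> real) \<Rightarrow> real" where
  "gap H g = (\<Sum>x\<in>carrier G. g x * ln (g x) - avg H g x * ln (avg H g x))"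

lemma finite_subgroup: "subgroup H G \<Longrightarrow> finite H"
  using finite_carrier finite_subset subgroup.subset by blast

lemma card_subgroup_pos: "subgroup H G \<Longrightarrow> 0 < card H"
  using finite_carrier subgroup.finite_imp_card_positive by blast

text \<open>Left translation by an element is injective on a finite closed set, hence onto; solving
  a b = a and then a c = 1 inside the set yields the identity and inverses.\<close>

lemma finite_closed_subgroup:
  assumes H: "H \<subseteq> carrier G" "H \<noteq> {}" and closed: "\<And>x y. x \<in> H \<Longrightarrow> y \<in> H \<Longrightarrow> x \<otimes> y \<in> H"
  shows "subgroup H G"
proof (rule subgroupI[OF H])
  have fin: "finite H" using H(1) finite_carrier finite_subset by blast
  have surj: "\<exists>b\<in>H. a \<otimes> b = c" if a: "a \<in> H" and c: "c \<in> H" for a c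
  proof -
    have "inj_on (\<lambda>x. a \<otimes> x) H" using a H by (intro inj_onI) (metis Units_eq Units_l_cancel subsetD)
    then have "(\<lambda>x. a \<otimes> x) ` H = H"
      using closed[OF a] by (intro endo_inj_surj[OF fin]) auto
    then show ?thesis using c by (metis imageE)
  qed
  fix a assume a: "a \<in> H"
  obtain b where b: "b \<in> H" "a \<otimes> b = a" using surj[OF a a] by auto
  then have "b = \<one>" using a H by (metis l_cancel_one subsetD)
  then obtain c where c: "c \<in> H" "a \<otimes> c = \<one>" using surj[OF a b(1)] by auto
  then have "inv a = c" using a H by (metis inv_equality inv_inv inv_closed subsetD)
  then show "inv a \<in> H" using c by simp
qed (rule closed)

lemma sum_left_translate:
  assumes K: "subgroup K G" and a: "a \<in> K"
  shows "(\<Sum>x\<in>K. f (a \<otimes> x)) = (\<Sum>x\<in>K. f x)"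
proof (rule sum.reindex_bij_witness[where i = "\<lambda>x. inv a \<otimes> x" and j = "\<lambda>x. a \<otimes> x"])
  fix x assume x: "x \<in> K"
  have c: "a \<in> carrier G" "x \<in> carrier G" using a x subgroup.subset[OF K] by auto
  show "inv a \<otimes> (a \<otimes> x) = x" "a \<otimes> (inv a \<otimes> x) = x"
    using c by (simp_all add: m_assoc[symmetric])
  show "a \<otimes> x \<in> K" "inv a \<otimes> x \<in> K"
    using K a x by (simp_all add: subgroup.m_closed subgroup.m_inv_closed)
qed auto

lemma sum_right_translate:
  assumes K: "subgroup K G" and a: "a \<in> K"
  shows "(\<Sum>x\<in>K. f (x \<otimes> a)) = (\<Sum>x\<in>K. f x)"
proof (rule sum.reindex_bij_witness[where i = "\<lambda>x. x \<otimes> inv a" and j = "\<lambda>x. x \<otimes> a"])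
  fix x assume x: "x \<in> K"
  have c: "a \<in> carrier G" "x \<in> carrier G" using a x subgroup.subset[OF K] by auto
  show "x \<otimes> a \<otimes> inv a = x" "x \<otimes> inv a \<otimes> a = x"
    using c by (simp_all add: m_assoc)
  show "x \<otimes> a \<in> K" "x \<otimes> inv a \<in> K"
    using K a x by (simp_all add: subgroup.m_closed subgroup.m_inv_closed)
qed auto

lemma avg_invariant:
  assumes H: "subgroup H G" and h: "h \<in> H" and x: "x \<in> carrier G"
  shows "avg H f (h \<otimes> x) = avg H f x"
proof -
  have "(\<Sum>k\<in>H. f (k \<otimes> (h \<otimes> x))) = (\<Sum>k\<in>H. f ((k \<otimes> h) \<otimes> x))"
    using subgroup.subset[OF H] h x
    by (intro sum.cong refl arg_cong[where f = f] m_assoc[symmetric]) auto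
  also have "\<dots> = (\<Sum>k\<in>H. f (k \<otimes> x))"
    by (rule sum_right_translate[OF H h])
  finally show ?thesis by (simp add: avg_def)
qed

lemma avg_pos:
  assumes H: "subgroup H G" and x: "x \<in> carrier G" and g: "\<And>y. y \<in> carrier G \<Longrightarrow> 0 < g y"
  shows "0 < avg H g x"
  unfolding avg_def using card_subgroup_pos[OF H] subgroup.subset[OF H] x
  by (intro divide_pos_pos sum_pos g finite_subgroup[OF H] m_closed) auto

text \<open>\<open>avg H\<close> is the conditional expectation onto functions constant on the
  cosets of \<open>H\<close>, so an \<open>H\<close>-invariant factor passes through it.\<close>

lemma sum_avg_mult:
  assumes K: "subgroup K G" and H: "subgroup H G" and HK: "H \<subseteq> K"
    and inv: "\<And>h x. h \<in> H \<Longrightarrow> x \<in> K \<Longrightarrow> k (h \<otimes> x) = k x"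
  shows "(\<Sum>x\<in>K. avg H f x * k x) = (\<Sum>x\<in>K. f x * k x)"
proof -
  have "(\<Sum>x\<in>K. avg H f x * k x) = (\<Sum>x\<in>K. \<Sum>h\<in>H. f (h \<otimes> x) * k (h \<otimes> x)) / real (card H)"
    by (simp add: avg_def inv sum_divide_distrib sum_distrib_right)
  also have "(\<Sum>x\<in>K. \<Sum>h\<in>H. f (h \<otimes> x) * k (h \<otimes> x)) = (\<Sum>h\<in>H. \<Sum>x\<in>K. f (h \<otimes> x) * k (h \<otimes> x))"
    by (rule sum.swap)
  also have "\<dots> = (\<Sum>h\<in>H. \<Sum>x\<in>K. f x * k x)"
    using HK by (intro sum.cong refl sum_left_translate[OF K, where f="\<lambda>x. f x * k x"]) auto
  also have "\<dots> / real (card H) = (\<Sum>x\<in>K. f x * k x)"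
    using card_subgroup_pos[OF H] by simp
  finally show ?thesis .
qed

lemma sum_avg:
  assumes K: "subgroup K G" and H: "subgroup H G" and HK: "H \<subseteq> K"
  shows "(\<Sum>x\<in>K. avg H f x) = (\<Sum>x\<in>K. f x)"
  using sum_avg_mult[OF K H HK, of "\<lambda>_. 1" f] by simp

lemma avg_product:
  assumes L: "subgroup L G" and N: "subgroup N G"
    and bij: "bij_betw (\<lambda>(l, n). l \<otimes> n) (L \<times> N) M" and x: "x \<in> carrier G"
  shows "avg M f x = avg N (avg L f) x"
proof -
  have c: "card M = card L * card N"
    using bij_betw_same_card[OF bij] by (simp add: card_cartesian_product)
  have "(\<Sum>m\<in>M. f (m \<otimes> x)) = (\<Sum>(l,n)\<in>L \<times> N. f (l \<otimes> n \<otimes> x))"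
    using sum.reindex_bij_betw[OF bij, of "\<lambda>m. f (m \<otimes> x)"] by (simp add: case_prod_beta)
  also have "\<dots> = (\<Sum>l\<in>L. \<Sum>n\<in>N. f (l \<otimes> n \<otimes> x))"
    by (simp add: sum.cartesian_product)
  also have "\<dots> = (\<Sum>n\<in>N. \<Sum>l\<in>L. f (l \<otimes> n \<otimes> x))"
    by (rule sum.swap)
  also have "\<dots> = (\<Sum>n\<in>N. \<Sum>l\<in>L. f (l \<otimes> (n \<otimes> x)))"
    using subgroup.subset[OF L] subgroup.subset[OF N] x
    by (intro sum.cong refl arg_cong[where f=f] m_assoc) auto
  finally show ?thesis
    by (simp add: avg_def c sum_divide_distrib[symmetric])
qed

text \<open>Inversion maps \<open>M\<close> to itself and reverses products. With
  \<open>avg_product\<close> in both orders, \<open>avg L\<close> and \<open>avg N\<close> commute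
  although neither subgroup is assumed normal.\<close>

lemma bij_betw_swap_product:
  assumes L: "subgroup L G" and N: "subgroup N G" and M: "subgroup M G"
    and bij: "bij_betw (\<lambda>(l, n). l \<otimes> n) (L \<times> N) M"
  shows "bij_betw (\<lambda>(n, l). n \<otimes> l) (N \<times> L) M"
proof -
  have s: "L \<subseteq> carrier G" "N \<subseteq> carrier G" "M \<subseteq> carrier G"
    using L N M subgroup.subset by auto
  have invbij: "bij_betw (\<lambda>x. inv x) H H" if "subgroup H G" for H
    using subgroup.subset[OF that] that
    by (intro bij_betw_byWitness[where f' = "\<lambda>x. inv x"]) (auto simp: subgroup.m_inv_closed)
  have "bij_betw (\<lambda>(n, l). (inv l, inv n)) (N \<times> L) (L \<times> N)"
    using s L N
    by (intro bij_betw_byWitness[where f' = "\<lambda>(l, n). (inv n, inv l)"])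
      (auto simp: subgroup.m_inv_closed subset_iff)
  from bij_betw_trans[OF bij_betw_trans[OF this bij] invbij[OF M]]
  have "bij_betw ((\<lambda>x. inv x) \<circ> ((\<lambda>(l, n). l \<otimes> n) \<circ> (\<lambda>(n, l). (inv l, inv n)))) (N \<times> L) M" .
  then show ?thesis
    by (rule bij_betw_cong[THEN iffD1, rotated])
      (use s in \<open>auto simp: inv_mult_group subset_iff\<close>)
qed

lemma bij_betw_productI:
  assumes L: "subgroup L G" "L \<subseteq> M" and N: "subgroup N G" "N \<subseteq> M" and M: "subgroup M G"
    and LN: "L \<inter> N = {\<one>}" and surj: "\<And>m. m \<in> M \<Longrightarrow> \<exists>l\<in>L. l \<otimes> m \<in> N"
  shows "bij_betw (\<lambda>(l, n). l \<otimes> n) (L \<times> N) M"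
proof (rule bij_betw_imageI)
  have s: "L \<subseteq> carrier G" "N \<subseteq> carrier G" "M \<subseteq> carrier G"
    using subgroup.subset[OF L(1)] subgroup.subset[OF N(1)] subgroup.subset[OF M] by auto
  show "inj_on (\<lambda>(l, n). l \<otimes> n) (L \<times> N)"
  proof (rule inj_onI)
    fix z z' assume z: "z \<in> L \<times> N" "z' \<in> L \<times> N" "(\<lambda>(l, n). l \<otimes> n) z = (\<lambda>(l, n). l \<otimes> n) z'"
    obtain l n l' n' where zz: "z = (l, n)" "z' = (l', n')" by (metis prod.exhaust)
    have m: "l \<in> L" "n \<in> N" "l' \<in> L" "n' \<in> N" and e: "l \<otimes> n = l' \<otimes> n'"
      using z by (auto simp: zz)
    have c: "l \<in> carrier G" "n \<in> carrier G" "l' \<in> carrier G" "n' \<in> carrier G"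
      using m s by auto
    have "inv l' \<otimes> l = n' \<otimes> inv n"
      using c e by (metis inv_closed inv_solve_left inv_solve_right m_assoc m_closed)
    moreover have "inv l' \<otimes> l \<in> L" "n' \<otimes> inv n \<in> N"
      using m L N by (simp_all add: subgroup.m_closed subgroup.m_inv_closed)
    ultimately have "inv l' \<otimes> l = \<one>" "n' \<otimes> inv n = \<one>" using LN by auto
    then show "z = z'" unfolding zz using c by (metis inv_closed inv_equality inv_inv)
  qed
  show "(\<lambda>(l, n). l \<otimes> n) ` (L \<times> N) = M"
  proof
    show "(\<lambda>(l, n). l \<otimes> n) ` (L \<times> N) \<subseteq> M"
      using L N M by (auto intro!: subgroup.m_closed)
    show "M \<subseteq> (\<lambda>(l, n). l \<otimes> n) ` (L \<times> N)"
    proof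
      fix m assume m: "m \<in> M"
      then obtain l where l: "l \<in> L" "l \<otimes> m \<in> N" using surj by blast
      have "m = inv l \<otimes> (l \<otimes> m)" using l m s by (simp add: m_assoc[symmetric] subset_iff)
      then show "m \<in> (\<lambda>(l, n). l \<otimes> n) ` (L \<times> N)"
        using l L by (intro image_eqI[of _ _ "(inv l, l \<otimes> m)"]) (auto simp: subgroup.m_inv_closed)
    qed
  qed
qed

text \<open>Convexity of relative entropy (the log-sum inequality), from the tangent bound
  \<open>ln u \<le> u - 1\<close> taken relative to the ratio of the averages.\<close>

lemma log_sum_avg:
  assumes N: "subgroup N G" and x: "x \<in> carrier G"
    and a: "\<And>y. y \<in> carrier G \<Longrightarrow> 0 < a y" and b: "\<And>y. y \<in> carrier G \<Longrightarrow> 0 < b y"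
  shows "avg N a x * ln (avg N a x / avg N b x) \<le> avg N (\<lambda>y. a y * ln (a y / b y)) x"
proof -
  define A where "A = avg N a x"
  define B where "B = avg N b x"
  have A: "0 < A" and B: "0 < B"
    using avg_pos[OF N x] a b by (auto simp: A_def B_def)
  have *: "a y * ln (A / B) + a y - b y * (A / B) \<le> a y * ln (a y / b y)" if y: "y \<in> carrier G" for y
  proof -
    have pos: "0 < a y" "0 < b y" using a b y by auto
    have "ln ((b y * A) / (a y * B)) \<le> (b y * A) / (a y * B) - 1"
      using pos A B by (intro ln_le_minus_one) auto
    moreover have "ln ((b y * A) / (a y * B)) = ln (A / B) - ln (a y / b y)"
      using pos A B by (simp add: ln_div ln_mult)
    ultimately have "ln (A / B) - ln (a y / b y) \<le> (b y * A) / (a y * B) - 1" by simp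
    then have "a y * (ln (A / B) - ln (a y / b y)) \<le> a y * ((b y * A) / (a y * B) - 1)"
      using pos by (intro mult_left_mono) auto
    also have "\<dots> = b y * (A / B) - a y" using pos by (simp add: field_simps)
    finally show ?thesis by (simp add: algebra_simps)
  qed
  have sub: "h \<otimes> x \<in> carrier G" if "h \<in> N" for h
    using that x subgroup.subset[OF N] by auto
  have "avg N (\<lambda>y. a y * ln (A / B) + a y - b y * (A / B)) x \<le> avg N (\<lambda>y. a y * ln (a y / b y)) x"
    unfolding avg_def by (intro divide_right_mono sum_mono * sub) auto
  also have "avg N (\<lambda>y. a y * ln (A / B) + a y - b y * (A / B)) x = A * ln (A / B) + A - B * (A / B)"
  proof -
    have "avg N (\<lambda>y. a y * p + a y - b y * q) x = A * p + A - B * q" for p q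
      by (simp add: avg_def A_def B_def sum.distrib sum_subtractf sum_distrib_right[symmetric]
          add_divide_distrib diff_divide_distrib)
    then show ?thesis .
  qed
  also have "\<dots> = A * ln (A / B)" using B by simp
  finally show ?thesis by (simp add: A_def B_def)
qed

lemma sum_avg_ln_avg:
  assumes H: "subgroup H G" and K: "subgroup K G" "H \<subseteq> K"
  shows "(\<Sum>x\<in>carrier G. avg H g x * ln (avg K g x)) = (\<Sum>x\<in>carrier G. g x * ln (avg K g x))"
proof (rule sum_avg_mult[OF subgroup_self H subgroup.subset[OF H]])
  fix h x assume "h \<in> H" "x \<in> carrier G"
  then show "ln (avg K g (h \<otimes> x)) = ln (avg K g x)"
    using avg_invariant[OF K(1)] K(2) by (metis subsetD)
qed

lemma gap_eq_relative:
  assumes H: "subgroup H G" and g: "\<And>y. y \<in> carrier G \<Longrightarrow> 0 < g y"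
  shows "gap H g = (\<Sum>x\<in>carrier G. g x * ln (g x / avg H g x))"
proof -
  have "gap H g = (\<Sum>x\<in>carrier G. g x * ln (g x)) - (\<Sum>x\<in>carrier G. avg H g x * ln (avg H g x))"
    by (simp add: gap_def sum_subtractf)
  also have "\<dots> = (\<Sum>x\<in>carrier G. g x * ln (g x) - g x * ln (avg H g x))"
    using sum_avg_ln_avg[OF H H subset_refl, of g] by (simp add: sum_subtractf)
  also have "\<dots> = (\<Sum>x\<in>carrier G. g x * ln (g x / avg H g x))"
    using g avg_pos[OF H, of _ g] by (intro sum.cong refl) (simp add: ln_div right_diff_distrib less_imp_neq[symmetric])
  finally show ?thesis .
qed

text \<open>Data processing: as the averages commute, \<open>avg N\<close> maps the pair
  \<open>g\<close>, \<open>avg L g\<close> to the pair \<open>avg N g\<close>,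
  \<open>avg L (avg N g)\<close>, and relative entropy does not grow.\<close>

lemma gap_avg_le:
  assumes L: "subgroup L G" and N: "subgroup N G"
    and comm: "\<And>x. x \<in> carrier G \<Longrightarrow> avg L (avg N g) x = avg N (avg L g) x"
    and g: "\<And>y. y \<in> carrier G \<Longrightarrow> 0 < g y"
  shows "gap L (avg N g) \<le> gap L g"
proof -
  have "gap L (avg N g) = (\<Sum>x\<in>carrier G. avg N g x * ln (avg N g x / avg N (avg L g) x))"
    using gap_eq_relative[OF L, of "avg N g"] avg_pos[OF N] g comm by simp
  also have "\<dots> \<le> (\<Sum>x\<in>carrier G. avg N (\<lambda>y. g y * ln (g y / avg L g y)) x)"
    by (intro sum_mono log_sum_avg[OF N]) (auto intro: g avg_pos[OF L])
  also have "\<dots> = gap L g"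
    using gap_eq_relative[OF L, of g] g sum_avg[OF subgroup_self N subgroup.subset[OF N]] by simp
  finally show ?thesis .
qed

text \<open>Chain rule: averaging over \<open>N\<close> first leaves the entropy on \<open>L\<close>
  of an already averaged function, which \<open>gap_avg_le\<close> compares with that of
  \<open>g\<close>.\<close>

lemma gap_product_le:
  assumes L: "subgroup L G" and N: "subgroup N G" and M: "subgroup M G"
    and bij: "bij_betw (\<lambda>(l, n). l \<otimes> n) (L \<times> N) M"
    and g: "\<And>y. y \<in> carrier G \<Longrightarrow> 0 < g y"
  shows "gap M g \<le> gap L g + gap N g"
proof -
  have 1: "avg M g x = avg N (avg L g) x" if "x \<in> carrier G" for x
    by (rule avg_product[OF L N bij that])
  have 2: "avg M g x = avg L (avg N g) x" if "x \<in> carrier G" for x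
    by (rule avg_product[OF N L bij_betw_swap_product[OF L N M bij] that])
  have "gap M g = gap N g + gap L (avg N g)"
    using 2 by (simp add: gap_def sum_subtractf)
  also have "gap L (avg N g) \<le> gap L g"
    using 1 2 g by (intro gap_avg_le[OF L N]) auto
  finally show ?thesis by simp
qed

section \<open>Energies of single group elements and a crude logarithmic Sobolev inequality\<close>

definition energy :: "('a \<Rightarrow> real) \<Rightarrow> 'a \<Rightarrow> real" where
  "energy g k = (\<Sum>x\<in>carrier G. (sqrt (g x) - sqrt (g (k \<otimes> x)))\<^sup>2)"

lemma energy_nonneg: "0 \<le> energy g k"
  by (simp add: energy_def sum_nonneg)

lemma energy_one: "energy g \<one> = 0"
  by (simp add: energy_def)

lemma energy_mult_le:
  assumes k: "k \<in> carrier G" and l: "l \<in> carrier G"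
  shows "energy g (k \<otimes> l) \<le> 2 * energy g k + 2 * energy g l"
proof -
  let ?f = "\<lambda>x. sqrt (g x)"
  have "energy g (k \<otimes> l) = (\<Sum>x\<in>carrier G. (?f x - ?f (k \<otimes> (l \<otimes> x)))\<^sup>2)"
    using k l by (simp add: energy_def m_assoc)
  also have "\<dots> \<le> (\<Sum>x\<in>carrier G. 2 * (?f (l \<otimes> x) - ?f (k \<otimes> (l \<otimes> x)))\<^sup>2 + 2 * (?f x - ?f (l \<otimes> x))\<^sup>2)"
  proof (intro sum_mono)
    fix x
    have "0 \<le> ((?f (l \<otimes> x) - ?f (k \<otimes> (l \<otimes> x))) - (?f x - ?f (l \<otimes> x)))\<^sup>2" by simp
    then show "(?f x - ?f (k \<otimes> (l \<otimes> x)))\<^sup>2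
        \<le> 2 * (?f (l \<otimes> x) - ?f (k \<otimes> (l \<otimes> x)))\<^sup>2 + 2 * (?f x - ?f (l \<otimes> x))\<^sup>2"
      by (simp add: power2_eq_square algebra_simps)
  qed
  also have "\<dots> = 2 * energy g k + 2 * energy g l"
    using sum_left_translate[OF subgroup_self l, of "\<lambda>x. (?f x - ?f (k \<otimes> x))\<^sup>2"]
    by (simp add: energy_def sum.distrib sum_distrib_left[symmetric])
  finally show ?thesis .
qed

text \<open>Entropy is at most the chi-square divergence, which Cauchy-Schwarz turns into squared
  increments of \<open>sqrt g\<close>. The sum over \<open>K\<close> is not divided by its order,
  which is wasteful for large groups; it is applied to groups of order at most two, where it gives
  the constant 4, and to groups of bounded order.\<close>

lemma gap_le_sum_energy:
  assumes K: "subgroup K G" and g: "\<And>y. y \<in> carrier G \<Longrightarrow> 0 < g y"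
  shows "gap K g \<le> 4 * (\<Sum>k\<in>K. energy g k)"
proof -
  define N where "N = real (card K)"
  have N1: "1 \<le> N" using card_subgroup_pos[OF K] by (simp add: N_def)
  have Kc: "k \<otimes> x \<in> carrier G" if "k \<in> K" "x \<in> carrier G" for k x
    using that subgroup.subset[OF K] by auto
  define f where "f = (\<lambda>x. sqrt (g x))"
  have f2: "(f x)\<^sup>2 = g x" if "x \<in> carrier G" for x using g[OF that] by (simp add: f_def)
  have f0: "0 < f x" if "x \<in> carrier G" for x using g[OF that] by (simp add: f_def)
  have "gap K g = (\<Sum>x\<in>carrier G. g x * ln (g x / avg K g x))"
    using gap_eq_relative[OF K] g by simp
  also have "\<dots> \<le> (\<Sum>x\<in>carrier G. g x * (g x / avg K g x - 1))"
    using g avg_pos[OF K] by (intro sum_mono mult_left_mono ln_le_minus_one) (auto intro: less_imp_le)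
  also have "\<dots> = (\<Sum>x\<in>carrier G. (g x - avg K g x)\<^sup>2 / avg K g x)"
  proof -
    have "(\<Sum>x\<in>carrier G. (g x - avg K g x)\<^sup>2 / avg K g x) =
        (\<Sum>x\<in>carrier G. g x * (g x / avg K g x - 1)) + (\<Sum>x\<in>carrier G. avg K g x - g x)"
      unfolding sum.distrib[symmetric]
    proof (intro sum.cong refl)
      fix x assume "x \<in> carrier G"
      then have "avg K g x \<noteq> 0" using avg_pos[OF K, of x g] g by force
      then show "(g x - avg K g x)\<^sup>2 / avg K g x = g x * (g x / avg K g x - 1) + (avg K g x - g x)"
        by (simp add: field_simps power2_eq_square)
    qed
    then show ?thesis
      using sum_avg[OF subgroup_self K subgroup.subset[OF K], of g] by (simp add: sum_subtractf)
  qed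
  also have "\<dots> \<le> (\<Sum>x\<in>carrier G. 4 * (\<Sum>k\<in>K. (f x - f (k \<otimes> x))\<^sup>2))"
  proof (intro sum_mono)
    fix x assume x: "x \<in> carrier G"
    let ?A = "avg K g x"
    have A: "0 < ?A" using avg_pos[OF K x] g by auto
    \<comment> \<open>\<open>g x\<close> is itself one term of the average; this is where the factor
      \<open>card K\<close> is lost.\<close>
    have gle: "g x \<le> N * ?A"
    proof -
      have "g (\<one> \<otimes> x) \<le> (\<Sum>k\<in>K. g (k \<otimes> x))"
        using Kc x g subgroup.one_closed[OF K]
        by (intro member_le_sum[where f = "\<lambda>k. g (k \<otimes> x)"] finite_subgroup[OF K]) (auto intro: less_imp_le)
      then show ?thesis using N1 x by (simp add: avg_def N_def)
    qed
    have e: "g x - ?A = (\<Sum>k\<in>K. (f x - f (k \<otimes> x)) * (f x + f (k \<otimes> x))) / N"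
    proof -
      have "(\<Sum>k\<in>K. (f x - f (k \<otimes> x)) * (f x + f (k \<otimes> x))) = (\<Sum>k\<in>K. g x - g (k \<otimes> x))"
        using f2 x Kc by (intro sum.cong refl) (simp add: power2_eq_square algebra_simps)
      then show ?thesis using N1 by (simp add: sum_subtractf avg_def N_def field_simps)
    qed
    have "(g x - ?A)\<^sup>2 \<le> (\<Sum>k\<in>K. (f x - f (k \<otimes> x))\<^sup>2) * (\<Sum>k\<in>K. (f x + f (k \<otimes> x))\<^sup>2) / N\<^sup>2"
      unfolding e power_divide by (intro divide_right_mono Cauchy_Schwarz_ineq_sum) auto
    also have "(\<Sum>k\<in>K. (f x + f (k \<otimes> x))\<^sup>2) \<le> (\<Sum>k\<in>K. 2 * g x + 2 * g (k \<otimes> x))"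
    proof (intro sum_mono)
      fix k assume k: "k \<in> K"
      have "0 \<le> (f x - f (k \<otimes> x))\<^sup>2" by simp
      then show "(f x + f (k \<otimes> x))\<^sup>2 \<le> 2 * g x + 2 * g (k \<otimes> x)"
        using f2[OF x] f2[OF Kc[OF k x]] by (simp add: power2_eq_square algebra_simps)
    qed
    also have "\<dots> = 2 * N * g x + 2 * (N * ?A)"
      using N1 by (simp add: sum.distrib N_def avg_def sum_distrib_left[symmetric])
    also have "\<dots> \<le> 4 * N\<^sup>2 * ?A"
    proof -
      have "2 * N * g x \<le> 2 * N * (N * ?A)" using gle N1 by (intro mult_left_mono) auto
      moreover have "1 * (N * ?A) \<le> N * (N * ?A)" using N1 A by (intro mult_right_mono) auto
      ultimately show ?thesis by (simp add: power2_eq_square)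
    qed
    finally have "(g x - ?A)\<^sup>2 \<le> (\<Sum>k\<in>K. (f x - f (k \<otimes> x))\<^sup>2) * (4 * N\<^sup>2 * ?A) / N\<^sup>2"
      by (simp add: divide_right_mono mult_left_mono sum_nonneg)
    also have "\<dots> = 4 * (\<Sum>k\<in>K. (f x - f (k \<otimes> x))\<^sup>2) * ?A"
      using N1 by simp
    finally show "(g x - ?A)\<^sup>2 / ?A \<le> 4 * (\<Sum>k\<in>K. (f x - f (k \<otimes> x))\<^sup>2)"
      using A by (simp add: pos_divide_le_eq)
  qed
  also have "\<dots> = 4 * (\<Sum>k\<in>K. energy g k)"
    unfolding energy_def f_def sum_distrib_left[symmetric] by (subst sum.swap) simp
  finally show ?thesis .
qed


section \<open>Factorization of entropy over two subgroups\<close>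

lemma avg_avg_subset:
  assumes K: "subgroup K G" and H: "subgroup H G" and HK: "H \<subseteq> K" and x: "x \<in> carrier G"
  shows "avg K (avg H f) x = avg K f x"
proof -
  have "avg H f (k \<otimes> x) = avg H (\<lambda>k. f (k \<otimes> x)) k" if "k \<in> K" for k
    unfolding avg_def using that x subgroup.subset[OF K] subgroup.subset[OF H]
    by (intro arg_cong2[where f = "(/)"] sum.cong refl arg_cong[where f = f] m_assoc[symmetric]) auto
  then show ?thesis
    using sum_avg[OF K H HK, of "\<lambda>k. f (k \<otimes> x)"] unfolding avg_def[of K] by simp
qed

text \<open>As \<open>S\<close> and \<open>T\<close> meet trivially, x is determined by its cosets S
  x and T x. A pair of cosets thus has probability at most 1/|K|, against |S| |T| / |K|^2 under the
  product of the marginals: the joint density is at most |K| / (|S| |T|).\<close>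

lemma sum_mult_le_density:
  assumes K: "subgroup K G" and S: "subgroup S G" "S \<subseteq> K" and T: "subgroup T G" "T \<subseteq> K"
    and ST: "S \<inter> T = {\<one>}"
    and phi: "\<And>x. x \<in> K \<Longrightarrow> 0 \<le> phi x" "\<And>s x. s \<in> S \<Longrightarrow> x \<in> K \<Longrightarrow> phi (s \<otimes> x) = phi x"
    and psi: "\<And>x. x \<in> K \<Longrightarrow> 0 \<le> psi x" "\<And>s x. s \<in> T \<Longrightarrow> x \<in> K \<Longrightarrow> psi (s \<otimes> x) = psi x"
  shows "real (card S * card T) * (\<Sum>x\<in>K. phi x * psi x) \<le> (\<Sum>x\<in>K. phi x) * (\<Sum>x\<in>K. psi x)"
proof -
  have fin: "finite K" "finite S" "finite T" using K S T finite_subgroup by auto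
  have sub: "K \<subseteq> carrier G" using K subgroup.subset by auto
  let ?F = "\<lambda>(x, s, t). (s \<otimes> x, t \<otimes> x)"
  have inj: "inj_on ?F (K \<times> S \<times> T)"
  proof (rule inj_onI)
    fix z z' assume z: "z \<in> K \<times> S \<times> T" "z' \<in> K \<times> S \<times> T" "?F z = ?F z'"
    obtain x s t x' s' t' where zz: "z = (x, s, t)" "z' = (x', s', t')"
      by (metis prod.exhaust)
    have m: "x \<in> K" "s \<in> S" "t \<in> T" "x' \<in> K" "s' \<in> S" "t' \<in> T"
      and e: "s \<otimes> x = s' \<otimes> x'" "t \<otimes> x = t' \<otimes> x'"
      using z by (auto simp: zz)
    have c: "x \<in> carrier G" "x' \<in> carrier G" "s \<in> carrier G" "s' \<in> carrier G" "t \<in> carrier G" "t' \<in> carrier G"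
      using m sub S T by auto
    have "inv s' \<otimes> s = x' \<otimes> inv x"
      using c e(1) by (metis inv_closed inv_solve_left inv_solve_right m_assoc m_closed)
    moreover have "inv t' \<otimes> t = x' \<otimes> inv x"
      using c e(2) by (metis inv_closed inv_solve_left inv_solve_right m_assoc m_closed)
    moreover have "inv s' \<otimes> s \<in> S" "inv t' \<otimes> t \<in> T"
      using m S T by (simp_all add: subgroup.m_closed subgroup.m_inv_closed)
    ultimately have "x' \<otimes> inv x \<in> S \<inter> T" "inv s' \<otimes> s = x' \<otimes> inv x" "inv t' \<otimes> t = x' \<otimes> inv x"
      by auto
    then have "inv s' \<otimes> s = \<one>" "inv t' \<otimes> t = \<one>" "x' \<otimes> inv x = \<one>"
      using ST by auto
    then show "z = z'"
      unfolding zz using c by (metis inv_closed inv_equality inv_inv)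
  qed
  have "real (card S * card T) * (\<Sum>x\<in>K. phi x * psi x) = (\<Sum>x\<in>K. \<Sum>st\<in>S \<times> T. phi x * psi x)"
    by (simp add: sum_distrib_left card_cartesian_product)
  also have "\<dots> = (\<Sum>x\<in>K. \<Sum>(s,t)\<in>S \<times> T. phi (s \<otimes> x) * psi (t \<otimes> x))"
    using phi(2) psi(2) by (intro sum.cong refl) auto
  also have "\<dots> = (\<Sum>z\<in>K \<times> S \<times> T. (\<lambda>(a, b). phi a * psi b) (?F z))"
    by (simp add: sum.cartesian_product case_prod_beta)
  also have "\<dots> = (\<Sum>z\<in>?F ` (K \<times> S \<times> T). (\<lambda>(a, b). phi a * psi b) z)"
    by (simp add: sum.reindex[OF inj])
  also have "\<dots> \<le> (\<Sum>z\<in>K \<times> K. (\<lambda>(a, b). phi a * psi b) z)"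
    using fin phi(1) psi(1) S(2) T(2) K
    by (intro sum_mono2) (auto simp: subgroup.m_closed subset_iff)
  also have "\<dots> = (\<Sum>x\<in>K. phi x) * (\<Sum>x\<in>K. psi x)"
    by (simp add: sum_product sum.cartesian_product)
  finally show ?thesis .
qed

text \<open>A two-function hypercontractive inequality. Below the level \<open>2 * M\<close> it follows from the
  smallness of the correlation, above it from the bounded density.\<close>

lemma sum_cubes_le:
  fixes M :: real and a b :: "'a \<Rightarrow> real"
  assumes K: "subgroup K G" and S: "subgroup S G" "S \<subseteq> K" and T: "subgroup T G" "T \<subseteq> K"
    and ST: "S \<inter> T = {\<one>}"
    and M: "1 \<le> M" "real (card K) \<le> M * real (card S * card T)"
    and H: "subgroup H G" "H \<subseteq> T"
    and k: "k = 1 / (4 * ((2 * M)\<^sup>2 + 2 * M + 1))"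
    and corr: "\<And>phi. (\<And>s x. s \<in> S \<Longrightarrow> x \<in> K \<Longrightarrow> phi (s \<otimes> x) = phi x) \<Longrightarrow> (\<Sum>x\<in>K. phi x) = 0 \<Longrightarrow>
        (\<Sum>x\<in>K. (avg H phi x)\<^sup>2) \<le> k\<^sup>2 * (\<Sum>x\<in>K. (phi x)\<^sup>2)"
    and a: "\<And>x. x \<in> K \<Longrightarrow> 0 \<le> a x" "\<And>s x. s \<in> S \<Longrightarrow> x \<in> K \<Longrightarrow> a (s \<otimes> x) = a x"
      "(\<Sum>x\<in>K. a x ^ 4) = card K"
    and b: "\<And>x. x \<in> K \<Longrightarrow> 0 \<le> b x" "\<And>s x. s \<in> T \<Longrightarrow> x \<in> K \<Longrightarrow> b (s \<otimes> x) = b x"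
      "(\<Sum>x\<in>K. b x ^ 4) = card K"
  shows "(\<Sum>x\<in>K. a x ^ 3 * b x ^ 3) \<le> card K"
proof -
  define N where "N = real (card K)"
  have N: "0 < N" using card_subgroup_pos[OF K] by (simp add: N_def)
  \<comment> \<open>Each tail costs a density factor \<open>M\<close>. The two budgets
    \<open>ma\<close> and \<open>mb\<close> are finally added with weight 1/2 and pay
    \<open>l / 2\<close> for it, hence the level \<open>2 * M\<close>.\<close>
  define l where "l = 2 * M"
  have k0: "0 < k" using M(1) by (auto simp: k intro!: add_pos_pos)
  define f0 where "f0 = (\<lambda>(f :: 'a \<Rightarrow> real) x. min (f x) l ^ 3 :: real)"
  define f1 where "f1 = (\<lambda>(f :: 'a \<Rightarrow> real) x. f x ^ 3 - f0 f x :: real)"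
  define E where "E = (\<lambda>f. (\<Sum>x\<in>K. f x) / N :: real)"
  have E_add: "E (\<lambda>x. f x + g x) = E f + E g" for f g
    by (simp add: E_def sum.distrib add_divide_distrib)
  have E_scale: "E (\<lambda>x. c * f x) = c * E f" for c f
    by (simp add: E_def sum_distrib_left)
  have E_const: "E (\<lambda>x. c) = c" for c
    using N by (simp add: E_def N_def)
  have E_mono: "E f \<le> E g" if "\<And>x. x \<in> K \<Longrightarrow> f x \<le> g x" for f g
    unfolding E_def using N that by (intro divide_right_mono sum_mono) auto
  have E_nonneg: "0 \<le> E f" if "\<And>x. x \<in> K \<Longrightarrow> 0 \<le> f x" for f
    unfolding E_def using N that by (intro divide_nonneg_pos sum_nonneg) auto
  have f01: "0 \<le> f0 f x" "0 \<le> f1 f x" if "0 \<le> f x" for f x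
    using that M(1) by (auto simp: f0_def f1_def l_def intro!: power_mono)
  \<comment> \<open>The fourth moment is 1, so the strengthened Young inequality leaves a total
    budget of 1 for the truncated mean, its squared deviation from 1 and \<open>l\<close> times the
    tail.\<close>
  have main: "E (f0 f) + k * E (\<lambda>x. (f0 f x - 1)\<^sup>2) + l * E (f1 f) \<le> 1"
    if f: "\<And>x. x \<in> K \<Longrightarrow> 0 \<le> f x" "(\<Sum>x\<in>K. f x ^ 4) = card K" for f :: "'a \<Rightarrow> real"
  proof -
    have "E (f0 f) + k * E (\<lambda>x. (f0 f x - 1)\<^sup>2) + l * E (f1 f) =
        E (\<lambda>x. f0 f x + k * (f0 f x - 1)\<^sup>2 + l * f1 f x)"
      by (simp only: E_add E_scale)
    also have "\<dots> \<le> E (\<lambda>x. 1/4 + 3/4 * f x ^ 4)"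
      using M(1) truncated_cube_le[of "f _" l] f(1)
      by (intro E_mono) (simp add: f0_def f1_def k l_def)
    also have "\<dots> = 1/4 + 3/4 * E (\<lambda>x. f x ^ 4)"
      by (simp only: E_add E_scale E_const)
    also have "E (\<lambda>x. f x ^ 4) = 1" using f(2) N by (simp add: E_def N_def)
    finally show ?thesis by simp
  qed
  define \<alpha> where "\<alpha> = E (f0 a)"
  define \<beta> where "\<beta> = E (f0 b)"
  define p where "p = E (f1 a)"
  define q where "q = E (f1 b)"
  define A where "A = E (\<lambda>x. (f0 a x - 1)\<^sup>2)"
  define B where "B = E (\<lambda>x. (f0 b x - 1)\<^sup>2)"
  have ma: "\<alpha> + k * A + l * p \<le> 1" and mb: "\<beta> + k * B + l * q \<le> 1"
    using main[OF a(1,3)] main[OF b(1,3)] by (simp_all add: \<alpha>_def \<beta>_def p_def q_def A_def B_def)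
  have nn: "0 \<le> \<alpha>" "0 \<le> \<beta>" "0 \<le> p" "0 \<le> q" "0 \<le> A" "0 \<le> B"
    unfolding \<alpha>_def \<beta>_def p_def q_def A_def B_def by (intro E_nonneg f01 a b zero_le_power2; assumption)+
  have dens: "E (\<lambda>x. phi x * psi x) \<le> M * (E phi * E psi)"
    if "\<And>x. x \<in> K \<Longrightarrow> 0 \<le> phi x" "\<And>s x. s \<in> S \<Longrightarrow> x \<in> K \<Longrightarrow> phi (s \<otimes> x) = phi x"
      "\<And>x. x \<in> K \<Longrightarrow> 0 \<le> psi x" "\<And>s x. s \<in> T \<Longrightarrow> x \<in> K \<Longrightarrow> psi (s \<otimes> x) = psi x" for phi psi
  proof -
    let ?I = "\<Sum>x\<in>K. phi x * psi x"
    have "N * ?I \<le> (M * real (card S * card T)) * ?I"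
      using M(2) that by (intro mult_right_mono sum_nonneg) (auto simp: N_def)
    also have "\<dots> \<le> M * ((\<Sum>x\<in>K. phi x) * (\<Sum>x\<in>K. psi x))"
      using mult_left_mono[OF sum_mult_le_density[OF K S T ST that], of M] M(1)
      by (simp add: mult.assoc)
    finally have "N * ?I / N\<^sup>2 \<le> M * ((\<Sum>x\<in>K. phi x) * (\<Sum>x\<in>K. psi x)) / N\<^sup>2"
      by (rule divide_right_mono) simp
    then show ?thesis using N by (simp add: E_def power2_eq_square)
  qed
  have inv: "f0 f (s \<otimes> x) = f0 f x" "f1 f (s \<otimes> x) = f1 f x" if "f (s \<otimes> x) = f x" for f s x
    using that by (simp_all add: f0_def f1_def)
  \<comment> \<open>Since \<open>?phi\<close> has mean zero, \<open>?psi\<close> may be centered at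
    1, where \<open>B\<close> measures it, rather than at its own mean. The factor
    \<open>k\<^sup>2\<close> from \<open>corr\<close> balances the weights 1/(2k) and k/2, so that
    k/2 is left on both squares; these are what the budgets provide.\<close>
  have bulk: "E (\<lambda>x. f0 a x * f0 b x) \<le> \<alpha> * \<beta> + k / 2 * (A + B)"
  proof -
    let ?phi = "\<lambda>x. f0 a x - \<alpha>" and ?psi = "\<lambda>x. f0 b x - 1"
    have phi0: "(\<Sum>x\<in>K. ?phi x) = 0"
      using N by (simp add: \<alpha>_def E_def sum_subtractf N_def[symmetric])
    have "(\<Sum>x\<in>K. ?phi x * ?psi x) = (\<Sum>x\<in>K. avg H ?phi x * ?psi x)"
      using H T b(2) inv by (intro sum_avg_mult[symmetric] K) auto
    also have "\<dots> \<le> (\<Sum>x\<in>K. (1 / (2 * k)) * (avg H ?phi x)\<^sup>2 + k / 2 * (?psi x)\<^sup>2)"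
    proof (intro sum_mono)
      fix x
      have "0 \<le> (avg H ?phi x - k * ?psi x)\<^sup>2 / (2 * k)" using k0 by simp
      also have "\<dots> = (1 / (2 * k)) * (avg H ?phi x)\<^sup>2 + k / 2 * (?psi x)\<^sup>2 - avg H ?phi x * ?psi x"
        using k0 by (simp add: field_simps power2_eq_square)
      finally show "avg H ?phi x * ?psi x \<le> (1 / (2 * k)) * (avg H ?phi x)\<^sup>2 + k / 2 * (?psi x)\<^sup>2" by simp
    qed
    also have "\<dots> = (1 / (2 * k)) * (\<Sum>x\<in>K. (avg H ?phi x)\<^sup>2) + k / 2 * (\<Sum>x\<in>K. (?psi x)\<^sup>2)"
      by (simp add: sum.distrib sum_distrib_left)
    also have "\<dots> \<le> (1 / (2 * k)) * (k\<^sup>2 * (\<Sum>x\<in>K. (?phi x)\<^sup>2)) + k / 2 * (\<Sum>x\<in>K. (?psi x)\<^sup>2)"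
      using k0 phi0 a(2) inv by (intro add_right_mono mult_left_mono corr) auto
    also have "\<dots> = k / 2 * ((\<Sum>x\<in>K. (?phi x)\<^sup>2) + (\<Sum>x\<in>K. (?psi x)\<^sup>2))"
      using k0 by (simp add: power2_eq_square field_simps)
    finally have 1: "E (\<lambda>x. ?phi x * ?psi x) \<le> k / 2 * (E (\<lambda>x. (?phi x)\<^sup>2) + B)"
      using N by (simp add: E_def B_def field_simps)
    have "E (\<lambda>x. (f0 a x - 1)\<^sup>2) = E (\<lambda>x. (?phi x)\<^sup>2 + ((2 * (\<alpha> - 1)) * ?phi x + (\<alpha> - 1)\<^sup>2))"
      by (rule arg_cong[where f = E]) (auto simp: power2_eq_square algebra_simps)
    also have "\<dots> = E (\<lambda>x. (?phi x)\<^sup>2) + ((2 * (\<alpha> - 1)) * E ?phi + (\<alpha> - 1)\<^sup>2)"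
      by (simp only: E_add E_scale E_const)
    also have "E ?phi = 0" using phi0 by (simp add: E_def)
    finally have "E (\<lambda>x. (?phi x)\<^sup>2) \<le> A" by (simp add: A_def)
    then have "k / 2 * (E (\<lambda>x. (?phi x)\<^sup>2) + B) \<le> k / 2 * (A + B)"
      using k0 by (intro mult_left_mono) auto
    with 1 have 2: "E (\<lambda>x. ?phi x * ?psi x) \<le> k / 2 * (A + B)" by simp
    have "E (\<lambda>x. f0 a x * f0 b x) = E (\<lambda>x. ?phi x * ?psi x + (1 * ?phi x + \<alpha> * f0 b x))"
      by (rule arg_cong[where f = E]) (auto simp: algebra_simps)
    also have "\<dots> = E (\<lambda>x. ?phi x * ?psi x) + (1 * E ?phi + \<alpha> * \<beta>)"
      unfolding \<beta>_def by (simp only: E_add E_scale)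
    finally show ?thesis using 2 \<open>E ?phi = 0\<close> by simp
  qed
  have "E (\<lambda>x. a x ^ 3 * b x ^ 3) = E (\<lambda>x. f0 a x * f0 b x + (f1 a x * b x ^ 3 + f0 a x * f1 b x))"
    by (rule arg_cong[where f = E]) (auto simp: f1_def algebra_simps)
  also have "\<dots> = E (\<lambda>x. f0 a x * f0 b x) + (E (\<lambda>x. f1 a x * b x ^ 3) + E (\<lambda>x. f0 a x * f1 b x))"
    by (simp only: E_add)
  also have "\<dots> \<le> (\<alpha> * \<beta> + k / 2 * (A + B)) + (M * (p * 1) + M * (1 * q))"
  proof (intro add_mono bulk)
    have "E (\<lambda>x. b x ^ 3) = E (\<lambda>x. f0 b x + f1 b x)" by (simp add: f1_def)
    also have "\<dots> = \<beta> + q" by (simp only: E_add \<beta>_def q_def)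
    also have "\<dots> \<le> 1"
      using mb nn k0 mult_right_mono[of 1 l q] mult_nonneg_nonneg[of k B] M(1) unfolding l_def by linarith
    finally have b1: "E (\<lambda>x. b x ^ 3) \<le> 1" .
    have "E (\<lambda>x. f1 a x * b x ^ 3) \<le> M * (E (f1 a) * E (\<lambda>x. b x ^ 3))"
      using a b f01 inv by (intro dens) auto
    also have "\<dots> \<le> M * (p * 1)"
      using b1 M(1) nn unfolding p_def by (intro mult_left_mono) auto
    finally show "E (\<lambda>x. f1 a x * b x ^ 3) \<le> M * (p * 1)" .
    have "E (\<lambda>x. f0 a x * f1 b x) \<le> M * (E (f0 a) * E (f1 b))"
      using a b f01 inv by (intro dens) auto
    also have "\<dots> \<le> M * (1 * q)"
    proof -
      have "\<alpha> \<le> 1" using ma nn k0 M(1) mult_nonneg_nonneg[of k A] mult_nonneg_nonneg[of l p] unfolding l_def by linarith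
      then show ?thesis using M(1) nn unfolding q_def \<alpha>_def by (intro mult_left_mono mult_right_mono) auto
    qed
    finally show "E (\<lambda>x. f0 a x * f1 b x) \<le> M * (1 * q)" .
  qed
  \<comment> \<open>Both truncated means are at most 1, so their product is below their arithmetic
    mean; the claim is then half of \<open>ma\<close> plus half of \<open>mb\<close>.\<close>
  also have "\<alpha> * \<beta> \<le> (\<alpha> + \<beta>) / 2"
  proof -
    have "\<alpha> \<le> 1" "\<beta> \<le> 1"
      using ma mb nn k0 M(1) mult_nonneg_nonneg[of k A] mult_nonneg_nonneg[of l p]
        mult_nonneg_nonneg[of k B] mult_nonneg_nonneg[of l q] unfolding l_def by linarith+
    then have "\<alpha> * \<beta> \<le> \<alpha> * 1" "\<alpha> * \<beta> \<le> 1 * \<beta>"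
      using nn by (intro mult_left_mono mult_right_mono; simp)+
    then show ?thesis by simp
  qed
  finally have "E (\<lambda>x. a x ^ 3 * b x ^ 3) \<le> 1"
    using ma mb unfolding l_def mult.assoc by (simp add: field_simps)
  then show ?thesis using N by (simp add: E_def N_def pos_divide_le_eq)
qed

text \<open>By duality (the Gibbs variational principle) the claim reduces to \<open>sum_cubes_le\<close>, applied on
  each coset of \<open>K\<close> to the fourth roots of the normalized averages.\<close>

lemma block_factorization:
  fixes M :: real
  assumes K: "subgroup K G" and S: "subgroup S G" "S \<subseteq> K" and T: "subgroup T G" "T \<subseteq> K"
    and ST: "S \<inter> T = {\<one>}"
    and M: "1 \<le> M" "real (card K) \<le> M * real (card S * card T)"
    and H: "subgroup H G" "H \<subseteq> T"
    and k: "k = 1 / (4 * ((2 * M)\<^sup>2 + 2 * M + 1))"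
    and corr: "\<And>phi. (\<And>s x. s \<in> S \<Longrightarrow> x \<in> K \<Longrightarrow> phi (s \<otimes> x) = phi x) \<Longrightarrow> (\<Sum>x\<in>K. phi x) = 0 \<Longrightarrow>
        (\<Sum>x\<in>K. (avg H phi x)\<^sup>2) \<le> k\<^sup>2 * (\<Sum>x\<in>K. (phi x)\<^sup>2)"
    and g: "\<And>y. y \<in> carrier G \<Longrightarrow> 0 < g y"
  shows "gap K g \<le> 3/2 * (gap S g + gap T g)"
proof -
  have Kc: "y \<otimes> x \<in> carrier G" if "y \<in> K" "x \<in> carrier G" for x y
    using that subgroup.subset[OF K] by auto
  define t where "t = (\<lambda>R x. root 4 (avg R g x / avg K g x))"
  \<comment> \<open>The trial function of the variational principle, equal to (avg S g)^(3/4) (avg T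
    g)^(3/4) (avg K g)^(-1/2). On each coset of \<open>K\<close> the fourth powers of
    \<open>t S\<close> and \<open>t T\<close> have mean 1, as \<open>sum_cubes_le\<close>
    requires.\<close>
  define w where "w = (\<lambda>x. avg K g x * (t S x ^ 3 * t T x ^ 3))"
  have pos: "0 < avg K g x" "0 < avg S g x" "0 < avg T g x" if "x \<in> carrier G" for x
    using avg_pos[OF K that] avg_pos[OF S(1) that] avg_pos[OF T(1) that] g by auto
  have tpos: "0 < t S x" "0 < t T x" if "x \<in> carrier G" for x
    using pos[OF that] by (auto simp: t_def real_root_gt_zero)
  have wpos: "0 < w x" if "x \<in> carrier G" for x
    using pos[OF that] tpos[OF that] by (auto simp: w_def)
  have ln_t: "ln (t R x) = (ln (avg R g x) - ln (avg K g x)) / 4"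
    if "0 < avg R g x" "x \<in> carrier G" for R x
    using that pos(1)[of x] by (simp add: t_def ln_root ln_div)
  have t_props: "(\<Sum>y\<in>K. t R (y \<otimes> x) ^ 4) = card K"
      "\<And>s y. s \<in> R \<Longrightarrow> y \<in> K \<Longrightarrow> t R (s \<otimes> y \<otimes> x) = t R (y \<otimes> x)"
    if x: "x \<in> carrier G" and R: "subgroup R G" "R \<subseteq> K" for R x
  proof -
    have inv: "avg K g (y \<otimes> x) = avg K g x" if "y \<in> K" for y
      using avg_invariant[OF K that x] .
    have "t R (y \<otimes> x) ^ 4 = avg R g (y \<otimes> x) / avg K g x" if "y \<in> K" for y
      using avg_pos[OF R(1) Kc[OF that x], of g] g pos(1)[OF x] inv[OF that] by (simp add: t_def)
    then have "(\<Sum>y\<in>K. t R (y \<otimes> x) ^ 4) = (\<Sum>y\<in>K. avg R g (y \<otimes> x)) / avg K g x"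
      by (simp add: sum_divide_distrib)
    also have "(\<Sum>y\<in>K. avg R g (y \<otimes> x)) = card K * avg K (avg R g) x"
      using card_subgroup_pos[OF K] by (simp add: avg_def[of K])
    also have "avg K (avg R g) x = avg K g x" by (rule avg_avg_subset[OF K R x])
    finally show "(\<Sum>y\<in>K. t R (y \<otimes> x) ^ 4) = card K" using pos(1)[OF x] by simp
    fix s y assume sy: "s \<in> R" "y \<in> K"
    then have c: "s \<in> carrier G" "y \<in> carrier G" using R K subgroup.subset by blast+
    have "avg R g (s \<otimes> (y \<otimes> x)) = avg R g (y \<otimes> x)" by (rule avg_invariant[OF R(1) sy(1) Kc[OF sy(2) x]])
    moreover have "avg K g (s \<otimes> (y \<otimes> x)) = avg K g (y \<otimes> x)"
      using avg_invariant[OF K _ Kc[OF sy(2) x]] sy(1) R(2) by blast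
    ultimately show "t R (s \<otimes> y \<otimes> x) = t R (y \<otimes> x)" using c x by (simp add: t_def m_assoc)
  qed
  have avg_w: "avg K w x \<le> avg K g x" if x: "x \<in> carrier G" for x
  proof -
    have "(\<Sum>y\<in>K. t S (y \<otimes> x) ^ 3 * t T (y \<otimes> x) ^ 3) \<le> card K"
      using tpos[OF Kc[OF _ x]] 
      by (intro sum_cubes_le[OF K S T ST M H k corr] t_props(1)[OF x S] t_props(1)[OF x T])
        (auto intro: less_imp_le t_props(2)[OF x S] t_props(2)[OF x T])
    then have "avg K g x * (\<Sum>y\<in>K. t S (y \<otimes> x) ^ 3 * t T (y \<otimes> x) ^ 3) / card K \<le> avg K g x"
      using card_subgroup_pos[OF K] pos(1)[OF x] by (simp add: pos_divide_le_eq)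
    moreover have "avg K w x = avg K g x * (\<Sum>y\<in>K. t S (y \<otimes> x) ^ 3 * t T (y \<otimes> x) ^ 3) / card K"
      unfolding avg_def[of K w] using avg_invariant[OF K _ x, of _ g] by (simp add: w_def sum_distrib_left)
    ultimately show ?thesis by simp
  qed
  have whole: "(\<Sum>x\<in>carrier G. avg K f x) = (\<Sum>x\<in>carrier G. f x)" for f
    by (rule sum_avg[OF subgroup_self K subgroup.subset[OF K]])
  have "(\<Sum>x\<in>carrier G. w x) \<le> (\<Sum>x\<in>carrier G. g x)"
    using sum_mono[of "carrier G" "avg K w" "avg K g"] avg_w whole by simp
  then have "0 \<le> (\<Sum>x\<in>carrier G. g x - w x)" by (simp add: sum_subtractf)
  also have "\<dots> \<le> (\<Sum>x\<in>carrier G. g x * ln (g x) - 3/4 * (g x * ln (avg S g x))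
      - 3/4 * (g x * ln (avg T g x)) + 1/2 * (g x * ln (avg K g x)))"
  proof (intro sum_mono)
    fix x assume x: "x \<in> carrier G"
    have "ln (w x / g x) \<le> w x / g x - 1"
      using wpos[OF x] g[OF x] by (intro ln_le_minus_one) simp
    then have "g x * ln (w x / g x) \<le> g x * (w x / g x - 1)"
      using g[OF x] by (intro mult_left_mono) auto
    also have "\<dots> = w x - g x" using g[OF x] by (simp add: field_simps)
    finally have "g x - w x \<le> - g x * ln (w x / g x)" by simp
    also have "ln (w x / g x) = ln (w x) - ln (g x)"
      using wpos[OF x] g[OF x] by (simp add: ln_div)
    also have "ln (w x) = ln (avg K g x) + (3 * ln (t S x) + 3 * ln (t T x))"
      using pos[OF x] tpos[OF x] by (simp add: w_def ln_mult ln_realpow)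
    also have "\<dots> = 3/4 * ln (avg S g x) + 3/4 * ln (avg T g x) - 1/2 * ln (avg K g x)"
      using pos[OF x] x by (simp add: ln_t field_simps)
    finally show "g x - w x \<le> g x * ln (g x) - 3/4 * (g x * ln (avg S g x))
      - 3/4 * (g x * ln (avg T g x)) + 1/2 * (g x * ln (avg K g x))"
      by (simp add: algebra_simps)
  qed
  also have "\<dots> = (\<Sum>x\<in>carrier G. g x * ln (g x)) - 3/4 * (\<Sum>x\<in>carrier G. g x * ln (avg S g x))
      - 3/4 * (\<Sum>x\<in>carrier G. g x * ln (avg T g x)) + 1/2 * (\<Sum>x\<in>carrier G. g x * ln (avg K g x))"
    by (simp only: sum.distrib sum_subtractf sum_distrib_left)
  \<comment> \<open>The term g ln g is distributed as 1 = 3/4 + 3/4 - 1/2; solving for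
    \<open>gap K g\<close> gives the factor (3/4) / (1/2) = 3/2.\<close>
  also have "\<dots> = 3/4 * (gap S g + gap T g) - 1/2 * gap K g"
    using sum_avg_ln_avg[OF S(1) S(1) subset_refl, of g] sum_avg_ln_avg[OF T(1) T(1) subset_refl, of g]
      sum_avg_ln_avg[OF K K subset_refl, of g]
    by (simp add: gap_def sum_subtractf algebra_simps)
  finally show ?thesis by simp
qed

text \<open>The products \<open>s \<otimes> w \<otimes> u\<close> with \<open>w\<close> in \<open>D\<close> cover \<open>D\<close> uniformly, and \<open>D\<close> is almost all of \<open>K\<close>, so
  averaging an \<open>S\<close>-invariant function over \<open>H\<close> almost amounts to averaging it over \<open>K\<close>.\<close>

lemma sum_avg_square_le:
  assumes K: "subgroup K G" and S: "subgroup S G" "S \<subseteq> K" and H: "subgroup H G" "H \<subseteq> K"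
    and U: "subgroup U G" "U \<subseteq> S" and D: "D \<subseteq> K"
    and DH: "\<And>s w u. s \<in> S \<Longrightarrow> w \<in> H \<inter> D \<Longrightarrow> u \<in> U \<Longrightarrow> s \<otimes> w \<otimes> u \<in> D"
    and fibre: "\<And>y. y \<in> D \<Longrightarrow> card {z \<in> S \<times> (H \<inter> D) \<times> U. fst z \<otimes> fst (snd z) \<otimes> snd (snd z) = y} = \<nu>"
    and e1: "real (card (H - D)) \<le> e1 * real (card H)"
    and e2: "real (card (K - D)) \<le> e2 * real (card D)"
    and phi: "\<And>s x. s \<in> S \<Longrightarrow> x \<in> K \<Longrightarrow> phi (s \<otimes> x) = phi x" "(\<Sum>x\<in>K. phi x) = 0"
  shows "(\<Sum>x\<in>K. (avg H phi x)\<^sup>2) \<le> (e1 + e2) * (\<Sum>x\<in>K. (phi x)\<^sup>2)"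
proof -
  have fin: "finite K" "finite S" "finite H" "finite U" using K S H U finite_subgroup by auto
  have finD: "finite D" using D fin finite_subset by blast
  have sub: "K \<subseteq> carrier G" using K subgroup.subset by auto
  have mK: "x \<otimes> y \<in> K" if "x \<in> K" "y \<in> K" for x y using that K by (simp add: subgroup.m_closed)
  define Q where "Q = (\<Sum>x\<in>K. (phi x)\<^sup>2)"
  have Q0: "0 \<le> Q" by (simp add: Q_def sum_nonneg)
  \<comment> \<open>The autocorrelation of \<open>phi\<close>. Its mean over \<open>H\<close> is the
    left-hand side of the claim; its invariance under \<open>S\<close> on the left and
    \<open>U\<close> on the right lets the sum over \<open>H \<inter> D\<close> be spread over all
    of \<open>D\<close>.\<close>
  define C where "C = (\<lambda>y. \<Sum>x\<in>K. phi x * phi (y \<otimes> x))"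
  have C_le: "\<bar>C y\<bar> \<le> Q" if y: "y \<in> K" for y
  proof -
    have "\<bar>C y\<bar> \<le> (\<Sum>x\<in>K. \<bar>phi x * phi (y \<otimes> x)\<bar>)" unfolding C_def by (rule sum_abs)
    also have "\<dots> \<le> (\<Sum>x\<in>K. ((phi x)\<^sup>2 + (phi (y \<otimes> x))\<^sup>2) / 2)"
    proof (intro sum_mono)
      fix x
      have "0 \<le> (\<bar>phi x\<bar> - \<bar>phi (y \<otimes> x)\<bar>)\<^sup>2" by simp
      then show "\<bar>phi x * phi (y \<otimes> x)\<bar> \<le> ((phi x)\<^sup>2 + (phi (y \<otimes> x))\<^sup>2) / 2"
        by (simp add: power2_diff abs_mult)
    qed
    also have "\<dots> = Q"
      using sum_left_translate[OF K y, of "\<lambda>x. (phi x)\<^sup>2"]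
      by (simp add: Q_def sum.distrib sum_divide_distrib[symmetric])
    finally show ?thesis .
  qed
  have C_S: "C (s \<otimes> y) = C y" if "s \<in> S" "y \<in> K" for s y
    unfolding C_def
  proof (intro sum.cong refl)
    fix x assume x: "x \<in> K"
    have "s \<otimes> y \<otimes> x = s \<otimes> (y \<otimes> x)" using that x sub S(2) by (intro m_assoc) auto
    then show "phi x * phi (s \<otimes> y \<otimes> x) = phi x * phi (y \<otimes> x)"
      using phi(1)[OF that(1) mK[OF that(2) x]] by simp
  qed
  have C_U: "C (y \<otimes> u) = C y" if "u \<in> U" "y \<in> K" for u y
  proof -
    have u: "u \<in> S" "u \<in> K" using that U(2) S(2) by auto
    have "C (y \<otimes> u) = (\<Sum>x\<in>K. phi (u \<otimes> x) * phi (y \<otimes> (u \<otimes> x)))"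
      unfolding C_def
    proof (intro sum.cong refl)
      fix x assume x: "x \<in> K"
      have "y \<otimes> u \<otimes> x = y \<otimes> (u \<otimes> x)" using that x sub u by (intro m_assoc) auto
      then show "phi x * phi (y \<otimes> u \<otimes> x) = phi (u \<otimes> x) * phi (y \<otimes> (u \<otimes> x))"
        using phi(1)[OF u(1) x] by simp
    qed
    also have "\<dots> = C y" unfolding C_def by (rule sum_left_translate[OF K u(2)])
    finally show ?thesis .
  qed
  have C_sum: "(\<Sum>y\<in>K. C y) = 0"
  proof -
    have "(\<Sum>y\<in>K. C y) = (\<Sum>x\<in>K. \<Sum>y\<in>K. phi x * phi (y \<otimes> x))"
      unfolding C_def by (rule sum.swap)
    also have "\<dots> = (\<Sum>x\<in>K. phi x * (\<Sum>y\<in>K. phi y))"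
      by (intro sum.cong refl) (simp add: sum_distrib_left[symmetric] sum_right_translate[OF K, of _ phi])
    finally show ?thesis by (simp add: phi(2))
  qed
  let ?Z = "S \<times> (H \<inter> D) \<times> U"
  let ?m = "\<lambda>z. fst z \<otimes> fst (snd z) \<otimes> snd (snd z)"
  have fibres: "(\<Sum>z\<in>?Z. F (?m z)) = \<nu> * (\<Sum>y\<in>D. F y)" for F :: "'a \<Rightarrow> real"
  proof -
    have "(\<Sum>z\<in>?Z. F (?m z)) = (\<Sum>y\<in>D. \<Sum>z\<in>{z \<in> ?Z. ?m z = y}. F (?m z))"
      by (rule sum.group[symmetric]) (use fin finD DH in auto)
    also have "\<dots> = (\<Sum>y\<in>D. \<Sum>z\<in>{z \<in> ?Z. ?m z = y}. F y)"
      by (intro sum.cong refl) auto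
    also have "\<dots> = (\<Sum>y\<in>D. \<nu> * F y)" using fibre by simp
    finally show ?thesis by (simp add: sum_distrib_left)
  qed
  have count: "real (card S) * real (card (H \<inter> D)) * real (card U) = \<nu> * real (card D)"
    using fibres[of "\<lambda>_. 1"] by (simp add: card_cartesian_product)
  have "real (card S) * real (card U) * (\<Sum>w\<in>H \<inter> D. C w) = (\<Sum>z\<in>?Z. C (fst (snd z)))"
  proof -
    have "(\<Sum>z\<in>?Z. C (fst (snd z))) = (\<Sum>s\<in>S. \<Sum>w\<in>H \<inter> D. \<Sum>u\<in>U. C w)"
      by (simp add: sum.cartesian_product')
    then show ?thesis by (simp add: sum_distrib_left mult.assoc)
  qed
  also have "\<dots> = (\<Sum>z\<in>?Z. C (?m z))"
  proof (intro sum.cong refl)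
    fix z assume "z \<in> ?Z"
    then have "fst z \<in> S" "fst (snd z) \<in> K" "snd (snd z) \<in> U" "fst z \<otimes> fst (snd z) \<in> K"
      using H S by (auto intro!: mK)
    then show "C (fst (snd z)) = C (?m z)" using C_S C_U by simp
  qed
  also have "\<dots> = \<nu> * (\<Sum>y\<in>D. C y)" by (rule fibres)
  \<comment> \<open>The sum of \<open>C\<close> over \<open>K\<close> is the square of the sum of
    \<open>phi\<close>, hence zero, so the sum over \<open>D\<close> is controlled by the few
    elements outside \<open>D\<close>.\<close>
  also have "(\<Sum>y\<in>D. C y) = (\<Sum>y\<in>K - D. - C y)"
    using C_sum sum.subset_diff[OF D fin(1), of C] by (simp add: sum_negf)
  also have "\<dots> \<le> real (card (K - D)) * Q"
    using C_le by (intro order_trans[OF sum_bounded_above[where K = Q]]) (auto simp: abs_le_iff)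
  also have "\<dots> \<le> e2 * real (card D) * Q" using e2 Q0 by (intro mult_right_mono) auto
  finally have "real (card S) * real (card U) * (\<Sum>w\<in>H \<inter> D. C w) \<le> real \<nu> * (e2 * real (card D) * Q)"
    by (simp add: mult_left_mono)
  also have "\<dots> = real (card S) * real (card U) * (e2 * real (card (H \<inter> D)) * Q)"
    using count by (simp add: ac_simps)
  finally have good: "(\<Sum>w\<in>H \<inter> D. C w) \<le> e2 * real (card (H \<inter> D)) * Q"
    using card_subgroup_pos[OF S(1)] card_subgroup_pos[OF U(1)] by simp
  have e20: "0 \<le> e2"
  proof -
    have "0 < card K" by (rule card_subgroup_pos[OF K])
    then have "card D \<noteq> 0 \<or> card (K - D) \<noteq> 0" using card_Diff_subset[OF finD D] by auto
    then have "0 < real (card D)" using e2 by (cases "card D = 0") auto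
    moreover have "0 \<le> e2 * real (card D)" using e2 by (rule order_trans[rotated]) simp
    ultimately show ?thesis by (simp add: zero_le_mult_iff)
  qed
  have "e2 * real (card (H \<inter> D)) * Q \<le> e2 * real (card H) * Q"
    using e20 Q0 fin by (intro mult_right_mono mult_left_mono) (auto intro: card_mono)
  with good have good: "(\<Sum>w\<in>H \<inter> D. C w) \<le> e2 * real (card H) * Q" by simp
  have "(\<Sum>w\<in>H - D. C w) \<le> real (card (H - D)) * Q"
    using C_le H by (intro order_trans[OF sum_bounded_above[where K = Q]]) (auto simp: abs_le_iff)
  also have "\<dots> \<le> e1 * real (card H) * Q" using e1 Q0 by (intro mult_right_mono) auto
  finally have bad: "(\<Sum>w\<in>H - D. C w) \<le> e1 * real (card H) * Q" .
  have "(\<Sum>x\<in>K. (avg H phi x)\<^sup>2) = (\<Sum>x\<in>K. phi x * avg H phi x)"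
    using avg_invariant[OF H(1)] sub
    by (simp add: power2_eq_square) (intro sum_avg_mult[OF K H], auto)
  also have "\<dots> = (\<Sum>x\<in>K. \<Sum>w\<in>H. phi x * phi (w \<otimes> x)) / card H"
    by (simp add: avg_def sum_divide_distrib sum_distrib_left)
  also have "\<dots> = (\<Sum>w\<in>H. C w) / card H" unfolding C_def by (subst sum.swap) simp
  also have "(\<Sum>w\<in>H. C w) = (\<Sum>w\<in>H \<inter> D. C w) + (\<Sum>w\<in>H - D. C w)"
    using sum.Int_Diff[OF fin(3)] .
  also have "\<dots> / card H \<le> (e2 * real (card H) * Q + e1 * real (card H) * Q) / card H"
    using good bad by (intro divide_right_mono add_mono) auto
  also have "\<dots> = (e1 + e2) * Q" using card_subgroup_pos[OF H(1)] by (simp add: field_simps)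
  finally show ?thesis by (simp add: Q_def)
qed

end

section \<open>Matrices of full row rank over the field with two elements\<close>

lemma bit_double [simp]: "(x :: bit) + x = 0"
  by (cases x rule: bit.exhaust) simp_all

lemma bit_eqI: "(x = 1 \<longleftrightarrow> y = 1) \<Longrightarrow> (x :: bit) = y"
  by (cases x rule: bit.exhaust; cases y rule: bit.exhaust) simp_all

text \<open>A certificate of full row rank that can be extended row by row and that solves linear
  systems explicitly.\<close>

definition right_inverse :: "'a set \<Rightarrow> 'b set \<Rightarrow> ('a \<Rightarrow> 'b \<Rightarrow> 'f :: field) \<Rightarrow> ('b \<Rightarrow> 'a \<Rightarrow> 'f) \<Rightarrow> bool" where
  "right_inverse A B q S \<longleftrightarrow> (\<forall>i\<in>A. \<forall>j\<in>A. (\<Sum>k\<in>B. q i k * S k j) = of_bool (i = j))"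

lemma right_inverse_cong:
  assumes "\<And>i k. i \<in> A \<Longrightarrow> k \<in> B \<Longrightarrow> q i k = q' i k"
  shows "right_inverse A B q s \<longleftrightarrow> right_inverse A B q' s"
proof -
  have "(\<Sum>k\<in>B. q i k * s k j) = (\<Sum>k\<in>B. q' i k * s k j)" if "i \<in> A" for i j
    using assms that by (intro sum.cong) auto
  then show ?thesis by (simp add: right_inverse_def)
qed

text \<open>Matrices over the two-element field are coded by the positions of their ones, so that
  counting matrices is counting subsets.\<close>

definition full_rank :: "'a set \<Rightarrow> 'b set \<Rightarrow> ('a \<times> 'b) set set" where
  "full_rank A B = {Q. Q \<subseteq> A \<times> B \<and> (\<exists>S. right_inverse A B (\<lambda>i k. of_bool ((i, k) \<in> Q) :: bit) S)}"

lemma finite_full_rank: "finite A \<Longrightarrow> finite B \<Longrightarrow> finite (full_rank A B)"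
  by (rule finite_subset[of _ "Pow (A \<times> B)"]) (auto simp: full_rank_def)

lemma full_rank_empty: "full_rank {} B = {{}}"
  by (auto simp: full_rank_def right_inverse_def)

text \<open>The new row can only be the combination of the old ones with coefficients
  \<open>t\<close>, the new row times \<open>S\<close>. If this fails in column \<open>k0\<close>
  with residue \<open>c\<close>, the vector \<open>s\<close> is killed by the old rows and paired to
  1 by the new one. It becomes the new column, and multiples of it correct the old columns.\<close>

lemma right_inverse_insert:
  fixes q :: "'a \<Rightarrow> 'b \<Rightarrow> 'f :: field"
  assumes fin: "finite A" "finite B" and a: "a \<notin> A" and S: "right_inverse A B q S"
    and out: "\<not> (\<forall>k\<in>B. q a k = (\<Sum>i\<in>A. (\<Sum>l\<in>B. q a l * S l i) * q i k))"
  shows "\<exists>S'. right_inverse (insert a A) B q S'"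
proof -
  define t where "t = (\<lambda>j. \<Sum>l\<in>B. q a l * S l j)"
  obtain k0 where k0: "k0 \<in> B" "q a k0 \<noteq> (\<Sum>i\<in>A. t i * q i k0)"
    using out by (auto simp: t_def)
  define c where "c = q a k0 - (\<Sum>i\<in>A. t i * q i k0)"
  have c: "c \<noteq> 0" using k0 by (simp add: c_def)
  define s where "s = (\<lambda>k. (of_bool (k = k0) - (\<Sum>i\<in>A. S k i * q i k0)) / c)"
  define S' where "S' = (\<lambda>k j. if j = a then s k else S k j - s k * t j)"
  have SA: "(\<Sum>k\<in>B. q i k * S k j) = of_bool (i = j)" if "i \<in> A" "j \<in> A" for i j
    using S that by (auto simp: right_inverse_def)
  have s_sum: "(\<Sum>k\<in>B. q i k * s k) = (q i k0 - (\<Sum>j\<in>A. (\<Sum>k\<in>B. q i k * S k j) * q j k0)) / c" for i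
  proof -
    have "(\<Sum>k\<in>B. q i k * s k) =
        ((\<Sum>k\<in>B. q i k * of_bool (k = k0)) - (\<Sum>k\<in>B. \<Sum>j\<in>A. q i k * S k j * q j k0)) / c"
      by (simp add: s_def right_diff_distrib sum_subtractf sum_distrib_left mult.assoc sum_divide_distrib
          diff_divide_distrib)
    also have "(\<Sum>k\<in>B. \<Sum>j\<in>A. q i k * S k j * q j k0) = (\<Sum>j\<in>A. \<Sum>k\<in>B. q i k * S k j * q j k0)"
      by (rule sum.swap)
    also have "(\<Sum>k\<in>B. q i k * of_bool (k = k0)) = q i k0"
      using k0(1) fin by (simp add: of_bool_def if_distrib[of "\<lambda>x. _ * x"] sum.delta cong: if_cong)
    finally show ?thesis by (simp add: sum_distrib_right)
  qed
  have sA: "(\<Sum>k\<in>B. q i k * s k) = 0" if "i \<in> A" for i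
  proof -
    have "(\<Sum>j\<in>A. (\<Sum>k\<in>B. q i k * S k j) * q j k0) = (\<Sum>j\<in>A. if i = j then q j k0 else 0)"
      using SA[OF that] by (intro sum.cong) auto
    also have "\<dots> = q i k0" using that fin by (simp add: sum.delta)
    finally show ?thesis by (simp add: s_sum)
  qed
  have sa: "(\<Sum>k\<in>B. q a k * s k) = 1"
    using c by (simp add: s_sum) (simp add: c_def t_def)
  have split: "(\<Sum>k\<in>B. q i k * (S k j - s k * t j)) = (\<Sum>k\<in>B. q i k * S k j) - (\<Sum>k\<in>B. q i k * s k) * t j" for i j
    by (simp add: right_diff_distrib sum_subtractf sum_distrib_right mult.assoc)
  have "right_inverse (insert a A) B q S'"
    unfolding right_inverse_def
  proof (intro ballI)
    fix i j assume ij: "i \<in> insert a A" "j \<in> insert a A"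
    show "(\<Sum>k\<in>B. q i k * S' k j) = of_bool (i = j)"
    proof (cases "j = a")
      case True
      then show ?thesis using ij(1) sA sa a by (auto simp: S'_def)
    next
      case False
      then have j: "j \<in> A" using ij by auto
      show ?thesis
      proof (cases "i = a")
        case True
        then show ?thesis using \<open>j \<noteq> a\<close> sa j by (simp add: S'_def split) (simp add: t_def)
      next
        case False
        with ij show ?thesis using \<open>j \<noteq> a\<close> sA SA j by (simp add: S'_def split)
      qed
    qed
  qed
  then show ?thesis by blast
qed

text \<open>Any new row outside the span of the old ones keeps the rank full, and the span has at
  most one vector for each subset of \<open>A\<close>.\<close>

lemma card_full_rank_insert:
  assumes fin: "finite A" "finite B" and a: "a \<notin> A"
  shows "card (full_rank A B) * (2 ^ card B - 2 ^ card A) \<le> card (full_rank (insert a A) B)"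
proof -
  define span where "span = (\<lambda>Q. (\<lambda>T. {k \<in> B. (\<Sum>i\<in>A. of_bool (i \<in> T) * of_bool ((i, k) \<in> Q)) = (1 :: bit)}) ` Pow A)"
  have span_card: "card (span Q) \<le> 2 ^ card A" for Q
    unfolding span_def card_Pow[OF fin(1), symmetric]
    by (rule card_image_le) (simp add: fin)
  have fin_span: "finite (span Q)" for Q using fin by (simp add: span_def)
  let ?Z = "Sigma (full_rank A B) (\<lambda>Q. Pow B - span Q)"
  let ?f = "\<lambda>(Q, r). Q \<union> {a} \<times> r"
  have inj: "inj_on ?f ?Z"
  proof (rule inj_onI, clarify)
    fix Q r Q' r' assume m: "Q \<in> full_rank A B" "Q' \<in> full_rank A B"
      and e: "Q \<union> {a} \<times> r = Q' \<union> {a} \<times> r'"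
    have "Q \<subseteq> A \<times> B" "Q' \<subseteq> A \<times> B" using m by (auto simp: full_rank_def)
    then show "Q = Q' \<and> r = r'" using e a by blast
  qed
  have "?f ` ?Z \<subseteq> full_rank (insert a A) B"
  proof clarify
    fix Q r assume Q: "Q \<in> full_rank A B" and r: "r \<subseteq> B" "r \<notin> span Q"
    let ?q = "\<lambda>i k. of_bool ((i, k) \<in> Q \<union> {a} \<times> r) :: bit"
    have QAB: "Q \<subseteq> A \<times> B" using Q by (auto simp: full_rank_def)
    obtain S where "right_inverse A B (\<lambda>i k. of_bool ((i, k) \<in> Q) :: bit) S"
      using Q by (auto simp: full_rank_def)
    moreover have q_eq: "?q i k = of_bool ((i, k) \<in> Q)" if "i \<in> A" for i k
      using that a by auto
    ultimately have S: "right_inverse A B ?q S" by (simp add: right_inverse_def)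
    have "\<not> (\<forall>k\<in>B. ?q a k = (\<Sum>i\<in>A. (\<Sum>l\<in>B. ?q a l * S l i) * ?q i k))"
    proof
      assume *: "\<forall>k\<in>B. ?q a k = (\<Sum>i\<in>A. (\<Sum>l\<in>B. ?q a l * S l i) * ?q i k)"
      define T where "T = {i \<in> A. (\<Sum>l\<in>B. ?q a l * S l i) = 1}"
      have "k \<in> r \<longleftrightarrow> (\<Sum>i\<in>A. of_bool (i \<in> T) * of_bool ((i, k) \<in> Q)) = (1 :: bit)" if k: "k \<in> B" for k
      proof -
        have "of_bool (i \<in> T) * of_bool ((i, k) \<in> Q) = (\<Sum>l\<in>B. ?q a l * S l i) * ?q i k" if "i \<in> A" for i
          unfolding q_eq[OF that] T_def using that
          by (cases "\<Sum>l\<in>B. ?q a l * S l i" rule: bit.exhaust) simp_all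
        then have "(\<Sum>i\<in>A. of_bool (i \<in> T) * of_bool ((i, k) \<in> Q) :: bit) = (\<Sum>i\<in>A. (\<Sum>l\<in>B. ?q a l * S l i) * ?q i k)"
          by (rule sum.cong[OF refl])
        also have "\<dots> = ?q a k" by (rule bspec[OF * k, symmetric])
        also have "\<dots> = of_bool (k \<in> r)" using a QAB by auto
        finally show ?thesis by simp
      qed
      then have "r = {k \<in> B. (\<Sum>i\<in>A. of_bool (i \<in> T) * of_bool ((i, k) \<in> Q)) = (1 :: bit)}"
        using r(1) by blast
      then have "r \<in> span Q" unfolding span_def by (rule image_eqI) (auto simp: T_def)
      then show False using r(2) by simp
    qed
    from right_inverse_insert[OF fin a S this]
    show "Q \<union> {a} \<times> r \<in> full_rank (insert a A) B"
      using QAB r(1) by (auto simp: full_rank_def)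
  qed
  from card_mono[OF finite_full_rank this] have "card ?Z \<le> card (full_rank (insert a A) B)"
    using fin card_image[OF inj] by simp
  moreover have "card (full_rank A B) * (2 ^ card B - 2 ^ card A) \<le> card ?Z"
  proof -
    have "(\<Sum>Q\<in>full_rank A B. 2 ^ card B - 2 ^ card A) \<le> (\<Sum>Q\<in>full_rank A B. card (Pow B - span Q))"
    proof (intro sum_mono)
      fix Q
      have "2 ^ card B - 2 ^ card A \<le> card (Pow B) - card (span Q)"
        using fin span_card[of Q] by (simp add: card_Pow)
      also have "\<dots> \<le> card (Pow B - span Q)" by (rule diff_card_le_card_Diff[OF fin_span])
      finally show "2 ^ card B - 2 ^ card A \<le> card (Pow B - span Q)" .
    qed
    also have "\<dots> = card ?Z"
      using fin by (subst card_SigmaI) (auto simp: finite_full_rank)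
    finally show ?thesis by simp
  qed
  ultimately show ?thesis by linarith
qed

lemma card_full_rank_ge_prod:
  assumes "finite A" "finite B" "card A \<le> card B"
  shows "2 ^ (card A * card B) * (\<Prod>i<card A. 1 - 2 ^ i / 2 ^ card B) \<le> real (card (full_rank A B))"
  using assms(1,3)
proof (induction A rule: finite_induct)
  case empty
  show ?case by (simp add: full_rank_empty)
next
  case (insert a A)
  let ?b = "card B"
  have c: "card (insert a A) = Suc (card A)" "card A \<le> ?b" using insert by auto
  have nn: "0 \<le> 1 - (2::real) ^ i / 2 ^ ?b" if "i \<le> ?b" for i
    using that by (simp add: power_increasing)
  have "(2::real) ^ (card (insert a A) * ?b) * (\<Prod>i<card (insert a A). 1 - 2 ^ i / 2 ^ ?b) =
      (2 ^ (card A * ?b) * (\<Prod>i<card A. 1 - 2 ^ i / 2 ^ ?b)) * (2 ^ ?b * (1 - 2 ^ card A / 2 ^ ?b))"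
    by (simp only: c prod.lessThan_Suc) (simp add: power_add)
  also have "\<dots> \<le> real (card (full_rank A B)) * (2 ^ ?b * (1 - 2 ^ card A / 2 ^ ?b))"
    using insert.IH c nn by (intro mult_right_mono) auto
  also have "2 ^ ?b * (1 - (2::real) ^ card A / 2 ^ ?b) = real (2 ^ ?b - 2 ^ card A)"
    using c by (simp add: of_nat_diff power_increasing right_diff_distrib)
  also have "real (card (full_rank A B)) * \<dots> \<le> real (card (full_rank (insert a A) B))"
    using card_full_rank_insert[OF insert(1) assms(2) insert(2)]
    by (simp only: of_nat_mult[symmetric] of_nat_le_iff)
  finally show ?case .
qed

lemma card_full_rank_ge:
  assumes "finite A" "finite B" "card A \<le> card B"
  shows "2 ^ (card A * card B) * (1 - 2 ^ card A / 2 ^ card B) \<le> real (card (full_rank A B))"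
proof -
  have "1 - (\<Sum>i<card A. (2::real) ^ i / 2 ^ card B) \<le> (\<Prod>i<card A. 1 - 2 ^ i / 2 ^ card B)"
    using assms(3) by (intro Weierstrass_prod_ineq) (auto simp: power_increasing)
  moreover have "(\<Sum>i<card A. (2::real) ^ i / 2 ^ card B) \<le> 2 ^ card A / 2 ^ card B"
    by (simp add: sum_divide_distrib[symmetric] divide_right_mono geometric_sum)
  ultimately have "1 - (2::real) ^ card A / 2 ^ card B \<le> (\<Prod>i<card A. 1 - 2 ^ i / 2 ^ card B)" by simp
  then show ?thesis
    by (intro order_trans[OF mult_left_mono card_full_rank_ge_prod[OF assms]]) auto
qed

lemma prod_one_minus_half_powers:
  "1 / 4 \<le> (\<Prod>i<n. 1 - 2 ^ i / 2 ^ n :: real)"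
proof -
  have eq: "(\<Prod>i<n. 1 - 2 ^ i / 2 ^ n :: real) = (\<Prod>i<n. 1 - (1/2) ^ Suc i)"
  proof (rule prod.reindex_bij_witness[where i = "\<lambda>i. n - Suc i" and j = "\<lambda>i. n - Suc i"])
    fix i assume "i \<in> {..<n}"
    then have "(2::real) ^ n = 2 ^ i * 2 ^ Suc (n - Suc i)"
      by (simp only: power_add[symmetric]) simp
    then show "1 - (1/2) ^ Suc (n - Suc i) = 1 - 2 ^ i / (2::real) ^ n"
      by (simp add: power_one_over)
  qed auto
  \<comment> \<open>The bare bound 1/4 is not inductive, since each factor is below 1; the added
    term absorbs the loss, with equality at \<open>m = 0\<close>.\<close>
  have "1/4 + (1/2) ^ Suc (Suc m) \<le> (\<Prod>i<Suc m. 1 - (1/2) ^ Suc i :: real)" for m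
  proof (induction m)
    case (Suc m)
    let ?x = "(1/2 :: real) ^ Suc (Suc m)"
    have x: "0 \<le> ?x" "?x \<le> 1/4" using power_le_one[of "1/2 :: real" m] by auto
    have "?x * ?x \<le> 1/4 * ?x" using x by (intro mult_right_mono) auto
    then have "1/4 + (1/2) ^ Suc (Suc (Suc m)) \<le> (1/4 + ?x) * (1 - ?x)"
      by (simp add: algebra_simps)
    also have "\<dots> \<le> (\<Prod>i<Suc m. 1 - (1/2) ^ Suc i) * (1 - ?x)"
      using Suc.IH x by (intro mult_right_mono) auto
    finally show ?case by (simp only: prod.lessThan_Suc[of _ "Suc m"])
  qed auto
  then have *: "1/4 \<le> (\<Prod>i<Suc m. 1 - (1/2) ^ Suc i :: real)" for m
    by (rule order_trans[rotated]) simp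
  have "1/4 \<le> (\<Prod>i<n. 1 - (1/2) ^ Suc i :: real)"
  proof (cases n)
    case (Suc m)
    then show ?thesis using * by simp
  qed simp
  then show ?thesis by (simp only: eq)
qed

lemma card_full_rank_square_ge:
  assumes "finite A"
  shows "2 ^ (card A * card A) / 4 \<le> real (card (full_rank A A))"
  using order_trans[OF mult_left_mono[OF prod_one_minus_half_powers, of "2 ^ (card A * card A)"]
      card_full_rank_ge_prod[OF assms assms order_refl]] by simp

text \<open>The set \<open>C0 P\<close> codes the product of \<open>s\<close> with \<open>P\<close>,
  a solution for the target \<open>P\<close>. Symmetric difference, which is addition of coded
  matrices, with this solution is a bijection between fibres, so the fibres over all
  \<open>A\<close> by \<open>A\<close> targets have equal size.\<close>

lemma card_right_inverse_fibre:
  fixes q :: "'a \<Rightarrow> 'b \<Rightarrow> bit"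
  assumes fin: "finite A" "finite B" and s: "right_inverse A B q s"
  shows "card {C \<in> Pow (B \<times> A). \<forall>i\<in>A. \<forall>j\<in>A. (\<Sum>k\<in>B. q i k * of_bool ((k, j) \<in> C)) = r i j}
      * 2 ^ (card A * card A) = 2 ^ (card A * card B)"
proof -
  define sd where "sd = (\<lambda>(C :: ('b \<times> 'a) set) D. (C - D) \<union> (D - C))"
  define F where "F = (\<lambda>C. {(i, j) \<in> A \<times> A. (\<Sum>k\<in>B. q i k * of_bool ((k, j) \<in> C)) = 1})"
  define C0 where "C0 = (\<lambda>P. {(k, j) \<in> B \<times> A. (\<Sum>i\<in>A. s k i * of_bool ((i, j) \<in> P)) = 1})"
  define fib where "fib = (\<lambda>P. {C \<in> Pow (B \<times> A). F C = P})"
  have sd_sum: "(\<Sum>k\<in>B. q i k * of_bool ((k, j) \<in> sd C D)) =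
      (\<Sum>k\<in>B. q i k * of_bool ((k, j) \<in> C)) + (\<Sum>k\<in>B. q i k * of_bool ((k, j) \<in> D))" for i j C D
  proof -
    have "q i k * of_bool ((k, j) \<in> sd C D) = q i k * of_bool ((k, j) \<in> C) + q i k * of_bool ((k, j) \<in> D)" for k
      by (cases "(k, j) \<in> C"; cases "(k, j) \<in> D") (simp_all add: sd_def)
    then show ?thesis by (simp only: sum.distrib)
  qed
  have C0_sum: "(\<Sum>k\<in>B. q i k * of_bool ((k, j) \<in> C0 P)) = of_bool ((i, j) \<in> P)"
    if ij: "i \<in> A" "j \<in> A" for i j P
  proof -
    have "q i k * of_bool ((k, j) \<in> C0 P) = (\<Sum>l\<in>A. q i k * s k l * of_bool ((l, j) \<in> P))" if "k \<in> B" for k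
    proof -
      have "of_bool ((k, j) \<in> C0 P) = (\<Sum>l\<in>A. s k l * of_bool ((l, j) \<in> P))"
        by (rule bit_eqI) (use that ij in \<open>auto simp: C0_def\<close>)
      then show ?thesis by (simp only: sum_distrib_left mult.assoc)
    qed
    then have "(\<Sum>k\<in>B. q i k * of_bool ((k, j) \<in> C0 P)) = (\<Sum>k\<in>B. \<Sum>l\<in>A. q i k * s k l * of_bool ((l, j) \<in> P))"
      by (rule sum.cong[OF refl])
    also have "\<dots> = (\<Sum>l\<in>A. \<Sum>k\<in>B. q i k * s k l * of_bool ((l, j) \<in> P))" by (rule sum.swap)
    also have "\<dots> = (\<Sum>l\<in>A. if l = i then of_bool ((l, j) \<in> P) else 0)"
    proof (intro sum.cong refl)
      fix l assume "l \<in> A"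
      then have "(\<Sum>k\<in>B. q i k * s k l) = of_bool (i = l)" using s ij by (simp only: right_inverse_def)
      then show "(\<Sum>k\<in>B. q i k * s k l * of_bool ((l, j) \<in> P)) = (if l = i then of_bool ((l, j) \<in> P) else 0)"
        by (cases "l = i") (simp_all only: sum_distrib_right[symmetric], simp_all)
    qed
    also have "\<dots> = of_bool ((i, j) \<in> P)"
      using ij fin by (simp only: sum.delta if_True)
    finally show ?thesis .
  qed
  have sd_C0: "sd C (C0 P) \<in> fib (F C - P \<union> (P - F C))" if "C \<in> Pow (B \<times> A)" "P \<subseteq> A \<times> A" for C P
  proof -
    have "(i, j) \<in> F (sd C (C0 P)) \<longleftrightarrow> (i, j) \<in> F C - P \<union> (P - F C)" for i j
    proof (cases "(i, j) \<in> A \<times> A")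
      case True
      then have ij: "i \<in> A" "j \<in> A" by auto
      have "(i, j) \<in> F (sd C (C0 P)) \<longleftrightarrow> (\<Sum>k\<in>B. q i k * of_bool ((k, j) \<in> C)) + of_bool ((i, j) \<in> P) = 1"
        using True C0_sum[OF ij] sd_sum by (simp only: F_def mem_Collect_eq case_prod_conv simp_thms)
      moreover have "(i, j) \<in> F C \<longleftrightarrow> (\<Sum>k\<in>B. q i k * of_bool ((k, j) \<in> C)) = 1"
        using True by (simp only: F_def mem_Collect_eq case_prod_conv simp_thms)
      ultimately show ?thesis
        by (cases "\<Sum>k\<in>B. q i k * of_bool ((k, j) \<in> C)" rule: bit.exhaust; cases "(i, j) \<in> P")
          (simp_all only: Un_iff Diff_iff, simp_all)
    next
      case False
      then have "(i, j) \<notin> F X" for X unfolding F_def by blast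
      moreover have "(i, j) \<notin> P" using False that by blast
      ultimately show ?thesis by blast
    qed
    then have "F (sd C (C0 P)) = F C - P \<union> (P - F C)"
      by (simp only: set_eq_iff split_paired_All) simp
    moreover have "sd C (C0 P) \<subseteq> B \<times> A" using that by (auto simp: sd_def C0_def)
    ultimately show ?thesis unfolding fib_def by blast
  qed
  have fib_card: "card (fib P) = card (fib {})" if P: "P \<subseteq> A \<times> A" for P
  proof -
    have "bij_betw (\<lambda>C. sd C (C0 P)) (fib P) (fib {})"
    proof (rule bij_betw_byWitness[where f' = "\<lambda>C. sd C (C0 P)"])
      show "(\<lambda>C. sd C (C0 P)) ` fib P \<subseteq> fib {}"
      proof (rule image_subsetI)
        fix C assume C: "C \<in> fib P"
        then have "sd C (C0 P) \<in> fib (F C - P \<union> (P - F C))" by (intro sd_C0 P) (simp add: fib_def)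
        also have "F C - P \<union> (P - F C) = {}" using C by (simp add: fib_def)
        finally show "sd C (C0 P) \<in> fib {}" .
      qed
      show "(\<lambda>C. sd C (C0 P)) ` fib {} \<subseteq> fib P"
      proof (rule image_subsetI)
        fix C assume C: "C \<in> fib {}"
        then have "sd C (C0 P) \<in> fib (F C - P \<union> (P - F C))" by (intro sd_C0 P) (simp add: fib_def)
        also have "F C - P \<union> (P - F C) = P" using C by (simp add: fib_def)
        finally show "sd C (C0 P) \<in> fib P" .
      qed
    qed (auto simp: sd_def)
    then show ?thesis by (rule bij_betw_same_card)
  qed
  have F_sub: "F C \<subseteq> A \<times> A" for C unfolding F_def by blast
  have "(\<Sum>P\<in>Pow (A \<times> A). card (fib P)) = card (Pow (B \<times> A))"
  proof -
    have "(\<Sum>P\<in>Pow (A \<times> A). \<Sum>C\<in>{C \<in> Pow (B \<times> A). F C = P}. 1) = (\<Sum>C\<in>Pow (B \<times> A). 1 :: nat)"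
      by (rule sum.group) (use fin F_sub in auto)
    then show ?thesis by (simp only: fib_def card_eq_sum)
  qed
  moreover have "(\<Sum>P\<in>Pow (A \<times> A). card (fib P)) = card (Pow (A \<times> A)) * card (fib {})"
  proof -
    have "(\<Sum>P\<in>Pow (A \<times> A). card (fib P)) = (\<Sum>P\<in>Pow (A \<times> A). card (fib {}))"
      by (intro sum.cong refl fib_card) auto
    then show ?thesis by (simp only: sum_constant of_nat_id)
  qed
  moreover have "{C \<in> Pow (B \<times> A). \<forall>i\<in>A. \<forall>j\<in>A. (\<Sum>k\<in>B. q i k * of_bool ((k, j) \<in> C)) = r i j} =
      fib {(i, j) \<in> A \<times> A. r i j = 1}"
  proof -
    define X where "X = (\<lambda>C i (j :: 'a). \<Sum>k\<in>B. q i k * of_bool ((k, j) \<in> C))"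
    have bit: "x = y \<longleftrightarrow> (x = 1 \<longleftrightarrow> y = 1)" for x y :: bit
      using bit_eqI by blast
    have gen: "{(i, j) \<in> A \<times> A. P i j} = {(i, j) \<in> A \<times> A. Q i j} \<longleftrightarrow> (\<forall>i\<in>A. \<forall>j\<in>A. P i j \<longleftrightarrow> Q i j)"
      for P Q by auto
    have "F C = {(i, j) \<in> A \<times> A. r i j = 1} \<longleftrightarrow> (\<forall>i\<in>A. \<forall>j\<in>A. X C i j = 1 \<longleftrightarrow> r i j = 1)" for C
      unfolding F_def X_def by (rule gen)
    moreover have "(\<forall>i\<in>A. \<forall>j\<in>A. X C i j = r i j) \<longleftrightarrow> (\<forall>i\<in>A. \<forall>j\<in>A. X C i j = 1 \<longleftrightarrow> r i j = 1)" for C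
      by (intro ball_cong refl bit)
    ultimately have "(\<forall>i\<in>A. \<forall>j\<in>A. X C i j = r i j) \<longleftrightarrow> F C = {(i, j) \<in> A \<times> A. r i j = 1}" for C
      by (simp only:)
    then show ?thesis unfolding fib_def X_def by (simp only:)
  qed
  moreover have "card (fib {(i, j) \<in> A \<times> A. r i j = 1}) = card (fib {})"
    by (rule fib_card) auto
  ultimately show ?thesis
    using fin by (simp add: card_Pow card_cartesian_product mult.commute)
qed

section \<open>Subgroups of the special linear group\<close>

locale transvections =
  fixes n :: nat
begin

abbreviation SL :: "bit mat monoid" where
  "SL \<equiv> \<lparr>carrier = SL_Z2 n, mult = (*), one = 1\<^sub>m n\<rparr>"

definition supp :: "(nat \<times> nat) set \<Rightarrow> bit mat \<Rightarrow> (nat \<times> nat) set" where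
  "supp T x = {p \<in> T. x $$ p = 1}"

lemma mult_index:
  fixes x y :: "bit mat"
  assumes "x \<in> carrier_mat n n" "y \<in> carrier_mat n n" "i < n" "j < n"
  shows "(x * y) $$ (i, j) = (\<Sum>k<n. x $$ (i, k) * y $$ (k, j))"
  using assms by (auto simp: scalar_prod_def atLeast0LessThan intro!: sum.cong)

lemma SL_carrier: "x \<in> SL_Z2 n \<Longrightarrow> x \<in> carrier_mat n n"
  by (simp add: SL_Z2_def)

lemma SL_iff: "x \<in> SL_Z2 n \<longleftrightarrow> x \<in> carrier_mat n n \<and> (\<exists>y\<in>carrier_mat n n. x * y = 1\<^sub>m n \<and> y * x = 1\<^sub>m n)"
proof
  assume x: "x \<in> SL_Z2 n"
  then have c: "x \<in> carrier_mat n n" by (rule SL_carrier)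
  obtain y where y: "x * y = 1\<^sub>m n" "y * x = 1\<^sub>m (dim_row y)"
    using x by (auto simp: SL_Z2_def invertible_mat_def inverts_mat_def)
  have "dim_col y = n" using y(1) by (metis index_mult_mat(3) index_one_mat(3))
  moreover have "dim_row y = n" using y(2) c by (metis index_mult_mat(3) index_one_mat(3) carrier_matD(2))
  ultimately show "x \<in> carrier_mat n n \<and> (\<exists>y\<in>carrier_mat n n. x * y = 1\<^sub>m n \<and> y * x = 1\<^sub>m n)"
    using c y by (intro conjI bexI[of _ y]) auto
qed (auto simp: SL_Z2_def invertible_mat_def inverts_mat_def)

lemma SL_I:
  assumes "x \<in> carrier_mat n n" "y \<in> carrier_mat n n" "x * y = 1\<^sub>m n"
  shows "x \<in> SL_Z2 n"
  using assms mat_mult_left_right_inverse[OF assms] by (auto simp: SL_iff)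

lemma SL_E:
  assumes "x \<in> SL_Z2 n"
  obtains y where "y \<in> carrier_mat n n" "x * y = 1\<^sub>m n" "y * x = 1\<^sub>m n"
  using assms SL_iff by blast

lemma mat_eq_supp:
  fixes x y :: "bit mat"
  assumes x: "x \<in> carrier_mat n n" and y: "y \<in> carrier_mat n n"
    and T: "\<And>i j. i < n \<Longrightarrow> j < n \<Longrightarrow> (i, j) \<notin> T \<Longrightarrow> x $$ (i, j) = y $$ (i, j)"
    and e: "supp T x = supp T y"
  shows "x = y"
proof (rule eq_matI)
  fix i j assume "i < dim_row y" "j < dim_col y"
  then have ij: "i < n" "j < n" using y by auto
  show "x $$ (i, j) = y $$ (i, j)"
  proof (cases "(i, j) \<in> T")
    case True
    then have "x $$ (i, j) = 1 \<longleftrightarrow> y $$ (i, j) = 1" using e by (auto simp: supp_def)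
    then show ?thesis using bit_eqI by blast
  qed (use T ij in auto)
qed (use x y in auto)

lemma finite_SL: "finite (SL_Z2 n)"
proof -
  let ?T = "{..<n} \<times> {..<n}"
  have "inj_on (supp ?T) (SL_Z2 n)"
    by (rule inj_onI, rule mat_eq_supp[where T = ?T]) (auto dest: SL_carrier)
  moreover have "finite (supp ?T ` SL_Z2 n)"
    by (rule finite_subset[of _ "Pow ?T"]) (auto simp: supp_def)
  ultimately show ?thesis by (rule finite_imageD[rotated])
qed

sublocale finite_group SL
proof -
  have "group SL"
  proof (rule groupI)
    fix x y assume "x \<in> carrier SL" "y \<in> carrier SL"
    then have xy: "x \<in> SL_Z2 n" "y \<in> SL_Z2 n" by simp_all
    obtain x' where x': "x' \<in> carrier_mat n n" "x * x' = 1\<^sub>m n" by (rule SL_E[OF xy(1)])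
    obtain y' where y': "y' \<in> carrier_mat n n" "y * y' = 1\<^sub>m n" by (rule SL_E[OF xy(2)])
    have c: "x \<in> carrier_mat n n" "y \<in> carrier_mat n n" "x' \<in> carrier_mat n n" "y' \<in> carrier_mat n n"
      and e: "x * x' = 1\<^sub>m n" "y * y' = 1\<^sub>m n"
      using xy x' y' SL_carrier by auto
    have "x * y * (y' * x') = x * (y * (y' * x'))"
      by (rule assoc_mult_mat[OF c(1,2) mult_carrier_mat[OF c(4,3)]])
    also have "y * (y' * x') = x'"
      using assoc_mult_mat[OF c(2,4,3)] e(2) c(3) by simp
    finally have "x * y * (y' * x') = 1\<^sub>m n" using e(1) by simp
    from SL_I[OF mult_carrier_mat[OF c(1,2)] mult_carrier_mat[OF c(4,3)] this]
    show "x \<otimes>\<^bsub>SL\<^esub> y \<in> carrier SL" by simp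
  next
    fix x y z assume "x \<in> carrier SL" "y \<in> carrier SL" "z \<in> carrier SL"
    then show "x \<otimes>\<^bsub>SL\<^esub> y \<otimes>\<^bsub>SL\<^esub> z = x \<otimes>\<^bsub>SL\<^esub> (y \<otimes>\<^bsub>SL\<^esub> z)"
      using assoc_mult_mat[of x n n y n z n] by (simp add: SL_carrier)
  next
    fix x assume x: "x \<in> carrier SL"
    then have x: "x \<in> SL_Z2 n" by simp
    from x obtain y where y: "y \<in> carrier_mat n n" "y * x = 1\<^sub>m n" by (rule SL_E)
    have xc: "x \<in> carrier_mat n n" by (rule SL_carrier[OF x])
    have "y \<in> SL_Z2 n" by (rule SL_I[OF y(1) xc y(2)])
    then show "\<exists>y\<in>carrier SL. y \<otimes>\<^bsub>SL\<^esub> x = \<one>\<^bsub>SL\<^esub>" using y(2) by auto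
    show "\<one>\<^bsub>SL\<^esub> \<otimes>\<^bsub>SL\<^esub> x = x" using xc by simp
  next
    show "\<one>\<^bsub>SL\<^esub> \<in> carrier SL" using SL_I[of "1\<^sub>m n" "1\<^sub>m n"] by simp
  qed
  then interpret group SL .
  show "finite_group SL" by unfold_locales (simp add: finite_SL)
qed

section \<open>Groups of invertible matrices that differ from the identity only in prescribed
  positions\<close>

definition rootgrp :: "(nat \<times> nat) set \<Rightarrow> bit mat set" where
  "rootgrp T = {x \<in> SL_Z2 n. \<forall>i<n. \<forall>j<n. (i, j) \<notin> T \<longrightarrow> x $$ (i, j) = of_bool (i = j)}"

lemma rootgrp_SL: "x \<in> rootgrp T \<Longrightarrow> x \<in> SL_Z2 n"
  by (simp add: rootgrp_def)

lemma rootgrp_carrier: "x \<in> rootgrp T \<Longrightarrow> x \<in> carrier_mat n n"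
  by (simp add: rootgrp_def SL_carrier)

lemma rootgrp_index: "x \<in> rootgrp T \<Longrightarrow> i < n \<Longrightarrow> j < n \<Longrightarrow> (i, j) \<notin> T \<Longrightarrow> x $$ (i, j) = of_bool (i = j)"
  by (simp add: rootgrp_def)

lemma rootgrp_mono: "T \<subseteq> T' \<Longrightarrow> rootgrp T \<subseteq> rootgrp T'"
  by (auto simp: rootgrp_def)

lemma rootgrp_Int: "rootgrp T \<inter> rootgrp T' = rootgrp (T \<inter> T')"
  by (auto simp: rootgrp_def)

lemma rootgrp_empty: "rootgrp {} = {1\<^sub>m n}"
proof -
  have "x = 1\<^sub>m n" if "x \<in> rootgrp {}" for x
    using rootgrp_carrier[OF that] rootgrp_index[OF that] by (intro mat_eq_supp[of _ _ "{}"]) (simp_all add: supp_def)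
  moreover have "1\<^sub>m n \<in> rootgrp {}" using one_closed by (simp add: rootgrp_def)
  ultimately show ?thesis by blast
qed

text \<open>Transitivity is the closure condition: a product entry outside \<open>T\<close> cannot
  receive a contribution through two positions of \<open>T\<close>. Inverses come from finiteness.
  Full blocks, off-diagonal blocks and single transvections are all covered.\<close>

lemma subgroup_rootgrp:
  assumes "trans T"
  shows "subgroup (rootgrp T) SL"
proof (rule finite_closed_subgroup)
  show "rootgrp T \<subseteq> carrier SL" using rootgrp_SL by auto
  show "rootgrp T \<noteq> {}" using rootgrp_empty rootgrp_mono[of "{}" T] by auto
  fix x y assume x: "x \<in> rootgrp T" and y: "y \<in> rootgrp T"
  have c: "x \<in> carrier_mat n n" "y \<in> carrier_mat n n" using x y rootgrp_carrier by auto
  have "(x * y) $$ (i, j) = of_bool (i = j)" if ij: "i < n" "j < n" "(i, j) \<notin> T" for i j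
  proof -
    have "x $$ (i, k) * y $$ (k, j) = (if k = i then of_bool (i = j) else 0)" if k: "k < n" for k
    proof (cases "(i, k) \<in> T")
      case False
      then show ?thesis using rootgrp_index[OF x] rootgrp_index[OF y] ij k by (cases "k = i") auto
    next
      case True
      then have kj: "(k, j) \<notin> T" using ij(3) assms by (meson transD)
      show ?thesis
      proof (cases "k = j")
        case False
        then show ?thesis using True rootgrp_index[OF y] kj ij k by auto
      qed (use True ij in auto)
    qed
    then have "(x * y) $$ (i, j) = (\<Sum>k<n. if k = i then of_bool (i = j) else 0)"
      unfolding mult_index[OF c ij(1,2)] by (intro sum.cong) auto
    then show ?thesis using ij by simp
  qed
  moreover have "x * y \<in> SL_Z2 n" using m_closed[of x y] rootgrp_SL x y by simp
  ultimately show "x \<otimes>\<^bsub>SL\<^esub> y \<in> rootgrp T" by (simp add: rootgrp_def)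
qed

lemma trans_Times: "trans (A \<times> B)"
  by (auto intro: transI)

lemma trans_subset_Times: "T \<subseteq> A \<times> B \<Longrightarrow> A \<inter> B = {} \<Longrightarrow> trans T"
  by (intro transI) blast

lemma row_unit_mult:
  fixes x y :: "bit mat"
  assumes "x \<in> carrier_mat n n" "y \<in> carrier_mat n n" "i < n" "j < n"
    and "\<And>k. k < n \<Longrightarrow> x $$ (i, k) = of_bool (i = k)"
  shows "(x * y) $$ (i, j) = y $$ (i, j)"
proof -
  have "(x * y) $$ (i, j) = (\<Sum>k<n. if k = i then y $$ (i, j) else 0)"
    unfolding mult_index[OF assms(1-4)]
  proof (intro sum.cong refl)
    fix k assume "k \<in> {..<n}"
    then show "x $$ (i, k) * y $$ (k, j) = (if k = i then y $$ (i, j) else 0)"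
      using assms(5)[of k] by (cases "k = i") simp_all
  qed
  then show ?thesis using assms by simp
qed

lemma col_unit_mult:
  fixes x y :: "bit mat"
  assumes "x \<in> carrier_mat n n" "y \<in> carrier_mat n n" "i < n" "j < n"
    and "\<And>k. k < n \<Longrightarrow> y $$ (k, j) = of_bool (k = j)"
  shows "(x * y) $$ (i, j) = x $$ (i, j)"
proof -
  have "(x * y) $$ (i, j) = (\<Sum>k<n. if k = j then x $$ (i, j) else 0)"
    unfolding mult_index[OF assms(1-4)]
  proof (intro sum.cong refl)
    fix k assume "k \<in> {..<n}"
    then show "x $$ (i, k) * y $$ (k, j) = (if k = j then x $$ (i, j) else 0)"
      using assms(5)[of k] by (cases "k = j") simp_all
  qed
  then show ?thesis using assms by simp
qed

text \<open>Row \<open>i\<close> of the quotient depends on \<open>x\<close> through row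
  \<open>i\<close> only, so \<open>x\<close> may be replaced by \<open>z\<close> there. This
  recognizes quotients as members of the groups that fix given rows.\<close>

lemma row_div:
  assumes x: "x \<in> SL_Z2 n" and z: "z \<in> SL_Z2 n" and i: "i < n" "j < n"
    and eq: "\<And>k. k < n \<Longrightarrow> x $$ (i, k) = z $$ (i, k)"
  shows "(x * inv\<^bsub>SL\<^esub> z) $$ (i, j) = of_bool (i = j)"
proof -
  have zi: "inv\<^bsub>SL\<^esub> z \<in> SL_Z2 n" using inv_closed[of z] z by simp
  have "(x * inv\<^bsub>SL\<^esub> z) $$ (i, j) = (z * inv\<^bsub>SL\<^esub> z) $$ (i, j)"
    using eq i x z zi by (simp add: mult_index SL_carrier)
  also have "z * inv\<^bsub>SL\<^esub> z = 1\<^sub>m n" using r_inv[of z] z by simp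
  finally show ?thesis using i by simp
qed

section \<open>Transvections and their products inside an off-diagonal block\<close>

definition uni :: "(nat \<times> nat) set \<Rightarrow> bit mat" where
  "uni S = Matrix.mat n n (\<lambda>(i, j). of_bool (i = j) + of_bool ((i, j) \<in> S))"

lemma uni_carrier [simp]: "uni S \<in> carrier_mat n n"
  by (simp add: uni_def)

lemma uni_index: "i < n \<Longrightarrow> j < n \<Longrightarrow> uni S $$ (i, j) = of_bool (i = j) + of_bool ((i, j) \<in> S)"
  by (simp add: uni_def)

lemma uni_mult_index:
  assumes "x \<in> carrier_mat n n" "i < n" "j < n"
  shows "(uni S * x) $$ (i, j) = x $$ (i, j) + (\<Sum>k<n. of_bool ((i, k) \<in> S) * x $$ (k, j))"
proof -
  have "(uni S * x) $$ (i, j) = (\<Sum>k<n. (if k = i then x $$ (k, j) else 0) + of_bool ((i, k) \<in> S) * x $$ (k, j))"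
    unfolding mult_index[OF uni_carrier assms]
  proof (intro sum.cong refl)
    fix k assume "k \<in> {..<n}"
    then have "uni S $$ (i, k) * x $$ (k, j) = of_bool (i = k) * x $$ (k, j) + of_bool ((i, k) \<in> S) * x $$ (k, j)"
      by (simp only: uni_index[OF assms(2)] lessThan_iff distrib_right)
    also have "of_bool (i = k) * x $$ (k, j) = (if k = i then x $$ (k, j) else 0)"
      by (cases "k = i") simp_all
    finally show "uni S $$ (i, k) * x $$ (k, j) =
        (if k = i then x $$ (k, j) else 0) + of_bool ((i, k) \<in> S) * x $$ (k, j)" .
  qed
  then show ?thesis
    using assms(2,3) by (simp only: sum.distrib sum.delta finite_lessThan lessThan_iff if_True)
qed

lemma uni_index_off: "i < n \<Longrightarrow> j < n \<Longrightarrow> i \<noteq> j \<Longrightarrow> uni S $$ (i, j) = of_bool ((i, j) \<in> S)"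
  by (simp add: uni_index)

lemma uni_index_out: "i < n \<Longrightarrow> j < n \<Longrightarrow> (i, j) \<notin> S \<Longrightarrow> uni S $$ (i, j) = of_bool (i = j)"
  by (simp add: uni_index)

text \<open>Two elementary matrices with positions in \<open>A \<times> B\<close> have product zero,
  as the column of the first lies in \<open>B\<close> and the row of the second in \<open>A\<close>.
  Only the sum of the supports remains, so these matrices form an elementary abelian
  2-group.\<close>

lemma uni_mult_uni_index:
  assumes S: "S \<subseteq> A \<times> B" "S' \<subseteq> A \<times> B" and AB: "A \<inter> B = {}" and ij: "i < n" "j < n"
  shows "(uni S * uni S') $$ (i, j) = uni S' $$ (i, j) + of_bool ((i, j) \<in> S)"
proof -
  have "of_bool ((i, k) \<in> S) * uni S' $$ (k, j) = (if k = j then of_bool ((i, j) \<in> S) else 0)" if k: "k < n" for k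
  proof (cases "(i, k) \<in> S")
    case True
    then have "(k, j) \<notin> S'" using S AB by auto
    then show ?thesis using True uni_index_out[OF k ij(2)] by auto
  qed auto
  then have "(\<Sum>k<n. of_bool ((i, k) \<in> S) * uni S' $$ (k, j)) = (\<Sum>k<n. if k = j then of_bool ((i, j) \<in> S) else 0)"
    by (intro sum.cong refl) (simp only: lessThan_iff)
  also have "\<dots> = of_bool ((i, j) \<in> S)"
    using ij by (simp only: sum.delta finite_lessThan lessThan_iff if_True)
  finally show ?thesis unfolding uni_mult_index[OF uni_carrier ij] by simp
qed

lemma uni_square:
  assumes S: "S \<subseteq> A \<times> B" and AB: "A \<inter> B = {}"
  shows "uni S * uni S = 1\<^sub>m n"
proof (rule eq_matI)
  fix i j assume "i < dim_row (1\<^sub>m n :: bit mat)" "j < dim_col (1\<^sub>m n :: bit mat)"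
  then have ij: "i < n" "j < n" by auto
  then have "(uni S * uni S) $$ (i, j) = of_bool (i = j) + (of_bool ((i, j) \<in> S) + of_bool ((i, j) \<in> S))"
    unfolding uni_mult_uni_index[OF S S AB ij] uni_index[OF ij] by (simp only: add.assoc)
  then show "(uni S * uni S) $$ (i, j) = 1\<^sub>m n $$ (i, j)" using ij by simp
qed (auto simp: uni_def)

lemma uni_mult:
  assumes "S \<subseteq> A \<times> B" "S' \<subseteq> A \<times> B" "A \<inter> B = {}" and disj: "S \<inter> S' = {}"
  shows "uni S * uni S' = uni (S \<union> S')"
proof (rule eq_matI)
  fix i j assume "i < dim_row (uni (S \<union> S'))" "j < dim_col (uni (S \<union> S'))"
  then have ij: "i < n" "j < n" by (auto simp: uni_def)
  have "of_bool ((i, j) \<in> S') + of_bool ((i, j) \<in> S) = (of_bool ((i, j) \<in> S \<union> S') :: bit)"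
    using disj by auto
  then show "(uni S * uni S') $$ (i, j) = uni (S \<union> S') $$ (i, j)"
    unfolding uni_mult_uni_index[OF assms(1-3) ij] uni_index[OF ij] by (simp only: add.assoc)
qed (auto simp: uni_def)

lemma uni_empty: "uni {} = 1\<^sub>m n"
  by (intro eq_matI) (auto simp: uni_def)

lemma uni_rootgrp:
  assumes "S \<subseteq> T" "T \<subseteq> A \<times> B" "A \<inter> B = {}"
  shows "uni S \<in> rootgrp T"
  unfolding rootgrp_def
proof (intro CollectI conjI allI impI)
  show "uni S \<in> SL_Z2 n"
    by (rule SL_I[OF uni_carrier uni_carrier uni_square[of S A B]]) (use assms in auto)
  fix i j assume "i < n" "j < n" "(i, j) \<notin> T"
  then show "uni S $$ (i, j) = of_bool (i = j)" using assms by (intro uni_index_out) auto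
qed

lemma rootgrp_eq_uni:
  assumes x: "x \<in> rootgrp T" and T: "T \<subseteq> A \<times> B" "A \<inter> B = {}"
  shows "x = uni (supp T x)"
proof (rule eq_matI)
  fix i j assume "i < dim_row (uni (supp T x))" "j < dim_col (uni (supp T x))"
  then have ij: "i < n" "j < n" by (auto simp: uni_def)
  show "x $$ (i, j) = uni (supp T x) $$ (i, j)"
  proof (cases "(i, j) \<in> T")
    case True
    then have "i \<noteq> j" using T by auto
    then have "uni (supp T x) $$ (i, j) = of_bool (x $$ (i, j) = 1)"
      using True ij by (simp add: uni_index_off supp_def)
    then show ?thesis by (intro bit_eqI) simp
  next
    case False
    then show ?thesis using rootgrp_index[OF x ij] ij by (subst uni_index_out) (auto simp: supp_def)
  qed
qed (use rootgrp_carrier[OF x] in \<open>auto simp: uni_def\<close>)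

lemma inj_on_uni:
  assumes "T \<subseteq> A \<times> B" "A \<inter> B = {}" "T \<subseteq> {..<n} \<times> {..<n}"
  shows "inj_on uni (Pow T)"
proof (rule inj_on_inverseI[of _ "supp T"])
  fix S assume S: "S \<in> Pow T"
  have "(i, j) \<in> supp T (uni S) \<longleftrightarrow> (i, j) \<in> S" for i j
  proof (cases "(i, j) \<in> T")
    case True
    then have "i < n" "j < n" "i \<noteq> j" using assms by auto
    then show ?thesis using True by (simp add: supp_def uni_index_off)
  qed (use S in \<open>auto simp: supp_def\<close>)
  then show "supp T (uni S) = S" by auto
qed

lemma rootgrp_image_uni:
  assumes "T \<subseteq> A \<times> B" "A \<inter> B = {}"
  shows "rootgrp T = uni ` Pow T"
proof
  show "rootgrp T \<subseteq> uni ` Pow T"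
    using rootgrp_eq_uni[OF _ assms] by (auto simp: supp_def)
  show "uni ` Pow T \<subseteq> rootgrp T" using uni_rootgrp[OF _ assms] by auto
qed

lemma card_rootgrp_Times:
  assumes "A \<subseteq> {..<n}" "B \<subseteq> {..<n}" "A \<inter> B = {}"
  shows "card (rootgrp (A \<times> B)) = 2 ^ (card A * card B)"
proof -
  have fin: "finite A" "finite B" using assms by (auto intro: finite_subset[OF _ finite_lessThan])
  have "inj_on uni (Pow (A \<times> B))" by (rule inj_on_uni[OF subset_refl assms(3)]) (use assms in auto)
  then have "card (rootgrp (A \<times> B)) = card (Pow (A \<times> B))"
    unfolding rootgrp_image_uni[OF subset_refl assms(3)] by (rule card_image)
  then show ?thesis using fin by (simp add: card_Pow card_cartesian_product)
qed

lemma card_rootgrp_le: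
  assumes "A \<subseteq> {..<n}"
  shows "card (rootgrp (A \<times> A)) \<le> 2 ^ (card A * card A)"
proof -
  have fin: "finite A" using assms by (auto intro: finite_subset[OF _ finite_lessThan])
  have "inj_on (supp (A \<times> A)) (rootgrp (A \<times> A))"
    by (rule inj_onI, rule mat_eq_supp[where T = "A \<times> A"]) (auto simp: rootgrp_index rootgrp_carrier)
  then have "card (rootgrp (A \<times> A)) \<le> card (Pow (A \<times> A))"
    using fin by (intro card_inj_on_le[of "supp (A \<times> A)"]) (auto simp: supp_def)
  then show ?thesis using fin by (simp add: card_Pow card_cartesian_product)
qed

text \<open>Every invertible block on \<open>A\<close>, extended by the identity, is an element, and
  at least a quarter of all blocks are invertible.\<close>

lemma card_rootgrp_ge:
  assumes A: "A \<subseteq> {..<n}"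
  shows "2 ^ (card A * card A) / 4 \<le> real (card (rootgrp (A \<times> A)))"
proof -
  have fin: "finite A" using A by (auto intro: finite_subset[OF _ finite_lessThan])
  define ext where "ext = (\<lambda>q :: nat \<Rightarrow> nat \<Rightarrow> bit. Matrix.mat n n (\<lambda>(i, j). if i \<in> A \<and> j \<in> A then q i j else of_bool (i = j)))"
  have ext_c: "ext q \<in> carrier_mat n n" for q by (simp add: ext_def)
  have ext_index: "ext q $$ (i, j) = (if i \<in> A \<and> j \<in> A then q i j else of_bool (i = j))" if "i < n" "j < n" for q i j
    using that by (simp add: ext_def)
  have ext_SL: "ext q \<in> SL_Z2 n" if qs: "right_inverse A A q s" for q s
  proof (rule SL_I[OF ext_c ext_c, of _ s], rule eq_matI)
    fix i j assume "i < dim_row (1\<^sub>m n :: bit mat)" "j < dim_col (1\<^sub>m n :: bit mat)"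
    then have ij: "i < n" "j < n" by auto
    have "(ext q * ext s) $$ (i, j) = of_bool (i = j)"
    proof (cases "i \<in> A")
      case False
      then have "(ext q * ext s) $$ (i, j) = ext s $$ (i, j)"
        using ij ext_c by (intro row_unit_mult) (auto simp: ext_index)
      then show ?thesis using False ij by (simp add: ext_index)
    next
      case i: True
      show ?thesis
      proof (cases "j \<in> A")
        case False
        then have "(ext q * ext s) $$ (i, j) = ext q $$ (i, j)"
          using ij ext_c by (intro col_unit_mult) (auto simp: ext_index)
        then show ?thesis using False ij by (simp add: ext_index)
      next
        case j: True
        have "(ext q * ext s) $$ (i, j) = (\<Sum>k<n. ext q $$ (i, k) * ext s $$ (k, j))"
          by (rule mult_index[OF ext_c ext_c ij])
        also have "\<dots> = (\<Sum>k\<in>A. ext q $$ (i, k) * ext s $$ (k, j))"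
          using A i ij by (intro sum.mono_neutral_right) (auto simp: ext_index)
        also have "\<dots> = (\<Sum>k\<in>A. q i k * s k j)"
          using A i j ij by (intro sum.cong) (auto simp: ext_index subset_iff)
        also have "\<dots> = of_bool (i = j)" using qs i j by (simp add: right_inverse_def)
        finally show ?thesis .
      qed
    qed
    then show "(ext q * ext s) $$ (i, j) = 1\<^sub>m n $$ (i, j)" using ij by simp
  qed (auto simp: ext_def)
  let ?f = "\<lambda>Q. ext (\<lambda>i j. of_bool ((i, j) \<in> Q))"
  have "inj_on ?f (full_rank A A)"
  proof (rule inj_on_inverseI[of _ "supp (A \<times> A)"])
    fix Q assume "Q \<in> full_rank A A"
    then have Q: "Q \<subseteq> A \<times> A" by (simp add: full_rank_def)
    have "(i, j) \<in> supp (A \<times> A) (?f Q) \<longleftrightarrow> (i, j) \<in> Q" for i j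
    proof (cases "(i, j) \<in> A \<times> A")
      case True
      then have "i < n" "j < n" using A by auto
      then show ?thesis using True by (simp add: supp_def ext_index)
    qed (use Q in \<open>auto simp: supp_def\<close>)
    then show "supp (A \<times> A) (?f Q) = Q" by auto
  qed
  moreover have "?f ` full_rank A A \<subseteq> rootgrp (A \<times> A)"
  proof (rule image_subsetI)
    fix Q assume "Q \<in> full_rank A A"
    then have "?f Q \<in> SL_Z2 n" using ext_SL by (auto simp: full_rank_def)
    then show "?f Q \<in> rootgrp (A \<times> A)" by (auto simp: rootgrp_def ext_index)
  qed
  ultimately have "card (full_rank A A) \<le> card (rootgrp (A \<times> A))"
    using finite_subgroup[OF subgroup_rootgrp[OF trans_Times]] by (intro card_inj_on_le)
  then show ?thesis using card_full_rank_square_ge[OF fin] by linarith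
qed

text \<open>Left multiplication by \<open>uni Q\<close>, with \<open>Q\<close> the \<open>A\<close>
  by \<open>B\<close> block of \<open>m\<close>, clears that block because the rows of
  \<open>m\<close> in \<open>B\<close> are unit rows.\<close>

lemma rootgrp_row_decomposition:
  assumes A: "A \<subseteq> {..<n}" "B \<subseteq> {..<n}" "A \<inter> B = {}"
  shows "bij_betw (\<lambda>(l, m). l * m) (rootgrp (A \<times> B) \<times> rootgrp (A \<times> A)) (rootgrp (A \<times> (A \<union> B)))"
proof -
  let ?L = "rootgrp (A \<times> B)" and ?N = "rootgrp (A \<times> A)" and ?M = "rootgrp (A \<times> (A \<union> B))"
  note sub = subgroup_rootgrp[OF trans_Times]
  have "bij_betw (\<lambda>(l, n). l \<otimes>\<^bsub>SL\<^esub> n) (?L \<times> ?N) ?M"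
  proof (rule bij_betw_productI[OF sub _ sub _ sub])
    show "?L \<subseteq> ?M" "?N \<subseteq> ?M" by (intro rootgrp_mono; blast)+
    have "A \<times> B \<inter> A \<times> A = {}" using A by auto
    then show "?L \<inter> ?N = {\<one>\<^bsub>SL\<^esub>}" by (simp add: rootgrp_Int rootgrp_empty)
    fix m assume m: "m \<in> ?M"
    define Q where "Q = supp (A \<times> B) m"
    have Q: "Q \<subseteq> A \<times> B" by (auto simp: Q_def supp_def)
    have l: "uni Q \<in> ?L" by (rule uni_rootgrp[OF Q subset_refl A(3)])
    have mc: "m \<in> carrier_mat n n" by (rule rootgrp_carrier[OF m])
    have "uni Q * m \<in> SL_Z2 n" using m_closed[of "uni Q" m] rootgrp_SL l m by simp
    moreover have "(uni Q * m) $$ (i, j) = of_bool (i = j)" if ij: "i < n" "j < n" "(i, j) \<notin> A \<times> A" for i j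
    proof -
      have "of_bool ((i, k) \<in> Q) * m $$ (k, j) = (if k = j then of_bool ((i, j) \<in> Q) else 0)" if k: "k < n" for k
      proof (cases "(i, k) \<in> Q")
        case True
        then have "k \<notin> A" using Q A by auto
        then have "m $$ (k, j) = of_bool (k = j)" using rootgrp_index[OF m k ij(2)] by auto
        then show ?thesis using True by auto
      qed auto
      then have "(\<Sum>k<n. of_bool ((i, k) \<in> Q) * m $$ (k, j)) = (\<Sum>k<n. if k = j then of_bool ((i, j) \<in> Q) else 0)"
        by (intro sum.cong refl) (simp only: lessThan_iff)
      also have "\<dots> = of_bool ((i, j) \<in> Q)"
        using ij by (simp only: sum.delta finite_lessThan lessThan_iff if_True)
      finally have e: "(uni Q * m) $$ (i, j) = m $$ (i, j) + of_bool ((i, j) \<in> Q)"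
        unfolding uni_mult_index[OF mc ij(1,2)] by simp
      show ?thesis
      proof (cases "(i, j) \<in> A \<times> B")
        case True
        then have "i \<noteq> j" using A by auto
        moreover have "m $$ (i, j) = of_bool ((i, j) \<in> Q)"
          by (rule bit_eqI) (use True in \<open>simp add: Q_def supp_def\<close>)
        ultimately show ?thesis unfolding e by simp
      next
        case False
        then have "(i, j) \<notin> Q" "(i, j) \<notin> A \<times> (A \<union> B)" using Q ij by auto
        then show ?thesis unfolding e using rootgrp_index[OF m ij(1,2)] by simp
      qed
    qed
    ultimately show "\<exists>l\<in>?L. l \<otimes>\<^bsub>SL\<^esub> m \<in> ?N" using l by (auto simp: rootgrp_def)
  qed
  then show ?thesis by simp
qed

lemma energy_off_diagonal_le:
  assumes "finite T" "T \<subseteq> A \<times> B" "A \<inter> B = {}" "x \<in> rootgrp T"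
  shows "energy g x \<le> 2 ^ card T * (\<Sum>p\<in>T. energy g (uni {p}))"
  using assms(1,2,4)
proof (induction T arbitrary: x rule: finite_induct)
  case empty
  then show ?case using energy_one by (simp add: rootgrp_empty)
next
  case (insert p T)
  let ?E = "\<Sum>p\<in>T. energy g (uni {p})"
  have T: "T \<subseteq> A \<times> B" "p \<in> A \<times> B" using insert by auto
  have E0: "0 \<le> ?E" "0 \<le> energy g (uni {p})" by (auto intro: sum_nonneg energy_nonneg)
  define Q where "Q = supp (insert p T) x"
  have x: "x = uni Q" unfolding Q_def by (rule rootgrp_eq_uni[OF insert.prems(2,1) assms(3)])
  have QT: "Q - {p} \<subseteq> T" by (auto simp: Q_def supp_def)
  have IH: "energy g (uni (Q - {p})) \<le> 2 ^ card T * ?E"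
    by (rule insert.IH[OF T(1) uni_rootgrp[OF QT T(1) assms(3)]])
  have "energy g x \<le> 2 * energy g (uni {p}) + 2 * energy g (uni (Q - {p}))"
  proof (cases "p \<in> Q")
    case True
    have in_SL: "uni {p} \<in> SL_Z2 n" "uni (Q - {p}) \<in> SL_Z2 n"
      using uni_rootgrp[OF QT T(1) assms(3)] uni_rootgrp[of "{p}" "{p}" A B] T assms(3) rootgrp_SL by auto
    have "uni {p} * uni (Q - {p}) = uni ({p} \<union> (Q - {p}))"
      by (rule uni_mult[of _ A B]) (use T QT assms(3) in auto)
    also have "{p} \<union> (Q - {p}) = Q" using True by auto
    finally show ?thesis using energy_mult_le[of "uni {p}" "uni (Q - {p})" g] in_SL x by simp
  next
    case False
    then have "x = uni (Q - {p})" using x by simp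
    then show ?thesis using E0 energy_nonneg[of g x] by simp
  qed
  also have "\<dots> \<le> 2 * (2 ^ card T * energy g (uni {p})) + 2 * (2 ^ card T * ?E)"
    using IH E0 mult_right_mono[of 1 "2 ^ card T" "energy g (uni {p})"] by simp
  also have "\<dots> = 2 ^ card (insert p T) * (\<Sum>p\<in>insert p T. energy g (uni {p}))"
    using insert by (simp add: algebra_simps)
  finally show ?case .
qed

text \<open>Each position spans a group of order two, and \<open>gap_product_le\<close> adds the
  bounds for the factors, so the constant does not grow with \<open>T\<close>.\<close>

lemma gap_off_diagonal_le:
  assumes g: "\<And>y. y \<in> SL_Z2 n \<Longrightarrow> 0 < g y"
    and T: "finite T" "T \<subseteq> A \<times> B" "A \<inter> B = {}" "T \<subseteq> {..<n} \<times> {..<n}"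
  shows "gap (rootgrp T) g \<le> 4 * (\<Sum>p\<in>T. energy g (uni {p}))"
  using T(1,2,4)
proof (induction T rule: finite_induct)
  case empty
  have "gap (rootgrp {}) g \<le> 4 * (\<Sum>k\<in>rootgrp {}. energy g k)"
    by (rule gap_le_sum_energy[OF subgroup_rootgrp]) (auto simp: g intro: transI)
  then show ?case using energy_one by (simp add: rootgrp_empty)
next
  case (insert p T)
  let ?T = "insert p T"
  have sub: "subgroup (rootgrp X) SL" if "X \<subseteq> ?T" for X
    by (rule subgroup_rootgrp, rule trans_subset_Times[of _ A B]) (use that insert T in auto)
  have "gap (rootgrp {p}) g \<le> 4 * (\<Sum>k\<in>rootgrp {p}. energy g k)"
    using g by (intro gap_le_sum_energy sub) auto
  also have "(\<Sum>k\<in>rootgrp {p}. energy g k) = (\<Sum>Q\<in>Pow {p}. energy g (uni Q))"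
    using insert T inj_on_uni[of "{p}" A B] rootgrp_image_uni[of "{p}" A B] by (simp add: sum.reindex)
  also have "\<dots> = energy g (uni {p})"
    using energy_one by (simp add: Pow_insert uni_empty)
  finally have 1: "gap (rootgrp {p}) g \<le> 4 * energy g (uni {p})" .
  have "bij_betw (\<lambda>(l, n). l \<otimes>\<^bsub>SL\<^esub> n) (rootgrp {p} \<times> rootgrp T) (rootgrp ?T)"
  proof (rule bij_betw_productI[OF sub _ sub _ sub])
    show "rootgrp {p} \<subseteq> rootgrp ?T" "rootgrp T \<subseteq> rootgrp ?T" by (intro rootgrp_mono; blast)+
    show "rootgrp {p} \<inter> rootgrp T = {\<one>\<^bsub>SL\<^esub>}" using insert by (simp add: rootgrp_Int rootgrp_empty)
    fix m assume m: "m \<in> rootgrp ?T"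
    define Q where "Q = supp ?T m"
    have mQ: "m = uni Q" unfolding Q_def by (rule rootgrp_eq_uni[OF m insert.prems(1) T(3)])
    have QT: "Q - {p} \<subseteq> T" by (auto simp: Q_def supp_def)
    have TAB: "T \<subseteq> A \<times> B" "{p} \<subseteq> A \<times> B" using insert by auto
    have N: "uni (Q - {p}) \<in> rootgrp T" by (rule uni_rootgrp[OF QT TAB(1) T(3)])
    show "\<exists>l\<in>rootgrp {p}. l \<otimes>\<^bsub>SL\<^esub> m \<in> rootgrp T"
    proof (cases "p \<in> Q")
      case True
      have "{p} \<union> (Q - {p}) = Q" using True by auto
      then have "m = uni {p} * uni (Q - {p})"
        unfolding mQ using TAB QT uni_mult[of "{p}" A B "Q - {p}"] T(3) by auto
      then have "uni {p} * m = (uni {p} * uni {p}) * uni (Q - {p})"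
        using assoc_mult_mat[OF uni_carrier uni_carrier uni_carrier, of "{p}" "{p}" "Q - {p}"] by simp
      also have "\<dots> = uni (Q - {p})"
        using uni_square[OF TAB(2) T(3)] left_mult_one_mat[OF uni_carrier] by simp
      finally show ?thesis
        using N uni_rootgrp[OF subset_refl TAB(2) T(3)] by (intro bexI[of _ "uni {p}"]) simp_all
    next
      case False
      then have "m = uni (Q - {p})" unfolding mQ by simp
      then show ?thesis
        using N subgroup.one_closed[OF sub[of "{p}"]] left_mult_one_mat[OF uni_carrier]
        by (intro bexI[of _ "1\<^sub>m n"]) simp_all
    qed
  qed auto
  then have "gap (rootgrp ?T) g \<le> gap (rootgrp {p}) g + gap (rootgrp T) g"
    by (intro gap_product_le sub) (auto simp: g)
  then show ?case using 1 insert by (simp add: algebra_simps)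
qed

definition pairs :: "nat set \<Rightarrow> (nat \<times> nat) set" where
  "pairs A = {(i, j). i \<in> A \<and> j \<in> A \<and> i \<noteq> j}"

lemma finite_pairs: "finite A \<Longrightarrow> finite (pairs A)"
  by (rule finite_subset[of _ "A \<times> A"]) (auto simp: pairs_def)

text \<open>The exponential constant is harmless, since this is only applied to sets of bounded size.\<close>

lemma energy_rootgrp_le:
  assumes "finite A" "A \<subseteq> {..<n}" "x \<in> rootgrp (A \<times> A)"
  shows "energy g x \<le> 32 ^ card A * (\<Sum>p\<in>pairs A. energy g (uni {p}))"
  using assms
proof (induction A arbitrary: x rule: finite_induct)
  case empty
  then show ?case using energy_one by (simp add: rootgrp_empty pairs_def)
next
  case (insert i A)
  let ?A = "insert i A"
  note sub = subgroup_rootgrp[OF trans_Times]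
  have AB: "A \<subseteq> {..<n}" "{i} \<subseteq> {..<n}" "A \<inter> {i} = {}" "{i} \<inter> A = {}" and i: "i < n" using insert by auto
  let ?E = "\<Sum>p\<in>pairs ?A. energy g (uni {p})"
  have E0: "0 \<le> ?E" by (auto intro: sum_nonneg energy_nonneg)
  have off: "energy g y \<le> 2 ^ card A * ?E" if T: "T = A \<times> {i} \<or> T = {i} \<times> A" and y: "y \<in> rootgrp T" for T y
  proof -
    have fT: "finite T" "card T = card A" using T insert by (auto simp: card_cartesian_product)
    have "energy g y \<le> 2 ^ card T * (\<Sum>p\<in>T. energy g (uni {p}))"
    proof (cases "T = A \<times> {i}")
      case True
      then show ?thesis using energy_off_diagonal_le[of T A "{i}" y g] AB y fT by auto
    next
      case False
      then have "T = {i} \<times> A" using T by simp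
      then show ?thesis using energy_off_diagonal_le[of T "{i}" A y g] AB y fT by auto
    qed
    also have "\<dots> \<le> 2 ^ card T * ?E"
      using T AB insert by (intro mult_left_mono sum_mono2 finite_pairs energy_nonneg) (auto simp: pairs_def)
    finally show ?thesis using fT by simp
  qed
  have x: "x \<in> SL_Z2 n" "x \<in> carrier_mat n n"
    using rootgrp_SL[OF insert.prems(2)] rootgrp_carrier[OF insert.prems(2)] by auto
  \<comment> \<open>Gaussian elimination on row \<open>i\<close>: if the diagonal entry is 0,
    invertibility gives a 1 in a column of \<open>A\<close>, and adding that column to column
    \<open>i\<close> makes the diagonal entry 1. The involution \<open>e\<close> is undone by a
    second multiplication.\<close>
  obtain e where e: "e \<in> rootgrp (A \<times> {i})" "e * e = 1\<^sub>m n" "(x * e) $$ (i, i) = 1"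
  proof (cases "x $$ (i, i) = 1")
    case True
    then show ?thesis
      using x subgroup.one_closed[OF sub, of A "{i}"] by (intro that[of "1\<^sub>m n"]) simp_all
  next
    case False
    have "\<exists>j\<in>A. x $$ (i, j) = 1"
    proof (rule ccontr)
      assume "\<not> ?thesis"
      then have z: "x $$ (i, k) = 0" if "k < n" for k
        using False that rootgrp_index[OF insert.prems(2) i that] by (cases "k \<in> ?A") auto
      obtain y where y: "y \<in> carrier_mat n n" "x * y = 1\<^sub>m n" by (rule SL_E[OF x(1)])
      have "(x * y) $$ (i, i) = 0"
        unfolding mult_index[OF x(2) y(1) i i] by (intro sum.neutral) (simp add: z)
      then show False using y(2) i by simp
    qed
    then obtain j where j: "j \<in> A" "x $$ (i, j) = 1" by auto
    have jn: "j < n" "j \<noteq> i" using j insert by auto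
    have e: "uni {(j, i)} \<in> rootgrp (A \<times> {i})"
      using j AB by (intro uni_rootgrp[of _ _ A "{i}"]) auto
    have "(x * uni {(j, i)}) $$ (i, i) = (\<Sum>k<n. (if k = i then x $$ (i, i) else 0) + (if k = j then x $$ (i, j) else 0))"
      unfolding mult_index[OF x(2) uni_carrier i i]
    proof (intro sum.cong refl)
      fix k assume "k \<in> {..<n}"
      then show "x $$ (i, k) * uni {(j, i)} $$ (k, i) =
          (if k = i then x $$ (i, i) else 0) + (if k = j then x $$ (i, j) else 0)"
        using i jn by (cases "k = i"; cases "k = j") (simp_all add: uni_index)
    qed
    also have "\<dots> = x $$ (i, i) + x $$ (i, j)"
      using i jn by (simp only: sum.distrib sum.delta finite_lessThan lessThan_iff if_True)
    also have "\<dots> = 1" using False j by simp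
    finally show ?thesis
      using e j AB uni_square[of "{(j, i)}" A "{i}"] by (intro that[of "uni {(j, i)}"]) auto
  qed
  have "rootgrp (A \<times> {i}) \<subseteq> rootgrp (?A \<times> ?A)" by (intro rootgrp_mono) auto
  then have eK: "e \<in> rootgrp (?A \<times> ?A)" using e(1) by auto
  define x' where "x' = x * e"
  have x': "x' \<in> rootgrp (?A \<times> ?A)"
    using subgroup.m_closed[OF sub insert.prems(2) eK] by (simp add: x'_def)
  have xe: "x = x' * e"
    unfolding x'_def assoc_mult_mat[OF x(2) rootgrp_carrier[OF eK] rootgrp_carrier[OF eK]] e(2) using x(2) by simp
  \<comment> \<open>\<open>w\<close> has the same row \<open>i\<close> as \<open>x'\<close>.
    Dividing by it leaves a unit row, so \<open>rootgrp_row_decomposition\<close> splits the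
    quotient into a column part \<open>h\<close> and an element \<open>l\<close> living on
    \<open>A\<close>.\<close>
  define w where "w = uni (supp ({i} \<times> A) x')"
  have w: "w \<in> rootgrp ({i} \<times> A)"
    unfolding w_def by (rule uni_rootgrp[of _ _ "{i}" A]) (use AB in \<open>auto simp: supp_def\<close>)
  have "rootgrp ({i} \<times> A) \<subseteq> rootgrp (?A \<times> ?A)" by (intro rootgrp_mono) auto
  then have wK: "w \<in> rootgrp (?A \<times> ?A)" using w by auto
  have row: "x' $$ (i, k) = w $$ (i, k)" if k: "k < n" for k
  proof (cases "k \<in> A")
    case True
    then have "k \<noteq> i" using insert by auto
    then show ?thesis
      unfolding w_def uni_index_off[OF i k \<open>k \<noteq> i\<close>[symmetric]]
      by (intro bit_eqI) (simp add: supp_def True)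
  next
    case False
    then have "w $$ (i, k) = of_bool (i = k)" using rootgrp_index[OF w i k] by auto
    moreover have "x' $$ (i, k) = of_bool (i = k)"
      using e(3) False rootgrp_index[OF x' i k] by (cases "k = i") (auto simp: x'_def)
    ultimately show ?thesis by simp
  qed
  define c where "c = x' * inv\<^bsub>SL\<^esub> w"
  have cK: "c \<in> rootgrp (?A \<times> ?A)"
    using subgroup.m_closed[OF sub x' subgroup.m_inv_closed[OF sub wK]] by (simp add: c_def)
  have "c $$ (k, l) = of_bool (k = l)" if kl: "k < n" "l < n" "(k, l) \<notin> A \<times> (A \<union> {i})" for k l
  proof (cases "k = i")
    case True
    then show ?thesis unfolding c_def using row_div[OF rootgrp_SL[OF x'] rootgrp_SL[OF wK] i kl(2) row] by simp
  next
    case False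
    then show ?thesis using rootgrp_index[OF cK kl(1,2)] kl by auto
  qed
  then have "c \<in> rootgrp (A \<times> (A \<union> {i}))" using rootgrp_SL[OF cK] by (simp add: rootgrp_def)
  then have "c \<in> (\<lambda>(l, m). l * m) ` (rootgrp (A \<times> {i}) \<times> rootgrp (A \<times> A))"
    using rootgrp_row_decomposition[OF AB(1-3)] by (simp only: bij_betw_def)
  then obtain h l where hl: "h \<in> rootgrp (A \<times> {i})" "l \<in> rootgrp (A \<times> A)" "c = h * l" by auto
  have x'c: "x' = c * w"
    using inv_solve_right[of c x' w] rootgrp_SL[OF cK] rootgrp_SL[OF x'] rootgrp_SL[OF wK] by (simp add: c_def)
  have IH: "energy g l \<le> 32 ^ card A * ?E"
  proof -
    have "energy g l \<le> 32 ^ card A * (\<Sum>p\<in>pairs A. energy g (uni {p}))"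
      by (rule insert.IH[OF AB(1) hl(2)])
    also have "\<dots> \<le> 32 ^ card A * ?E"
      using insert by (intro mult_left_mono sum_mono2 finite_pairs energy_nonneg) (auto simp: pairs_def)
    finally show ?thesis .
  qed
  have "energy g x \<le> 2 * energy g x' + 2 * energy g e"
    unfolding xe using energy_mult_le[of x' e g] rootgrp_SL[OF x'] rootgrp_SL[OF eK] by simp
  also have "energy g x' \<le> 2 * energy g c + 2 * energy g w"
    unfolding x'c using energy_mult_le[of c w g] rootgrp_SL[OF cK] rootgrp_SL[OF wK] by simp
  also have "energy g c \<le> 2 * energy g h + 2 * energy g l"
    unfolding hl(3) using energy_mult_le[of h l g] rootgrp_SL[OF hl(1)] rootgrp_SL[OF hl(2)] by simp
  finally have "energy g x \<le> 8 * energy g h + 8 * energy g l + 4 * energy g w + 2 * energy g e" by simp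
  \<comment> \<open>The off-diagonal factors have total weight 8 + 4 + 2 = 14, and 14 + 8 = 22 is
    below 32, the base of the exponential bound.\<close>
  also have "\<dots> \<le> 14 * (2 ^ card A * ?E) + 8 * (32 ^ card A * ?E)"
    using off[OF _ hl(1)] off[OF _ w] off[OF _ e(1)] IH by simp
  also have "2 ^ card A * ?E \<le> 32 ^ card A * ?E"
    using E0 by (intro mult_right_mono power_mono) auto
  also have "14 * (32 ^ card A * ?E) + 8 * (32 ^ card A * ?E) \<le> 32 ^ card ?A * ?E"
    using insert E0 mult_nonneg_nonneg[of "32 ^ card A" ?E] by simp
  finally show ?case by simp
qed

end

section \<open>Two blocks of rows\<close>

locale two_blocks = transvections +
  fixes A1 A2 :: "nat set"
  assumes A1: "A1 \<subseteq> {..<n}" and A2: "A2 \<subseteq> {..<n}" and disjoint: "A1 \<inter> A2 = {}"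
begin

abbreviation "A \<equiv> A1 \<union> A2"
abbreviation "K \<equiv> rootgrp (A \<times> A)"
text \<open>The index names the rows that an invariant function sees: on \<open>K\<close>,
  invariance under \<open>S1\<close> from the left means depending on the rows in \<open>A1\<close>
  only.\<close>

abbreviation "S1 \<equiv> rootgrp (A2 \<times> A)"
abbreviation "S2 \<equiv> rootgrp (A1 \<times> A)"
abbreviation "H \<equiv> rootgrp (A1 \<times> A2)"
abbreviation "U \<equiv> rootgrp (A2 \<times> A1)"

definition good :: "bit mat \<Rightarrow> bool" where
  "good x \<longleftrightarrow> (\<exists>s. right_inverse A1 A2 (\<lambda>i k. x $$ (i, k)) s)"

definition D :: "bit mat set" where
  "D = {y \<in> K. good y}"

lemma fin: "finite A1" "finite A2" "finite A"
  using A1 A2 by (auto intro: finite_subset[OF _ finite_lessThan])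

lemma A_le: "A \<subseteq> {..<n}"
  using A1 A2 by auto

lemma card_A: "card A = card A1 + card A2"
  using fin disjoint by (simp add: card_Un_disjoint)

lemma sub: "subgroup (rootgrp (X \<times> Y)) SL"
  by (rule subgroup_rootgrp[OF trans_Times])

lemma sub_K: "S1 \<subseteq> K" "S2 \<subseteq> K" "H \<subseteq> K" "U \<subseteq> K" "H \<subseteq> S2" "U \<subseteq> S1"
  by (intro rootgrp_mono; blast)+

lemma good_cong:
  assumes "\<And>i k. i \<in> A1 \<Longrightarrow> k \<in> A2 \<Longrightarrow> x $$ (i, k) = y $$ (i, k)"
  shows "good x \<longleftrightarrow> good y"
  unfolding good_def using assms by (intro ex_cong1 right_inverse_cong)

lemma S1_row:
  assumes "s \<in> S1" "i \<in> A1" "k < n"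
  shows "s $$ (i, k) = of_bool (i = k)"
proof (rule rootgrp_index[OF assms(1) _ assms(3)])
  show "i < n" "(i, k) \<notin> A2 \<times> A" using assms A1 disjoint by auto
qed

text \<open>Left factors from \<open>S1\<close> leave the rows in \<open>A1\<close> alone and right
  factors from \<open>U\<close> change only columns in \<open>A1\<close>, so the block on which
  \<open>good\<close> depends survives.\<close>

lemma block_mult:
  assumes s: "s \<in> S1" and u: "u \<in> U" and w: "w \<in> carrier_mat n n" and ik: "i \<in> A1" "k \<in> A2"
  shows "(s * w * u) $$ (i, k) = w $$ (i, k)"
proof -
  have ikn: "i < n" "k < n" using ik A1 A2 by auto
  have c: "s \<in> carrier_mat n n" "u \<in> carrier_mat n n" using s u rootgrp_carrier by auto
  have "(s * w * u) $$ (i, k) = (s * w) $$ (i, k)"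
  proof (intro col_unit_mult mult_carrier_mat[OF c(1) w] c ikn)
    fix l assume "l < n"
    moreover have "(l, k) \<notin> A2 \<times> A1" using ik disjoint by auto
    ultimately show "u $$ (l, k) = of_bool (l = k)" by (intro rootgrp_index[OF u _ ikn(2)])
  qed
  also have "\<dots> = w $$ (i, k)"
    using S1_row[OF s ik(1)] by (intro row_unit_mult c w ikn)
  finally show ?thesis .
qed

lemma top_rows:
  assumes y: "y \<in> K" and C: "C \<subseteq> A2 \<times> A1" and i: "i \<in> A1" and j: "j \<in> A1"
  shows "(uni (supp (A1 \<times> A2) y) * uni C) $$ (i, j) = of_bool (i = j) + (\<Sum>k\<in>A2. y $$ (i, k) * of_bool ((k, j) \<in> C))"
proof -
  let ?W = "supp (A1 \<times> A2) y"
  have ij: "i < n" "j < n" using i j A1 by auto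
  have "(uni ?W * uni C) $$ (i, j) = uni C $$ (i, j) + (\<Sum>k<n. of_bool ((i, k) \<in> ?W) * uni C $$ (k, j))"
    by (rule uni_mult_index[OF uni_carrier ij])
  also have "uni C $$ (i, j) = of_bool (i = j)"
    using C i disjoint by (intro uni_index_out ij) auto
  also have "(\<Sum>k<n. of_bool ((i, k) \<in> ?W) * uni C $$ (k, j)) = (\<Sum>k\<in>A2. of_bool ((i, k) \<in> ?W) * uni C $$ (k, j))"
    using A2 by (intro sum.mono_neutral_right) (auto simp: supp_def)
  also have "\<dots> = (\<Sum>k\<in>A2. y $$ (i, k) * of_bool ((k, j) \<in> C))"
  proof (intro sum.cong refl)
    fix k assume k: "k \<in> A2"
    then have "k < n" "k \<noteq> j" using A2 j disjoint by auto
    then have "uni C $$ (k, j) = of_bool ((k, j) \<in> C)" by (rule uni_index_off[OF _ ij(2)])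
    moreover have "of_bool ((i, k) \<in> ?W) = y $$ (i, k)"
      by (rule bit_eqI) (use i k in \<open>simp add: supp_def\<close>)
    ultimately show "of_bool ((i, k) \<in> ?W) * uni C $$ (k, j) = y $$ (i, k) * of_bool ((k, j) \<in> C)"
      by (simp only:)
  qed
  finally show ?thesis .
qed

text \<open>In y = s w u the factor w is read off from the \<open>A1\<close> by \<open>A2\<close>
  block of y, and s follows by division. The freedom lies in u = \<open>uni C\<close>: the rows of w
  u in \<open>A1\<close> must agree with those of y, a linear system for \<open>C\<close> whose
  matrix is that block, so that \<open>card_right_inverse_fibre\<close> counts its
  solutions.\<close>

lemma fibre_card:
  assumes y: "y \<in> D"
  shows "card {z \<in> S1 \<times> (H \<inter> D) \<times> U. fst z * fst (snd z) * snd (snd z) = y}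
      = 2 ^ (card A1 * card A2) div 2 ^ (card A1 * card A1)"
    (is "card ?Z = _")
proof -
  have yK: "y \<in> K" "y \<in> SL_Z2 n" "good y" using y rootgrp_SL by (auto simp: D_def)
  then obtain s where s: "right_inverse A1 A2 (\<lambda>i k. y $$ (i, k)) s" by (auto simp: good_def)
  define V where "V = {C \<in> Pow (A2 \<times> A1). \<forall>i\<in>A1. \<forall>j\<in>A1.
      (\<Sum>k\<in>A2. y $$ (i, k) * of_bool ((k, j) \<in> C)) = y $$ (i, j) + of_bool (i = j)}"
  define W where "W = supp (A1 \<times> A2) y"
  have W: "W \<subseteq> A1 \<times> A2" by (auto simp: W_def supp_def)
  have WH: "uni W \<in> H" by (rule uni_rootgrp[OF W subset_refl disjoint])
  have W_index: "uni W $$ (i, k) = y $$ (i, k)" if "i \<in> A1" "k \<in> A2" for i k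
  proof -
    have "i < n" "k < n" "i \<noteq> k" using that A1 A2 disjoint by auto
    then have "uni W $$ (i, k) = of_bool ((i, k) \<in> W)" by (rule uni_index_off)
    also have "\<dots> = y $$ (i, k)"
      by (rule bit_eqI) (use that in \<open>simp add: W_def supp_def\<close>)
    finally show ?thesis .
  qed
  have WD: "uni W \<in> D"
    using WH sub_K(3) good_cong[of "uni W" y] W_index yK(3) by (auto simp: D_def)
  have CU: "uni C \<in> U" if "C \<subseteq> A2 \<times> A1" for C
    using uni_rootgrp[OF that subset_refl] disjoint by auto
  have WCK: "uni W * uni C \<in> K" if "C \<subseteq> A2 \<times> A1" for C
    using subgroup.m_closed[OF sub, of "uni W" A A "uni C"] WH CU[OF that] sub_K by auto
  have V_rows: "C \<in> V \<longleftrightarrow> C \<subseteq> A2 \<times> A1 \<and> (\<forall>i\<in>A1. \<forall>j\<in>A1. (uni W * uni C) $$ (i, j) = y $$ (i, j))" for C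
  proof -
    have 1: "((a :: bit) = b + c) = (c + a = b)" for a b c
      by (cases a rule: bit.exhaust; cases b rule: bit.exhaust; cases c rule: bit.exhaust) simp_all
    show ?thesis
    proof (cases "C \<subseteq> A2 \<times> A1")
      case True
      have "(uni W * uni C) $$ (i, j) = y $$ (i, j) \<longleftrightarrow>
          (\<Sum>k\<in>A2. y $$ (i, k) * of_bool ((k, j) \<in> C)) = y $$ (i, j) + of_bool (i = j)"
        if "i \<in> A1" "j \<in> A1" for i j
        unfolding W_def top_rows[OF yK(1) True that] 1 by (rule refl)
      then show ?thesis using True unfolding V_def by blast
    qed (auto simp only: V_def mem_Collect_eq Pow_iff)
  qed
  \<comment> \<open>The only triple compatible with a solution \<open>C\<close>.\<close>
  define h where "h = (\<lambda>C. (y * inv\<^bsub>SL\<^esub> (uni W * uni C), uni W, uni C))"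
  have "bij_betw h V ?Z"
  proof (rule bij_betw_imageI)
    have "inj_on uni (Pow (A2 \<times> A1))"
      by (rule inj_on_uni[OF subset_refl]) (use A1 A2 disjoint in auto)
    then show "inj_on h V"
      unfolding h_def V_def by (intro inj_onI) (auto simp only: prod.inject inj_on_def mem_Collect_eq)
    show "h ` V = ?Z"
    proof
      show "h ` V \<subseteq> ?Z"
      proof (rule image_subsetI)
        fix C assume C: "C \<in> V"
        then have C': "C \<subseteq> A2 \<times> A1" using V_rows by blast
        let ?z = "uni W * uni C"
        let ?c = "y * inv\<^bsub>SL\<^esub> ?z"
        have zS: "?z \<in> SL_Z2 n" by (rule rootgrp_SL[OF WCK[OF C']])
        have row: "y $$ (i, j) = ?z $$ (i, j)" if ij: "i \<in> A1" "j < n" for i j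
        proof (cases "j \<in> A")
          case False
          then show ?thesis
            using rootgrp_index[OF yK(1)] rootgrp_index[OF WCK[OF C']] ij A1 by auto
        next
          case True
          show ?thesis
          proof (cases "j \<in> A1")
            case True
            then show ?thesis using C V_rows ij by auto
          next
            case False
            with True have j: "j \<in> A2" by auto
            have "?z $$ (i, j) = uni W $$ (i, j)"
            proof (intro col_unit_mult uni_carrier)
              show "i < n" "j < n" using ij A1 by auto
              fix k assume "k < n"
              moreover have "(k, j) \<notin> A2 \<times> A1" using j disjoint by auto
              ultimately show "uni C $$ (k, j) = of_bool (k = j)"
                using ij by (intro rootgrp_index[OF CU[OF C']])
            qed
            then show ?thesis using W_index[OF ij(1) j] by simp
          qed
        qed
        have cK: "?c \<in> K"
          using subgroup.m_closed[OF sub yK(1) subgroup.m_inv_closed[OF sub WCK[OF C']]] by simp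
        have "?c $$ (i, j) = of_bool (i = j)" if ij: "i < n" "j < n" "(i, j) \<notin> A2 \<times> A" for i j
        proof (cases "i \<in> A1")
          case True
          show ?thesis by (rule row_div[OF yK(2) zS ij(1,2) row[OF True]])
        next
          case False
          then show ?thesis using rootgrp_index[OF cK ij(1,2)] ij by auto
        qed
        then have c1: "?c \<in> S1" using rootgrp_SL[OF cK] by (simp add: rootgrp_def)
        have "?c * ?z = y"
          using inv_solve_right[of ?c y ?z] rootgrp_SL[OF cK] yK(2) zS by simp
        moreover have "?c * uni W * uni C = ?c * ?z"
          by (rule assoc_mult_mat[OF rootgrp_carrier[OF cK] uni_carrier uni_carrier])
        ultimately show "h C \<in> ?Z"
          unfolding h_def using c1 WH WD CU[OF C'] by simp
      qed
      show "?Z \<subseteq> h ` V"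
      proof
        fix z assume z: "z \<in> ?Z"
        obtain c w u where zz: "z = (c, w, u)" by (metis prod.exhaust)
        have c: "c \<in> S1" and w: "w \<in> H" and u: "u \<in> U" and e: "c * w * u = y"
          using z by (auto simp: zz)
        have cc: "c \<in> carrier_mat n n" "w \<in> carrier_mat n n" "u \<in> carrier_mat n n"
          using c w u rootgrp_carrier by auto
        have cS: "c \<in> SL_Z2 n" "w \<in> SL_Z2 n" "u \<in> SL_Z2 n" using c w u rootgrp_SL by auto
        have "y $$ (i, k) = w $$ (i, k)" if "i \<in> A1" "k \<in> A2" for i k
          using block_mult[OF c u cc(2) that] by (simp only: e)
        then have "supp (A1 \<times> A2) w = W" by (auto simp: supp_def W_def)
        then have w_eq: "w = uni W" using rootgrp_eq_uni[OF w subset_refl disjoint] by simp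
        define C where "C = supp (A2 \<times> A1) u"
        have C: "C \<subseteq> A2 \<times> A1" by (auto simp: C_def supp_def)
        have u_eq: "u = uni C"
          unfolding C_def by (rule rootgrp_eq_uni[OF u subset_refl]) (use disjoint in auto)
        have y_eq: "y = c * (uni W * uni C)"
          using e assoc_mult_mat[OF cc] by (simp only: w_eq u_eq)
        have WC: "uni W * uni C \<in> SL_Z2 n" by (rule rootgrp_SL[OF WCK[OF C]])
        have "(uni W * uni C) $$ (i, j) = y $$ (i, j)" if "i \<in> A1" "j \<in> A1" for i j
        proof -
          have ij: "i < n" "j < n" using that A1 by auto
          show ?thesis unfolding y_eq
            using S1_row[OF c that(1)]
            by (intro row_unit_mult[symmetric] cc(1) SL_carrier[OF WC] ij)
        qed
        then have "C \<in> V" using V_rows C by blast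
        moreover have "c = y * inv\<^bsub>SL\<^esub> (uni W * uni C)"
          using inv_solve_right[of c y "uni W * uni C"] cS(1) yK(2) WC y_eq by simp
        ultimately show "z \<in> h ` V"
          unfolding zz h_def w_eq u_eq by (intro image_eqI[of _ _ C]) simp_all
      qed
    qed
  qed
  then have "card V = card ?Z" by (rule bij_betw_same_card)
  moreover have V: "card V * 2 ^ (card A1 * card A1) = 2 ^ (card A1 * card A2)"
    unfolding V_def by (rule card_right_inverse_fibre[OF fin(1,2) s])
  moreover have "card V = card V * 2 ^ (card A1 * card A1) div 2 ^ (card A1 * card A1)"
    by (rule nonzero_mult_div_cancel_right[symmetric]) simp
  ultimately show ?thesis by (simp only:)
qed

lemma card_bad_le:
  assumes "card A1 \<le> card A2"
  shows "real (card (Pow (A1 \<times> A2) - full_rank A1 A2)) \<le> 2 ^ (card A1 * card A2) * (2 ^ card A1 / 2 ^ card A2)"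
proof -
  have sub: "full_rank A1 A2 \<subseteq> Pow (A1 \<times> A2)" by (auto simp: full_rank_def)
  have "card (Pow (A1 \<times> A2) - full_rank A1 A2) = card (Pow (A1 \<times> A2)) - card (full_rank A1 A2)"
    using finite_full_rank[OF fin(1,2)] sub by (intro card_Diff_subset) auto
  moreover have "card (full_rank A1 A2) \<le> card (Pow (A1 \<times> A2))"
    using fin sub by (intro card_mono) auto
  moreover have "card (Pow (A1 \<times> A2)) = 2 ^ (card A1 * card A2)"
    using fin by (simp add: card_Pow card_cartesian_product)
  ultimately have "real (card (Pow (A1 \<times> A2) - full_rank A1 A2)) = 2 ^ (card A1 * card A2) - real (card (full_rank A1 A2))"
    by (simp add: of_nat_diff)
  then show ?thesis
    using card_full_rank_ge[OF fin(1,2) assms] by (simp add: right_diff_distrib)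
qed

lemma good_iff_full_rank: "good x \<longleftrightarrow> supp (A1 \<times> A2) x \<in> full_rank A1 A2"
proof -
  have "of_bool ((i, k) \<in> supp (A1 \<times> A2) x) = x $$ (i, k)" if "i \<in> A1" "k \<in> A2" for i k
    by (rule bit_eqI) (use that in \<open>simp add: supp_def\<close>)
  then have "right_inverse A1 A2 (\<lambda>i k. of_bool ((i, k) \<in> supp (A1 \<times> A2) x)) s \<longleftrightarrow>
      right_inverse A1 A2 (\<lambda>i k. x $$ (i, k)) s" for s
    by (rule right_inverse_cong)
  moreover have "supp (A1 \<times> A2) x \<subseteq> A1 \<times> A2" by (auto simp: supp_def)
  ultimately show ?thesis unfolding good_def full_rank_def by blast
qed

lemma card_H_bad:
  assumes "card A1 \<le> card A2"
  shows "real (card (H - D)) \<le> 2 ^ card A1 / 2 ^ card A2 * real (card H)"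
proof -
  have "inj_on (supp (A1 \<times> A2)) (H - D)"
    by (rule inj_onI, rule mat_eq_supp[where T = "A1 \<times> A2"]) (auto simp: rootgrp_index rootgrp_carrier)
  moreover have "supp (A1 \<times> A2) ` (H - D) \<subseteq> Pow (A1 \<times> A2) - full_rank A1 A2"
    using good_iff_full_rank sub_K(3) by (auto simp: D_def supp_def)
  ultimately have "card (H - D) \<le> card (Pow (A1 \<times> A2) - full_rank A1 A2)"
    using fin by (intro card_inj_on_le) auto
  then have "real (card (H - D)) \<le> 2 ^ (card A1 * card A2) * (2 ^ card A1 / 2 ^ card A2)"
    using card_bad_le[OF assms] by linarith
  then show ?thesis using card_rootgrp_Times[OF A1 A2 disjoint] by (simp add: mult.commute)
qed

text \<open>All matrices on \<open>A\<close> with a bad block are counted, invertible or not; as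
  \<open>K\<close> contains at least a quarter of all matrices, this loses only a factor 4.\<close>

lemma card_K_bad:
  assumes "card A1 \<le> card A2"
  shows "real (card (K - D)) \<le> 2 ^ (card A * card A) * (2 ^ card A1 / 2 ^ card A2)"
proof -
  let ?X = "A1 \<times> A2" and ?B = "Pow (A1 \<times> A2) - full_rank A1 A2" and ?R = "A \<times> A - A1 \<times> A2"
  have "inj_on (\<lambda>x. (supp ?X x, supp ?R x)) (K - D)"
  proof (rule inj_onI)
    fix x y assume x: "x \<in> K - D" and y: "y \<in> K - D"
      and e: "(supp ?X x, supp ?R x) = (supp ?X y, supp ?R y)"
    have "supp (A \<times> A) z = supp ?X z \<union> supp ?R z" for z by (auto simp: supp_def)
    then have "supp (A \<times> A) x = supp (A \<times> A) y" using e by simp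
    then show "x = y"
      using x y by (intro mat_eq_supp[where T = "A \<times> A"]) (auto simp: rootgrp_index rootgrp_carrier)
  qed
  moreover have "(\<lambda>x. (supp ?X x, supp ?R x)) ` (K - D) \<subseteq> ?B \<times> Pow ?R"
    using good_iff_full_rank by (auto simp: D_def supp_def)
  ultimately have "card (K - D) \<le> card (?B \<times> Pow ?R)"
    using fin by (intro card_inj_on_le) auto
  also have "\<dots> = card ?B * 2 ^ (card A * card A - card A1 * card A2)"
  proof -
    have "card ?R = card A * card A - card A1 * card A2"
      using fin by (subst card_Diff_subset) (auto simp: card_cartesian_product)
    then show ?thesis using fin by (simp add: card_cartesian_product card_Pow)
  qed
  finally have "real (card (K - D)) \<le> real (card ?B) * 2 ^ (card A * card A - card A1 * card A2)"
    by (metis of_nat_le_iff of_nat_mult of_nat_numeral of_nat_power)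
  also have "\<dots> \<le> 2 ^ (card A1 * card A2) * (2 ^ card A1 / 2 ^ card A2) * 2 ^ (card A * card A - card A1 * card A2)"
    by (intro mult_right_mono card_bad_le assms) simp
  also have "\<dots> = (2 ^ (card A1 * card A2) * 2 ^ (card A * card A - card A1 * card A2)) * (2 ^ card A1 / 2 ^ card A2)"
    by simp
  also have "2 ^ (card A1 * card A2) * 2 ^ (card A * card A - card A1 * card A2) = (2::real) ^ (card A * card A)"
  proof -
    have "card A1 * card A2 \<le> card A * card A" unfolding card_A by (intro mult_le_mono) auto
    then show ?thesis by (simp add: power_add[symmetric])
  qed
  finally show ?thesis .
qed

text \<open>Both sides are compared with the number of all matrices on \<open>A\<close>. The 16 is a
  factor 4 for each of the two diagonal blocks, of which at least a quarter of the matrices are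
  invertible.\<close>

lemma card_K_le: "real (card K) \<le> 16 * real (card S1 * card S2)"
proof -
  have c: "card (rootgrp (X \<times> (X \<union> Y))) = card (rootgrp (X \<times> Y)) * card (rootgrp (X \<times> X))"
    if "X \<subseteq> {..<n}" "Y \<subseteq> {..<n}" "X \<inter> Y = {}" for X Y
    using bij_betw_same_card[OF rootgrp_row_decomposition[OF that]] by (simp add: card_cartesian_product)
  have c2: "real (card S2) = 2 ^ (card A1 * card A2) * real (card (rootgrp (A1 \<times> A1)))"
    using c[OF A1 A2 disjoint] card_rootgrp_Times[OF A1 A2 disjoint] by simp
  have c1: "real (card S1) = 2 ^ (card A1 * card A2) * real (card (rootgrp (A2 \<times> A2)))"
    using c[OF A2 A1] card_rootgrp_Times[OF A2 A1] disjoint by (simp add: Un_commute Int_commute mult.commute)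
  have "real (card K) \<le> 2 ^ (card A * card A)"
    using card_rootgrp_le[OF A_le] by (metis of_nat_le_iff of_nat_numeral of_nat_power)
  also have "\<dots> = 16 * ((2 ^ (card A1 * card A2) * (2 ^ (card A2 * card A2) / 4)) *
      (2 ^ (card A1 * card A2) * (2 ^ (card A1 * card A1) / 4)))"
    unfolding card_A by (simp add: power_add[symmetric] algebra_simps)
  also have "\<dots> \<le> 16 * (real (card S1) * real (card S2))"
    unfolding c1 c2 using card_rootgrp_ge[OF A1] card_rootgrp_ge[OF A2]
    by (intro mult_left_mono mult_mono) auto
  finally show ?thesis by simp
qed

lemma gap_two_blocks_le:
  assumes d: "card A1 + 28 \<le> card A2" and g: "\<And>y. y \<in> SL_Z2 n \<Longrightarrow> 0 < g y"
  shows "gap K g \<le> 3/2 * (gap S1 g + gap S2 g)"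
proof -
  define e where "e = (2::real) ^ card A1 / 2 ^ card A2"
  have e0: "0 \<le> e" by (simp add: e_def)
  \<comment> \<open>The correlation estimate below needs \<open>9 * e \<le> k\<^sup>2\<close>, where
    1/k = 4 (32^2 + 32 + 1) = 4228 for density bound 16. The least power of two above 9 times 4228^2
    is 2^28, which explains the imbalance 28.\<close>
  have e: "e \<le> 1 / 2 ^ 28"
  proof -
    have "(2::real) ^ (card A1 + 28) \<le> 2 ^ card A2" using d by (intro power_increasing) auto
    then show ?thesis by (simp add: e_def power_add field_simps)
  qed
  define k where "k = 1 / (4 * ((2 * 16)\<^sup>2 + 2 * 16 + 1) :: real)"
  have le: "card A1 \<le> card A2" using d by simp
  have finK: "finite K" using finite_subgroup[OF sub] .
  \<comment> \<open>The bad part is at most a fraction \<open>4 * e\<close> of \<open>K\<close>; as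
    this is at most one half, it is at most \<open>8 * e\<close> times the good part.\<close>
  have K_bad: "real (card (K - D)) \<le> 8 * e * real (card D)"
  proof -
    have 1: "real (card (K - D)) \<le> e * 4 * real (card K)"
      using card_K_bad[OF le] mult_left_mono[OF card_rootgrp_ge[OF A_le] e0]
      by (simp add: e_def[symmetric] mult.commute)
    also have "real (card K) = real (card D) + real (card (K - D))"
    proof -
      have "D \<subseteq> K" by (auto simp: D_def)
      then show ?thesis using finK by (metis card_Diff_subset card_mono finite_subset le_add_diff_inverse of_nat_add)
    qed
    finally have "real (card (K - D)) \<le> e * 4 * real (card D) + e * 4 * real (card (K - D))"
      by (simp add: distrib_left)
    moreover have "e * 4 * real (card (K - D)) \<le> 1 / 2 * real (card (K - D))"
      using e by (intro mult_right_mono) auto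
    ultimately show ?thesis by simp
  qed
  have triv: "S1 \<inter> S2 = {\<one>\<^bsub>SL\<^esub>}"
  proof -
    have "A2 \<times> A \<inter> A1 \<times> A = {}" using disjoint by auto
    then show ?thesis by (simp add: rootgrp_Int rootgrp_empty)
  qed
  have DH: "s * w * u \<in> D" if "s \<in> S1" "w \<in> H \<inter> D" "u \<in> U" for s w u
  proof -
    have "s * w * u \<in> K"
      using that sub_K subgroup.m_closed[OF sub[of A A]] by (auto simp: subset_iff)
    moreover have "good (s * w * u) \<longleftrightarrow> good w"
      using that rootgrp_carrier by (intro good_cong block_mult) auto
    ultimately show ?thesis using that by (auto simp: D_def)
  qed
  have corr: "(\<Sum>x\<in>K. (avg H phi x)\<^sup>2) \<le> k\<^sup>2 * (\<Sum>x\<in>K. (phi x)\<^sup>2)"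
    if phi: "\<And>s x. s \<in> S1 \<Longrightarrow> x \<in> K \<Longrightarrow> phi (s \<otimes>\<^bsub>SL\<^esub> x) = phi x" "(\<Sum>x\<in>K. phi x) = 0" for phi
  proof -
    have "(\<Sum>x\<in>K. (avg H phi x)\<^sup>2) \<le> (e + 8 * e) * (\<Sum>x\<in>K. (phi x)\<^sup>2)"
    proof (rule sum_avg_square_le[OF sub sub sub_K(1) sub sub_K(3) sub sub_K(6)])
      show "D \<subseteq> K" by (auto simp: D_def)
      show "real (card (H - D)) \<le> e * real (card H)" unfolding e_def by (rule card_H_bad[OF le])
    qed (use K_bad phi fibre_card DH in auto)
    also have "\<dots> \<le> k\<^sup>2 * (\<Sum>x\<in>K. (phi x)\<^sup>2)"
      using e by (intro mult_right_mono sum_nonneg) (auto simp: k_def power2_eq_square)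
    finally show ?thesis .
  qed
  show ?thesis
    by (rule block_factorization[OF sub sub sub_K(1) sub sub_K(2) triv _ card_K_le sub sub_K(5) k_def corr])
      (auto simp: g)
qed

end

section \<open>Induction on the number of rows\<close>

text \<open>Counts in two ways the \<open>a\<close>-subsets of an \<open>N\<close>-set together with
  an ordered pair of distinct elements in them.\<close>

lemma choose_pair_in:
  assumes "2 \<le> a" "a \<le> N"
  shows "real N * (real N - 1) * real ((N - 2) choose (a - 2)) = real a * (real a - 1) * real (N choose a)"
proof -
  obtain c M where cM: "a = Suc (Suc c)" "N = Suc (Suc M)"
  proof
    show "a = Suc (Suc (a - 2))" "N = Suc (Suc (N - 2))" using assms by arith+
  qed
  then have d: "a - 1 = Suc c" "a - 2 = c" "N - 1 = Suc M" "N - 2 = M" by auto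
  have "a * (a - 1) * (N choose a) = (a - 1) * (a * (N choose a))" by (simp only: ac_simps)
  also have "a * (N choose a) = N * ((N - 1) choose (a - 1))"
    unfolding d unfolding cM by (rule Suc_times_binomial)
  also have "(a - 1) * (N * ((N - 1) choose (a - 1))) = N * ((a - 1) * ((N - 1) choose (a - 1)))"
    by (simp only: ac_simps)
  also have "(a - 1) * ((N - 1) choose (a - 1)) = (N - 1) * ((N - 2) choose (a - 2))"
    unfolding d by (rule Suc_times_binomial)
  finally have "real (a * (a - 1) * (N choose a)) = real (N * ((N - 1) * ((N - 2) choose (a - 2))))"
    by (simp only:)
  then show ?thesis using assms by (simp add: of_nat_diff mult.assoc)
qed

text \<open>The exact proportion is (a (a - 1) + b (b - 1)) / (N (N - 1)) with N = a + b, which is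
  at most 3/5 once the imbalance \<open>d\<close> does not exceed \<open>a\<close>; the bounds by 29
  ensure this.\<close>

lemma card_subsets_same_side_le:
  fixes A :: "'a set"
  assumes fin: "finite A" and ij: "i \<in> A" "j \<in> A" "i \<noteq> j"
    and a: "29 \<le> a" "card A = a + b" "b = a + d" "d \<le> 29"
  shows "real (card {S. S \<subseteq> A \<and> card S = a \<and> (i \<in> S \<longleftrightarrow> j \<in> S)}) \<le> 3/5 * real (card A choose a)"
proof -
  let ?N = "card A" and ?B = "A - {i, j}"
  have cB: "card ?B = ?N - 2" using fin ij by (simp add: card_Diff_subset)
  let ?I = "{S. S \<subseteq> A \<and> card S = a \<and> i \<in> S \<and> j \<in> S}" and ?O = "{S. S \<subseteq> A \<and> card S = a \<and> i \<notin> S \<and> j \<notin> S}"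
  have "card ?I = card {S. S \<subseteq> ?B \<and> card S = a - 2}"
  proof (rule bij_betw_same_card[of "\<lambda>S. S - {i, j}"], rule bij_betw_byWitness[where f' = "\<lambda>S. S \<union> {i, j}"])
    show "(\<lambda>S. S - {i, j}) ` ?I \<subseteq> {S. S \<subseteq> ?B \<and> card S = a - 2}"
      using ij fin by (auto simp: card_Diff_subset)
    show "(\<lambda>S. S \<union> {i, j}) ` {S. S \<subseteq> ?B \<and> card S = a - 2} \<subseteq> ?I"
    proof (rule image_subsetI)
      fix S assume "S \<in> {S. S \<subseteq> ?B \<and> card S = a - 2}"
      then have S: "S \<subseteq> ?B" "card S = a - 2" by auto
      have "finite S" using S(1) fin finite_subset by blast
      then have "card (S \<union> {i, j}) = card S + card {i, j}" using S(1) by (intro card_Un_disjoint) auto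
      then show "S \<union> {i, j} \<in> ?I" using S ij a by auto
    qed
  qed auto
  also have "\<dots> = (?N - 2) choose (a - 2)" using n_subsets[of ?B "a - 2"] fin cB by simp
  finally have I: "card ?I = (?N - 2) choose (a - 2)" .
  have "?O = {S. S \<subseteq> ?B \<and> card S = a}" by auto
  then have "card ?O = (?N - 2) choose a" using n_subsets[of ?B a] fin cB by simp
  also have "\<dots> = (?N - 2) choose (b - 2)"
    using a binomial_symmetric[of a "?N - 2"] by (simp add: add_diff_assoc2)
  finally have O: "card ?O = (?N - 2) choose (b - 2)" .
  have "{S. S \<subseteq> A \<and> card S = a \<and> (i \<in> S \<longleftrightarrow> j \<in> S)} = ?I \<union> ?O" by auto
  then have m: "card {S. S \<subseteq> A \<and> card S = a \<and> (i \<in> S \<longleftrightarrow> j \<in> S)} \<le> card ?I + card ?O"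
    using card_Un_le[of ?I ?O] by (simp only:)
  have sym: "?N choose b = ?N choose a"
    using a binomial_symmetric[of a ?N] by simp
  let ?n = "real ?N" and ?t = "real (?N choose a)"
  have "?n * (?n - 1) * (real (card ?I) + real (card ?O)) = (real a * (real a - 1) + real b * (real b - 1)) * ?t"
    using choose_pair_in[of a ?N] choose_pair_in[of b ?N] a I O sym by (simp add: distrib_left distrib_right)
  also have "\<dots> \<le> (3/5 * (?n * (?n - 1))) * ?t"
  proof (rule mult_right_mono)
    have "real d * real d \<le> real a * real d" using a by (intro mult_right_mono) auto
    moreover have "0 \<le> real a * real a" by simp
    ultimately show "real a * (real a - 1) + real b * (real b - 1) \<le> 3/5 * (?n * (?n - 1))"
      unfolding a(2,3) by (simp only: of_nat_add algebra_simps)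
  qed simp
  finally have "?n * (?n - 1) * (real (card ?I) + real (card ?O)) \<le> ?n * (?n - 1) * (3/5 * ?t)"
    by (simp only: ac_simps)
  then have "real (card ?I) + real (card ?O) \<le> 3/5 * ?t"
    using a by (simp add: mult_le_cancel_left_pos)
  then show ?thesis using m by linarith
qed

context transvections
begin

section \<open>The recursion over splittings of the row set\<close>

lemma gap_row_le:
  assumes g: "\<And>y. y \<in> SL_Z2 n \<Longrightarrow> 0 < g y"
    and AB: "A \<subseteq> {..<n}" "B \<subseteq> {..<n}" "A \<inter> B = {}"
  shows "gap (rootgrp (A \<times> (A \<union> B))) g \<le> 4 * (\<Sum>p\<in>A \<times> B. energy g (uni {p})) + gap (rootgrp (A \<times> A)) g"
proof -
  have fin: "finite (A \<times> B)" using AB by (auto intro: finite_subset[OF _ finite_lessThan])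
  note sub = subgroup_rootgrp[OF trans_Times]
  have "gap (rootgrp (A \<times> (A \<union> B))) g \<le> gap (rootgrp (A \<times> B)) g + gap (rootgrp (A \<times> A)) g"
    using rootgrp_row_decomposition[OF AB] g by (intro gap_product_le sub) auto
  also have "gap (rootgrp (A \<times> B)) g \<le> 4 * (\<Sum>p\<in>A \<times> B. energy g (uni {p}))"
    using AB g by (intro gap_off_diagonal_le[OF _ fin subset_refl]) auto
  finally show ?thesis by simp
qed

text \<open>An opaque constant, to keep the simplifier from evaluating its powers.\<close>

definition small_card :: nat where
  "small_card = 200"

text \<open>The factors come from \<open>gap_le_sum_energy\<close>, from the order of the group and
  from \<open>energy_rootgrp_le\<close>.\<close>

definition gap_const :: real where
  "gap_const = 4 * 2 ^ (small_card * small_card) * 32 ^ small_card"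

text \<open>24 is the fixed point of c = 3/2 (3/5 c + 2/5 * 4); from there on the recursion does not
  increase the constant.\<close>

lemma gap_const_ge: "24 \<le> gap_const"
proof -
  have "(1::real) * 32 \<le> 2 ^ (small_card * small_card) * 32 ^ small_card"
  proof (intro mult_mono one_le_power self_le_power)
    show "0 < small_card" by (simp add: small_card_def)
  qed simp_all
  then show ?thesis by (simp add: gap_const_def)
qed

lemma gap_small_le:
  assumes g: "\<And>y. y \<in> SL_Z2 n \<Longrightarrow> 0 < g y" and A: "A \<subseteq> {..<n}" "card A \<le> small_card"
  shows "gap (rootgrp (A \<times> A)) g \<le> gap_const * (\<Sum>p\<in>pairs A. energy g (uni {p}))"
proof -
  let ?E = "\<Sum>p\<in>pairs A. energy g (uni {p})"
  have fin: "finite A" using A by (auto intro: finite_subset[OF _ finite_lessThan])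
  have E0: "0 \<le> ?E" by (auto intro: sum_nonneg energy_nonneg)
  have "gap (rootgrp (A \<times> A)) g \<le> 4 * (\<Sum>k\<in>rootgrp (A \<times> A). energy g k)"
    using g by (intro gap_le_sum_energy subgroup_rootgrp[OF trans_Times]) auto
  also have "\<dots> \<le> 4 * (real (card (rootgrp (A \<times> A))) * (32 ^ card A * ?E))"
    using energy_rootgrp_le[OF fin A(1)] by (intro mult_left_mono sum_bounded_above) auto
  also have "\<dots> \<le> 4 * (2 ^ (small_card * small_card) * (32 ^ small_card * ?E))"
  proof (intro mult_left_mono mult_mono mult_right_mono power_increasing)
    have "real (card (rootgrp (A \<times> A))) \<le> 2 ^ (card A * card A)"
      using card_rootgrp_le[OF A(1)] by (metis of_nat_le_iff of_nat_numeral of_nat_power)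
    also have "\<dots> \<le> 2 ^ (small_card * small_card)" using A(2) by (intro power_increasing mult_le_mono) auto
    finally show "real (card (rootgrp (A \<times> A))) \<le> 2 ^ (small_card * small_card)" .
  qed (use A E0 in auto)
  finally show ?thesis by (simp add: gap_const_def mult.assoc)
qed

text \<open>A pair across the splitting occurs in the off-diagonal block of exactly one of the two
  row groups and costs 4; a pair inside a part costs the inductive constant.\<close>

lemma gap_rootgrp_split_le:
  assumes g: "\<And>y. y \<in> SL_Z2 n \<Longrightarrow> 0 < g y" and A: "A \<subseteq> {..<n}"
    and S: "S \<subseteq> A" "card S + 28 \<le> card (A - S)"
    and IH: "\<And>B. B = S \<or> B = A - S \<Longrightarrow> gap (rootgrp (B \<times> B)) g \<le> c * (\<Sum>p\<in>pairs B. energy g (uni {p}))"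
  shows "gap (rootgrp (A \<times> A)) g \<le> 3/2 * (\<Sum>p\<in>pairs A. (if fst p \<in> S \<longleftrightarrow> snd p \<in> S then c else 4) * energy g (uni {p}))"
proof -
  let ?T = "A - S" and ?e = "\<lambda>p. energy g (uni {p})"
  interpret two_blocks n S ?T using A S by unfold_locales auto
  have fin: "finite S" "finite ?T" "finite A" using A S by (auto intro: finite_subset[OF _ finite_lessThan])
  have A_eq: "S \<union> ?T = A" "?T \<union> S = A" using S by auto
  have row1: "gap (rootgrp (S \<times> A)) g \<le> 4 * (\<Sum>p\<in>S \<times> ?T. ?e p) + gap (rootgrp (S \<times> S)) g"
    by (rule gap_row_le[of g S ?T, unfolded A_eq]) (use g A1 A2 disjoint in auto)
  have row2: "gap (rootgrp (?T \<times> A)) g \<le> 4 * (\<Sum>p\<in>?T \<times> S. ?e p) + gap (rootgrp (?T \<times> ?T)) g"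
    by (rule gap_row_le[of g ?T S, unfolded A_eq]) (use g A1 A2 disjoint in auto)
  have "gap (rootgrp (A \<times> A)) g \<le> 3/2 * (gap (rootgrp (?T \<times> A)) g + gap (rootgrp (S \<times> A)) g)"
    using gap_two_blocks_le[OF S(2), of g] g by (simp only: A_eq)
  also have "gap (rootgrp (S \<times> A)) g \<le> 4 * (\<Sum>p\<in>S \<times> ?T. ?e p) + c * (\<Sum>p\<in>pairs S. ?e p)"
    using row1 IH[of S] by simp
  also have "gap (rootgrp (?T \<times> A)) g \<le> 4 * (\<Sum>p\<in>?T \<times> S. ?e p) + c * (\<Sum>p\<in>pairs ?T. ?e p)"
    using row2 IH[of ?T] by simp
  finally have "gap (rootgrp (A \<times> A)) g \<le> 3/2 * ((4 * (\<Sum>p\<in>?T \<times> S. ?e p) + c * (\<Sum>p\<in>pairs ?T. ?e p)) +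
      (4 * (\<Sum>p\<in>S \<times> ?T. ?e p) + c * (\<Sum>p\<in>pairs S. ?e p)))" by simp
  also have "\<dots> = 3/2 * (c * (\<Sum>p\<in>pairs S \<union> pairs ?T. ?e p) + 4 * (\<Sum>p\<in>S \<times> ?T \<union> ?T \<times> S. ?e p))"
  proof -
    have "(\<Sum>p\<in>pairs S \<union> pairs ?T. ?e p) = (\<Sum>p\<in>pairs S. ?e p) + (\<Sum>p\<in>pairs ?T. ?e p)"
      using fin by (intro sum.union_disjoint finite_pairs) (auto simp: pairs_def)
    moreover have "(\<Sum>p\<in>S \<times> ?T \<union> ?T \<times> S. ?e p) = (\<Sum>p\<in>S \<times> ?T. ?e p) + (\<Sum>p\<in>?T \<times> S. ?e p)"
      using fin by (intro sum.union_disjoint) auto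
    ultimately show ?thesis by (simp add: algebra_simps)
  qed
  also have "pairs S \<union> pairs ?T = {p \<in> pairs A. fst p \<in> S \<longleftrightarrow> snd p \<in> S}"
    using S by (auto simp: pairs_def)
  also have "S \<times> ?T \<union> ?T \<times> S = {p \<in> pairs A. \<not> (fst p \<in> S \<longleftrightarrow> snd p \<in> S)}"
    using S by (auto simp: pairs_def)
  also have "c * (\<Sum>p\<in>{p \<in> pairs A. fst p \<in> S \<longleftrightarrow> snd p \<in> S}. ?e p) +
      4 * (\<Sum>p\<in>{p \<in> pairs A. \<not> (fst p \<in> S \<longleftrightarrow> snd p \<in> S)}. ?e p) =
      (\<Sum>p\<in>pairs A. (if fst p \<in> S \<longleftrightarrow> snd p \<in> S then c else 4) * ?e p)"
    using finite_pairs[OF fin(3)]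
    by (simp add: if_distrib[of "\<lambda>x. x * _"] sum.If_cases sum_distrib_left Int_def cong: if_cong)
  finally show ?thesis .
qed

lemma gap_rootgrp_le:
  assumes g: "\<And>y. y \<in> SL_Z2 n \<Longrightarrow> 0 < g y" and A: "A \<subseteq> {..<n}"
  shows "gap (rootgrp (A \<times> A)) g \<le> gap_const * (\<Sum>p\<in>pairs A. energy g (uni {p}))"
  using A
proof (induction "card A" arbitrary: A rule: less_induct)
  case less
  show ?case
  proof (cases "card A \<le> small_card")
    case True
    then show ?thesis by (intro gap_small_le g less.prems)
  next
    case False
    let ?e = "\<lambda>p. energy g (uni {p})" and ?c = gap_const and ?N = "card A"
    have fin: "finite A" using less.prems by (auto intro: finite_subset[OF _ finite_lessThan])
    \<comment> \<open>The sides then differ by 28 or 29 according to the parity of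
      \<open>card A\<close>, within the range that both \<open>gap_two_blocks_le\<close> and
      \<open>card_subsets_same_side_le\<close> accept.\<close>
    define a where "a = (?N - 28) div 2"
    define b where "b = ?N - a"
    define d where "d = b - a"
    have ab: "29 \<le> a" "?N = a + b" "b = a + d" "d \<le> 29" "a + 28 \<le> b" "a < ?N" "b < ?N"
      using False by (auto simp: a_def b_def d_def small_card_def)
    define F where "F = {S. S \<subseteq> A \<and> card S = a}"
    define t where "t = real (?N choose a)"
    have finF: "finite F" using fin by (simp add: F_def)
    have cF: "real (card F) = t" using n_subsets[OF fin, of a] by (simp add: F_def t_def)
    have t0: "0 < t" using ab by (simp add: t_def)
    have each: "gap (rootgrp (A \<times> A)) g \<le> 3/2 * (\<Sum>p\<in>pairs A. (if fst p \<in> S \<longleftrightarrow> snd p \<in> S then ?c else 4) * ?e p)"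
      if S: "S \<in> F" for S
    proof (rule gap_rootgrp_split_le[OF g less.prems])
      have cS: "S \<subseteq> A" "card S = a" "card (A - S) = b"
        using S fin ab by (auto simp: F_def b_def card_Diff_subset finite_subset)
      then show "S \<subseteq> A" "card S + 28 \<le> card (A - S)" using ab by auto
      fix B assume "B = S \<or> B = A - S"
      then show "gap (rootgrp (B \<times> B)) g \<le> ?c * (\<Sum>p\<in>pairs B. ?e p)"
        using cS ab less.prems by (intro less.hyps) auto
    qed
    have "t * gap (rootgrp (A \<times> A)) g = (\<Sum>S\<in>F. gap (rootgrp (A \<times> A)) g)"
      by (simp add: cF)
    also have "\<dots> \<le> (\<Sum>S\<in>F. 3/2 * (\<Sum>p\<in>pairs A. (if fst p \<in> S \<longleftrightarrow> snd p \<in> S then ?c else 4) * ?e p))"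
      by (intro sum_mono each)
    also have "\<dots> = 3/2 * (\<Sum>p\<in>pairs A. (\<Sum>S\<in>F. if fst p \<in> S \<longleftrightarrow> snd p \<in> S then ?c else 4) * ?e p)"
      unfolding sum_distrib_left[symmetric] sum_distrib_right by (subst sum.swap) (rule refl)
    \<comment> \<open>The average weight of a pair is at most 3/5 c + 2/5 * 4, which is at most 2/3
      c because c is at least 24; the 2/3 cancels the factor 3/2.\<close>
    also have "\<dots> \<le> 3/2 * (\<Sum>p\<in>pairs A. (2/3 * t * ?c) * ?e p)"
    proof (intro mult_left_mono sum_mono mult_right_mono energy_nonneg)
      fix p assume "p \<in> pairs A"
      then have p: "fst p \<in> A" "snd p \<in> A" "fst p \<noteq> snd p" by (auto simp: pairs_def)
      define m where "m = real (card {S \<in> F. fst p \<in> S \<longleftrightarrow> snd p \<in> S})"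
      have m: "m \<le> 3/5 * t"
        using card_subsets_same_side_le[OF fin p ab(1-4)] by (simp add: m_def F_def t_def conj_assoc)
      have "(\<Sum>S\<in>F. if fst p \<in> S \<longleftrightarrow> snd p \<in> S then ?c else 4) =
          (\<Sum>S\<in>F. 4 + (if fst p \<in> S \<longleftrightarrow> snd p \<in> S then ?c - 4 else 0))"
        by (intro sum.cong) auto
      also have "\<dots> = 4 * t + m * (?c - 4)"
        using finF by (simp add: sum.distrib cF sum.inter_filter[symmetric] m_def)
      also have "m * (?c - 4) \<le> 3/5 * t * (?c - 4)"
        using m gap_const_ge by (intro mult_right_mono) auto
      also have "4 * t + 3/5 * t * (?c - 4) \<le> 2/3 * t * ?c"
      proof -
        have "t * 24 \<le> t * ?c" using gap_const_ge t0 by (intro mult_left_mono) auto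
        moreover have "3/5 * t * (?c - 4) = 3/5 * (t * ?c) - 12/5 * t" by (simp add: field_simps)
        ultimately show ?thesis by linarith
      qed
      finally show "(\<Sum>S\<in>F. if fst p \<in> S \<longleftrightarrow> snd p \<in> S then ?c else 4) \<le> 2/3 * t * ?c" by simp
    qed simp
    also have "\<dots> = t * (?c * (\<Sum>p\<in>pairs A. ?e p))"
      by (simp add: sum_distrib_left ac_simps)
    finally show ?thesis using t0 by (simp add: mult_le_cancel_left_pos)
  qed
qed

end

section \<open>The logarithmic Sobolev constant\<close>

text \<open>For each function the inequality is a closed condition on the constant, so the infimum
  of the admissible constants is admissible. The function of positive entropy rules out the infimum
  0.\<close>

lemma log_sobolev_constant_exists:
  assumes P: "\<And>x y. 0 \<le> P x y" and p: "\<And>x. 0 \<le> p x"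
    and c0: "0 < c0" "log_sobolev_inequality S p P c0" and f: "0 < Ent S p (\<lambda>x. (f x)\<^sup>2)"
  shows "\<exists>C. is_log_sobolev_constant S p P C \<and> C \<le> c0"
proof -
  define V where "V = {c. 0 < c \<and> log_sobolev_inequality S p P c}"
  have V: "c0 \<in> V" using c0 by (simp add: V_def)
  have E0: "0 \<le> dirichlet_form S p P h" for h
    unfolding dirichlet_form_def using P p by (intro mult_nonneg_nonneg sum_nonneg) auto
  have le: "Ent S p (\<lambda>x. (h x)\<^sup>2) \<le> c * dirichlet_form S p P h" if "c \<in> V" for c h
    using that by (simp add: V_def log_sobolev_inequality_def)
  have bdd: "bdd_below V" by (rule bdd_belowI[of _ 0]) (auto simp: V_def)
  let ?C = "Inf V"
  have lsi: "log_sobolev_inequality S p P ?C"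
    unfolding log_sobolev_inequality_def
  proof
    fix h
    show "Ent S p (\<lambda>x. (h x)\<^sup>2) \<le> ?C * dirichlet_form S p P h"
    proof (cases "dirichlet_form S p P h = 0")
      case True
      then show ?thesis using le[OF V, of h] by simp
    next
      case False
      then have pos: "0 < dirichlet_form S p P h" using E0[of h] by simp
      have "Ent S p (\<lambda>x. (h x)\<^sup>2) / dirichlet_form S p P h \<le> ?C"
        using V le pos by (intro cInf_greatest) (auto simp: pos_divide_le_eq)
      then show ?thesis using pos by (simp add: pos_divide_le_eq)
    qed
  qed
  have "0 \<le> ?C" using V by (intro cInf_greatest) (auto simp: V_def)
  moreover have "?C \<noteq> 0"
  proof
    assume "?C = 0"
    then have "Ent S p (\<lambda>x. (f x)\<^sup>2) \<le> 0" using lsi by (simp add: log_sobolev_inequality_def)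
    then show False using f by simp
  qed
  ultimately have "is_log_sobolev_constant S p P ?C"
    using lsi bdd by (auto simp: is_log_sobolev_constant_def V_def intro!: cInf_lower)
  moreover have "?C \<le> c0" by (rule cInf_lower[OF V bdd])
  ultimately show ?thesis by blast
qed

section \<open>From strictly positive functions to arbitrary ones\<close>

lemma tendsto_add_mult_ln:
  fixes c :: real
  assumes "0 \<le> c"
  shows "((\<lambda>e. (c + e) * ln (c + e)) \<longlongrightarrow> c * ln c) (at_right 0)"
proof (cases "c = 0")
  case True
  have "((\<lambda>e::real. e * ln e) \<longlongrightarrow> 0) (at_right 0)" by real_asymp
  then show ?thesis using True by simp
next
  case False
  then have "((\<lambda>e. (c + e) * ln (c + e)) \<longlongrightarrow> (c + 0) * ln (c + 0)) (at_right 0)"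
    using assms by (intro tendsto_intros) auto
  then show ?thesis by simp
qed

lemma Ent_add_tendsto:
  assumes p: "\<And>x. 0 \<le> p x" "(\<Sum>x\<in>S. p x) = 1" and g: "\<And>x. 0 \<le> g x"
  shows "((\<lambda>e. Ent S p (\<lambda>x. g x + e)) \<longlongrightarrow> Ent S p g) (at_right 0)"
proof -
  have "expect S p (\<lambda>x. g x + e) = expect S p g + e" for e
    using p(2) by (simp add: expect_def distrib_left sum.distrib sum_distrib_right[symmetric])
  moreover have "0 \<le> expect S p g" unfolding expect_def using p g by (intro sum_nonneg) auto
  ultimately have 1: "((\<lambda>e. expect S p (\<lambda>x. g x + e) * ln (expect S p (\<lambda>x. g x + e)))
      \<longlongrightarrow> expect S p g * ln (expect S p g)) (at_right 0)"
    using tendsto_add_mult_ln by simp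
  have "((\<lambda>e. \<Sum>x\<in>S. p x * ((g x + e) * ln (g x + e))) \<longlongrightarrow> (\<Sum>x\<in>S. p x * (g x * ln (g x)))) (at_right 0)"
    by (intro tendsto_sum tendsto_mult_left tendsto_add_mult_ln g)
  then have 2: "((\<lambda>e. expect S p (\<lambda>x. (g x + e) * ln (g x + e))) \<longlongrightarrow> expect S p (\<lambda>x. g x * ln (g x))) (at_right 0)"
    by (simp add: expect_def)
  from tendsto_diff[OF 2 1] show ?thesis by (simp add: Ent_def)
qed

text \<open>The map taking a to sqrt (a^2 + e) is 1-Lipschitz, by Cauchy-Schwarz for (a, sqrt e) and
  (b, sqrt e). So adding \<open>e\<close> to f^2, which makes it strictly positive, does not
  increase the energies.\<close>

lemma sqrt_add_diff_square_le:
  fixes a b e :: real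
  assumes "0 \<le> e"
  shows "(sqrt (a\<^sup>2 + e) - sqrt (b\<^sup>2 + e))\<^sup>2 \<le> (a - b)\<^sup>2"
proof -
  have pos: "0 \<le> a\<^sup>2 + e" "0 \<le> b\<^sup>2 + e" using assms by auto
  have "(a * b + e)\<^sup>2 \<le> (a\<^sup>2 + e) * (b\<^sup>2 + e)"
  proof -
    have "(a\<^sup>2 + e) * (b\<^sup>2 + e) - (a * b + e)\<^sup>2 = e * (a - b)\<^sup>2"
      by (simp add: power2_eq_square algebra_simps)
    moreover have "0 \<le> e * (a - b)\<^sup>2" using assms by simp
    ultimately show ?thesis by linarith
  qed
  then have "a * b + e \<le> sqrt (a\<^sup>2 + e) * sqrt (b\<^sup>2 + e)"
    by (simp add: real_le_rsqrt real_sqrt_mult[symmetric])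
  moreover have "(sqrt (a\<^sup>2 + e) - sqrt (b\<^sup>2 + e))\<^sup>2 = (a\<^sup>2 + e) + (b\<^sup>2 + e) - 2 * (sqrt (a\<^sup>2 + e) * sqrt (b\<^sup>2 + e))"
    using pos by (simp add: power2_diff)
  ultimately show ?thesis by (simp add: power2_diff)
qed

context transvections
begin

section \<open>The walk in terms of the group\<close>

lemma uni_singleton: "1\<^sub>m n + elem_mat n i j = uni {(i, j)}"
  by (intro eq_matI) (auto simp: elem_mat_def uni_def)

lemma rootgrp_UNIV: "rootgrp ({..<n} \<times> {..<n}) = SL_Z2 n"
  by (auto simp: rootgrp_def)

lemma uni_singleton_SL: "p \<in> pairs {..<n} \<Longrightarrow> uni {p} \<in> SL_Z2 n"
  by (cases p) (auto simp: pairs_def intro!: rootgrp_SL[OF uni_rootgrp[of _ "{p}" "{fst p}" "{snd p}"]])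

text \<open>\<open>transvection_P\<close> only asks whether some pair leads to \<open>y\<close>.
  Cancelling \<open>x\<close> shows that distinct pairs lead to distinct matrices, so the sum over
  pairs has no multiplicities.\<close>

lemma sum_transvection_P:
  assumes x: "x \<in> SL_Z2 n"
  shows "(\<Sum>y\<in>SL_Z2 n. transvection_P n x y * F y) = (\<Sum>p\<in>pairs {..<n}. F (uni {p} * x)) / (real n * (real n - 1))"
proof -
  let ?T = "(\<lambda>p. uni {p} * x) ` pairs {..<n}"
  have inj: "inj_on (\<lambda>p. uni {p} * x) (pairs {..<n})"
  proof (rule inj_onI)
    fix p q assume p: "p \<in> pairs {..<n}" and q: "q \<in> pairs {..<n}" and e: "uni {p} * x = uni {q} * x"
    have "uni {p} = uni {q}"
      using right_cancel[of x "uni {p}" "uni {q}"] e x uni_singleton_SL[OF p] uni_singleton_SL[OF q] by simp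
    moreover have "fst p < n" "snd p < n" "fst p \<noteq> snd p" using p by (auto simp: pairs_def)
    ultimately have "of_bool (p \<in> {p}) = (of_bool (p \<in> {q}) :: bit)"
      using uni_index_off[of "fst p" "snd p"] by (metis prod.collapse)
    then show "p = q" by (cases "p = q") simp_all
  qed
  have T: "?T \<subseteq> SL_Z2 n"
    using m_closed[of _ x] x uni_singleton_SL by auto
  have P: "transvection_P n x y = (if y \<in> ?T then 1 / (real n * (real n - 1)) else 0)" for y
    unfolding transvection_P_def uni_singleton by (rule if_cong) (auto simp: pairs_def)
  have "(\<Sum>y\<in>SL_Z2 n. transvection_P n x y * F y) = (\<Sum>y\<in>?T. transvection_P n x y * F y)"
    using T finite_SL by (intro sum.mono_neutral_right) (auto simp: P)
  also have "\<dots> = (\<Sum>y\<in>?T. F y / (real n * (real n - 1)))"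
    by (intro sum.cong) (auto simp: P)
  also have "\<dots> = (\<Sum>p\<in>pairs {..<n}. F (uni {p} * x)) / (real n * (real n - 1))"
    by (simp add: sum.reindex[OF inj] sum_divide_distrib)
  finally show ?thesis .
qed

lemma card_SL_pos: "0 < card (SL_Z2 n)"
  using card_subgroup_pos[OF subgroup_self] by simp

lemma dirichlet_form_SL:
  "dirichlet_form (SL_Z2 n) (unif (SL_Z2 n)) (transvection_P n) f =
    (\<Sum>p\<in>pairs {..<n}. \<Sum>x\<in>SL_Z2 n. (f x - f (uni {p} * x))\<^sup>2) /
    (2 * real (card (SL_Z2 n)) * (real n * (real n - 1)))"
proof -
  let ?N = "real (card (SL_Z2 n))"
  have "dirichlet_form (SL_Z2 n) (unif (SL_Z2 n)) (transvection_P n) f =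
      1 / 2 * (\<Sum>x\<in>SL_Z2 n. (\<Sum>y\<in>SL_Z2 n. transvection_P n x y * (f x - f y)\<^sup>2) / ?N)"
    by (simp add: dirichlet_form_def unif_def sum_divide_distrib)
  also have "\<dots> = 1 / 2 * (\<Sum>x\<in>SL_Z2 n. (\<Sum>p\<in>pairs {..<n}. (f x - f (uni {p} * x))\<^sup>2) / (real n * (real n - 1)) / ?N)"
    by (simp add: sum_transvection_P)
  also have "\<dots> = (\<Sum>x\<in>SL_Z2 n. \<Sum>p\<in>pairs {..<n}. (f x - f (uni {p} * x))\<^sup>2) / (2 * ?N * (real n * (real n - 1)))"
    by (simp add: sum_divide_distrib[symmetric] ac_simps)
  also have "(\<Sum>x\<in>SL_Z2 n. \<Sum>p\<in>pairs {..<n}. (f x - f (uni {p} * x))\<^sup>2) =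
      (\<Sum>p\<in>pairs {..<n}. \<Sum>x\<in>SL_Z2 n. (f x - f (uni {p} * x))\<^sup>2)"
    by (rule sum.swap)
  finally show ?thesis .
qed

lemma Ent_SL_eq: "Ent (SL_Z2 n) (unif (SL_Z2 n)) g = gap (SL_Z2 n) g / real (card (SL_Z2 n))"
proof -
  let ?N = "real (card (SL_Z2 n))"
  have "avg (SL_Z2 n) g x = expect (SL_Z2 n) (unif (SL_Z2 n)) g" if "x \<in> SL_Z2 n" for x
    using sum_right_translate[OF subgroup_self, of x g] that
    by (simp add: avg_def expect_def unif_def sum_divide_distrib)
  then have "gap (SL_Z2 n) g = (\<Sum>x\<in>SL_Z2 n. g x * ln (g x)) -
      ?N * (expect (SL_Z2 n) (unif (SL_Z2 n)) g * ln (expect (SL_Z2 n) (unif (SL_Z2 n)) g))"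
    by (simp add: gap_def sum_subtractf)
  then show ?thesis
    using card_SL_pos by (simp add: Ent_def expect_def unif_def sum_divide_distrib[symmetric] field_simps)
qed

text \<open>Entropy and Dirichlet form share the normalization by the order of the group. What
  remains is the probability 1 / (n (n - 1)) of a transvection, the source of the square, and the
  1/2 in the Dirichlet form.\<close>

lemma log_sobolev_SL:
  assumes n: "2 \<le> n"
  shows "log_sobolev_inequality (SL_Z2 n) (unif (SL_Z2 n)) (transvection_P n) (2 * gap_const * (real n)\<^sup>2)"
  unfolding log_sobolev_inequality_def
proof
  fix f :: "bit mat \<Rightarrow> real"
  let ?N = "real (card (SL_Z2 n))" and ?D = "dirichlet_form (SL_Z2 n) (unif (SL_Z2 n)) (transvection_P n) f"
  let ?E = "\<Sum>p\<in>pairs {..<n}. \<Sum>x\<in>SL_Z2 n. (f x - f (uni {p} * x))\<^sup>2"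
  have N: "0 < ?N" using card_SL_pos by simp
  have c0: "0 \<le> gap_const" using gap_const_ge by simp
  have E0: "0 \<le> ?E" by (intro sum_nonneg) auto
  have "Ent (SL_Z2 n) (unif (SL_Z2 n)) (\<lambda>x. (f x)\<^sup>2 + e) \<le> gap_const * ?E / ?N" if e: "0 < e" for e
  proof -
    let ?g = "\<lambda>x. (f x)\<^sup>2 + e"
    have "gap (SL_Z2 n) ?g \<le> gap_const * (\<Sum>p\<in>pairs {..<n}. energy ?g (uni {p}))"
      using gap_rootgrp_le[of ?g "{..<n}"] e by (simp add: rootgrp_UNIV add_nonneg_pos)
    also have "\<dots> \<le> gap_const * ?E"
      using sqrt_add_diff_square_le[OF less_imp_le[OF e]] c0
      by (intro mult_left_mono sum_mono) (simp_all add: energy_def sum_mono)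
    finally show ?thesis unfolding Ent_SL_eq using N by (intro divide_right_mono) auto
  qed
  then have ev: "\<forall>\<^sub>F e in at_right 0. Ent (SL_Z2 n) (unif (SL_Z2 n)) (\<lambda>x. (f x)\<^sup>2 + e) \<le> gap_const * ?E / ?N"
    by (auto simp: eventually_at_right_field intro: exI[of _ 1])
  have "Ent (SL_Z2 n) (unif (SL_Z2 n)) (\<lambda>x. (f x)\<^sup>2) \<le> gap_const * ?E / ?N"
    using N by (intro tendsto_upperbound[OF Ent_add_tendsto ev]) (auto simp: unif_def)
  also have "\<dots> = (2 * gap_const * (real n * (real n - 1))) * ?D"
    unfolding dirichlet_form_SL using n by simp
  also have "\<dots> \<le> (2 * gap_const * (real n)\<^sup>2) * ?D"
  proof (rule mult_right_mono)
    show "2 * gap_const * (real n * (real n - 1)) \<le> 2 * gap_const * (real n)\<^sup>2"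
      using c0 by (intro mult_left_mono) (auto simp: power2_eq_square algebra_simps)
    show "0 \<le> ?D" unfolding dirichlet_form_SL using E0 n by (intro divide_nonneg_nonneg) auto
  qed
  finally show "Ent (SL_Z2 n) (unif (SL_Z2 n)) (\<lambda>x. (f x)\<^sup>2) \<le> 2 * gap_const * (real n)\<^sup>2 * ?D" .
qed

text \<open>Supplies the function that keeps the optimal constant away from 0. A point mass has
  entropy ln N / N, with N the order of the group, and N is at least 2 because a transvection
  differs from the identity.\<close>

lemma Ent_indicator_pos:
  assumes n: "2 \<le> n"
  shows "0 < Ent (SL_Z2 n) (unif (SL_Z2 n)) (\<lambda>x. (of_bool (x = 1\<^sub>m n))\<^sup>2)"
proof -
  let ?N = "real (card (SL_Z2 n))"
  have one: "1\<^sub>m n \<in> SL_Z2 n" using one_closed by simp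
  have p: "(0, 1) \<in> pairs {..<n}" using n by (auto simp: pairs_def)
  have "uni {(0, 1)} \<noteq> 1\<^sub>m n"
  proof
    assume "uni {(0, 1)} = 1\<^sub>m n"
    then show False using uni_index_off[of 0 1 "{(0, 1)}"] n by simp
  qed
  then have "card {1\<^sub>m n, uni {(0, 1)}} = 2" by simp
  moreover have "card {1\<^sub>m n, uni {(0, 1)}} \<le> card (SL_Z2 n)"
    using one uni_singleton_SL[OF p] by (intro card_mono finite_SL) auto
  ultimately have N: "2 \<le> ?N" by simp
  have 1: "expect (SL_Z2 n) (unif (SL_Z2 n)) (\<lambda>x. (of_bool (x = 1\<^sub>m n))\<^sup>2) = 1 / ?N"
  proof -
    have "expect (SL_Z2 n) (unif (SL_Z2 n)) (\<lambda>x. (of_bool (x = 1\<^sub>m n))\<^sup>2) =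
        (\<Sum>x\<in>SL_Z2 n. if x = 1\<^sub>m n then 1 / ?N else 0)"
      unfolding expect_def unif_def by (intro sum.cong) auto
    then show ?thesis using one finite_SL by simp
  qed
  have 2: "expect (SL_Z2 n) (unif (SL_Z2 n)) (\<lambda>x. (of_bool (x = 1\<^sub>m n))\<^sup>2 * ln ((of_bool (x = 1\<^sub>m n))\<^sup>2)) = 0"
    unfolding expect_def by (intro sum.neutral) auto
  have "Ent (SL_Z2 n) (unif (SL_Z2 n)) (\<lambda>x. (of_bool (x = 1\<^sub>m n))\<^sup>2) = ln ?N / ?N"
    unfolding Ent_def 1 2 using N by (simp add: ln_div)
  also have "\<dots> > 0" using N by simp
  finally show ?thesis .
qed

end

theorem proposition2:
  shows "\<exists>c::real. c > 0 \<and>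
    (\<forall>n::nat. n \<ge> 2 \<longrightarrow>
      (\<exists>C::real. is_log_sobolev_constant (SL_Z2 n) (unif (SL_Z2 n)) (transvection_P n) C \<and>
                 C \<le> c * (real n)\<^sup>2))"
proof (rule exI[of _ "2 * transvections.gap_const"], intro conjI allI impI)
  \<comment> \<open>\<open>gap_const\<close> does not involve the locale parameter \<open>n\<close>,
    so outside the locale it takes no argument; this makes the bound uniform in
    \<open>n\<close>.\<close>
  show "0 < 2 * transvections.gap_const" using transvections.gap_const_ge by simp
  fix n :: nat assume n: "2 \<le> n"
  interpret transvections n .
  show "\<exists>C. is_log_sobolev_constant (SL_Z2 n) (unif (SL_Z2 n)) (transvection_P n) C \<and> C \<le> 2 * gap_const * (real n)\<^sup>2"
  proof (rule log_sobolev_constant_exists[OF _ _ _ log_sobolev_SL[OF n] Ent_indicator_pos[OF n]])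
    show "0 < 2 * gap_const * (real n)\<^sup>2" using gap_const_ge n by simp
    show "0 \<le> transvection_P n x y" for x y using n by (simp add: transvection_P_def)
    show "0 \<le> unif (SL_Z2 n) x" for x by (simp add: unif_def)
  qed
qed

end
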